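(* In the singular control setting of the context (Assumptions 1–4 in force), if $\theta^*\in\mathcal{A}$ is an optimal control for the problem $\inf_{\theta\in\mathcal{A}}J(\theta)$, then $\theta^*$ is flat off the set $$\{t\ge0\,:\,DJ(\theta^* )_t=S(\theta^* )_t\},$$ where the process $S(\theta^* )$ is the "Snell envelope" of $DJ(\theta^* )$, i.e. $$S(\theta^* )_\tau=\operatorname*{ess\,inf}_{\sigma\ge\tau}E_x\left[DJ(\theta^* )_\sigma e^{-r(\sigma-\tau)}\,\big|\,\mathcal{F}_\tau\right]$$ for all stopping times $\tau$ (the essential infimum being over stopping times $\sigma\ge\tau$).
   Context: Setting. $(\Omega,\mathcal{F},\mathbb{F}=(\mathcal{F}_t)_{t\ge0},(P_x)_{x\in\mathbb{R}})$ are filtered probability spaces, $X=(X_t)_{t\ge 0}$ is a real-valued $\mathbb{F}$-adapted Lévy process with $X_0=x$ under $P_x$, $E_x$ is expectation under $P_x$, $r>0$ is a constant, and $x\in\mathbb{R}$ is fixed. Stopping times are with respect to $\mathbb{F}$ and may take the value $+\infty$, where discounted quantities $DJ(\theta)_\sigma e^{-r\sigma}$ are read as $0$. Controls. A singular control $\theta$ is an increasing (i.e. nondecreasing) adapted càdlàg process with $\theta_{0-}=0$ and $\left\|\int_0^\infty e^{-rt}\,d\theta_t\right\|_{L^2(P_x)}<\infty$; $\mathcal{A}$ is the set of all singular controls. Integrals $\int_0^\infty\cdot\,d\theta_t$ are over $[0,\infty)$ and include the jump of $\theta$ at time $0$. "$\theta$ is flat off a (random) set $\Gamma\subset[0,\infty)$"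 means $\theta$ increases only on $\Gamma$, i.e. $\int_0^\infty \mathbb{I}_{\{t\notin\Gamma\}}\,d\theta_t=0$ $P_x$-a.s. Costs. $k=(k_t)_{t\ge0}$ is the intervention cost process and $c:(t,x,\theta)\mapsto c(t,x,\theta)\in\mathbb{R}$ is a deterministic running cost function ($t\ge0$, $x\in\mathbb{R}$, $\theta\ge0$); neither $k$ nor $X$ depends on the control. Assumption 1: $k$ is a positive adapted càdlàg process with $E_x[\sup_{t\ge0}|k_t|^2]<\infty$. Assumption 2: for each $(t,x)$ the map $\theta\mapsto c(t,x,\theta)$ has a continuous, strictly increasing first derivative $c_\theta(t,x,\theta)$, and this derivative is bounded, uniformly in $t$ and $x$. Assumption 3: there is $y\in\mathbb{R}_+$ such that for all $x\in\mathbb{R}$, $E_x[\int_0^\infty c(t,X_t,y)e^{-rt}\,dt]<+\infty$. Assumption 4: with $C(t,x,k)=\inf_{z\ge0}(c(t,x,z)+rkz)$, one has $E_x[\int_0^\infty C(t,X_t,k_t)e^{-rt}\,dt]>-\infty$. Objective. For $\theta\in\mathcal{A}$, $$J(\theta)=E_x\left[\int_0^\infty c(t,X_t,\theta_t)e^{-rt}\,dt+\int_0^\infty k_te^{-rt}\,d\theta_t\right]\in\mathbb{R}\cup\{+\infty\}.$$ A control is optimal if it attains $\inf_{\theta\in\mathcal{A}}J(\theta)$. Subgradient process. For $\theta\in\mathcal{A}$, $p^\theta_s=E_x\left[\int_s^\infty c_\theta(u,X_u,\theta_u)e^{-r(u-s)}\,du\,\big|\,\mathcal{F}_s\right]$ (càdlàg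 version) and $DJ(\theta)_t=k_t+p^\theta_t$ for $t\ge0$. *)

theory Defs
  imports "HOL-Probability.Probability"
begin

section \<open>Processes, filtrations and stopping times\<close>

text \<open>Processes are functions of type \<open>real \<Rightarrow> 'a \<Rightarrow> real\<close>, and filtrations are functions of type
  \<open>real \<Rightarrow> 'a measure\<close>; only their values at times \<open>t \<ge> 0\<close> matter.\<close>

definition adapted :: "(real \<Rightarrow> 'a measure) \<Rightarrow> (real \<Rightarrow> 'a \<Rightarrow> real) \<Rightarrow> bool" where
  "adapted F Y \<longleftrightarrow> (\<forall>t\<ge>0. Y t \<in> borel_measurable (F t))"

definition progressive :: "(real \<Rightarrow> 'a measure) \<Rightarrow> (real \<Rightarrow> 'a \<Rightarrow> real) \<Rightarrow> bool" where
  "progressive F Y \<longleftrightarrow>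
     (\<forall>t\<ge>0. (\<lambda>(s, \<omega>). Y s \<omega>) \<in> borel_measurable (restrict_space borel {0..t} \<Otimes>\<^sub>M F t))"

definition cadlag :: "(real \<Rightarrow> real) \<Rightarrow> bool" where
  "cadlag f \<longleftrightarrow> (\<forall>t\<ge>0. continuous (at_right t) f) \<and> (\<forall>t>0. \<exists>l. (f \<longlongrightarrow> l) (at_left t))"

definition cadlag_process :: "'a measure \<Rightarrow> (real \<Rightarrow> 'a \<Rightarrow> real) \<Rightarrow> bool" where
  "cadlag_process M Y \<longleftrightarrow> (\<forall>\<omega>\<in>space M. cadlag (\<lambda>t. Y t \<omega>))"

text \<open>Stopping times take values in \<open>[0, \<infinity>]\<close>. To apply the library's notion \<^const>\<open>stopping_time\<close>
  and its stopped sigma-algebra \<open>filtration.pre_sigma\<close> to them, the filtration is extended to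
  \<open>[0, \<infinity>]\<close> by the sigma-algebra generated by all \<open>F t\<close> with \<open>t \<ge> 0\<close>.\<close>

definition ext_filtration :: "'a measure \<Rightarrow> (real \<Rightarrow> 'a measure) \<Rightarrow> ennreal \<Rightarrow> 'a measure" where
  "ext_filtration M F t =
     (if t = \<infinity> then sigma (space M) (\<Union>s\<in>{0..}. sets (F s)) else F (enn2real t))"

abbreviation is_stopping_time ::
    "'a measure \<Rightarrow> (real \<Rightarrow> 'a measure) \<Rightarrow> ('a \<Rightarrow> ennreal) \<Rightarrow> bool" where
  "is_stopping_time M F \<tau> \<equiv> stopping_time (ext_filtration M F) \<tau>"

abbreviation stopped_sigma ::
    "'a measure \<Rightarrow> (real \<Rightarrow> 'a measure) \<Rightarrow> ('a \<Rightarrow> ennreal) \<Rightarrow> 'a measure" where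
  "stopped_sigma M F \<tau> \<equiv> filtration.pre_sigma (space M) (ext_filtration M F) \<tau>"

lemma filtration_ext_filtration:
  assumes "\<And>t. 0 \<le> t \<Longrightarrow> subalgebra M (F t)"
    and "\<And>s t. 0 \<le> s \<Longrightarrow> s \<le> t \<Longrightarrow> sets (F s) \<subseteq> sets (F t)"
  shows "filtration (space M) (ext_filtration M F)"
proof
  have sub: "(\<Union>s\<in>{0..}. sets (F s)) \<subseteq> Pow (space M)"
  proof (intro UN_least)
    fix s :: real assume "s \<in> {0..}"
    then show "sets (F s) \<subseteq> Pow (space M)"
      using assms(1)[of s] sets.space_closed[of "F s"] by (auto simp: subalgebra_def)
  qed
  show "space (ext_filtration M F t) = space M" for t
    using assms(1)[of "enn2real t"] sub
    by (simp add: ext_filtration_def subalgebra_def space_measure_of)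
  show "sets (ext_filtration M F s) \<subseteq> sets (ext_filtration M F t)" if "s \<le> t" for s t
  proof (cases "t = \<infinity>")
    case True
    show ?thesis
    proof (cases "s = \<infinity>")
      case False
      have "sets (F (enn2real s)) \<subseteq> (\<Union>u\<in>{0..}. sets (F u))"
        by (intro UN_upper) simp
      also have "\<dots> \<subseteq> sets (sigma (space M) (\<Union>s\<in>{0..}. sets (F s)))"
        using sub by (auto simp: sets_measure_of)
      finally show ?thesis using True False by (simp add: ext_filtration_def)
    qed (simp add: True)
  next
    case False
    then have "s \<noteq> \<infinity>" using that by (auto simp: top_unique)
    moreover have "enn2real s \<le> enn2real t"
      using False that by (intro enn2real_mono) (auto simp: less_top)
    ultimately show ?thesis using False assms(2)[of "enn2real s" "enn2real t"]
      by (simp add: ext_filtration_def)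
  qed
qed

section \<open>Levy processes\<close>

definition levy_process :: "'a measure \<Rightarrow> (real \<Rightarrow> 'a \<Rightarrow> real) \<Rightarrow> real \<Rightarrow> bool" where
  "levy_process M X x \<longleftrightarrow>
     (\<forall>t\<ge>0. X t \<in> borel_measurable M) \<and>
     cadlag_process M X \<and>
     (AE \<omega> in M. X 0 \<omega> = x) \<and>
     (\<forall>(t :: nat \<Rightarrow> real) n. 0 \<le> t 0 \<longrightarrow> mono t \<longrightarrow>
        prob_space.indep_vars M (\<lambda>_. borel) (\<lambda>i \<omega>. X (t (Suc i)) \<omega> - X (t i) \<omega>) {..<n}) \<and>
     (\<forall>s\<ge>0. \<forall>h\<ge>0. distr M borel (\<lambda>\<omega>. X (s + h) \<omega> - X s \<omega>) = distr M borel (\<lambda>\<omega>. X h \<omega> - X 0 \<omega>))"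

section \<open>Extended integrals and essential infima\<close>

text \<open>The Lebesgue integral with values in \<open>[-\<infinity>, \<infinity>]\<close>, i.e. the integral of the positive part minus
  the integral of the negative part. If both are infinite, the value is \<open>\<infinity>\<close>.\<close>

definition ext_integral :: "'a measure \<Rightarrow> ('a \<Rightarrow> ereal) \<Rightarrow> ereal" where
  "ext_integral M f =
     enn2ereal (\<integral>\<^sup>+ \<omega>. e2ennreal (f \<omega>) \<partial>M) - enn2ereal (\<integral>\<^sup>+ \<omega>. e2ennreal (- f \<omega>) \<partial>M)"

abbreviation time_measure :: "real measure" where
  "time_measure \<equiv> restrict_space lborel {0..}"

text \<open>\<open>Z\<close> is a version of the essential infimum of the family \<open>\<Phi>\<close> of real random variables, that is,
  a greatest lower bound up to null sets. (The library's \<^const>\<open>esssup\<close> is the essential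
  supremum of a single function, a number.)\<close>

definition is_ess_inf :: "'a measure \<Rightarrow> ('a \<Rightarrow> real) set \<Rightarrow> ('a \<Rightarrow> real) \<Rightarrow> bool" where
  "is_ess_inf M \<Phi> Z \<longleftrightarrow>
     Z \<in> borel_measurable M \<and>
     (\<forall>f\<in>\<Phi>. AE \<omega> in M. Z \<omega> \<le> f \<omega>) \<and>
     (\<forall>W\<in>borel_measurable M. (\<forall>f\<in>\<Phi>. AE \<omega> in M. W \<omega> \<le> f \<omega>) \<longrightarrow> (AE \<omega> in M. W \<omega> \<le> Z \<omega>))"

section \<open>Singular controls\<close>

text \<open>The Lebesgue--Stieltjes measure of one path on \<open>[0, \<infinity>)\<close>. The path is extended by \<open>0\<close> to negative
  times, which encodes \<open>\<theta>\<^sub>0\<^sub>- = 0\<close>, so that the jump at time \<open>0\<close> is an atom of mass \<open>\<theta> 0 \<omega>\<close>.\<close>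

definition stieltjes :: "(real \<Rightarrow> 'a \<Rightarrow> real) \<Rightarrow> 'a \<Rightarrow> real measure" where
  "stieltjes \<theta> \<omega> = interval_measure (\<lambda>t. if t < 0 then 0 else \<theta> t \<omega>)"

text \<open>The condition \<open>0 \<le> \<theta> 0 \<omega>\<close> is monotonicity at time \<open>0\<close>, given \<open>\<theta>\<^sub>0\<^sub>- = 0\<close>.\<close>

definition controls ::
    "'a measure \<Rightarrow> (real \<Rightarrow> 'a measure) \<Rightarrow> real \<Rightarrow> (real \<Rightarrow> 'a \<Rightarrow> real) set" where
  "controls M F r = {\<theta>.
     adapted F \<theta> \<and> cadlag_process M \<theta> \<and>
     (\<forall>\<omega>\<in>space M. 0 \<le> \<theta> 0 \<omega> \<and> mono_on {0..} (\<lambda>t. \<theta> t \<omega>)) \<and>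
     (\<integral>\<^sup>+ \<omega>. (\<integral>\<^sup>+ t\<in>{0..}. ennreal (exp (- r * t)) \<partial>stieltjes \<theta> \<omega>)\<^sup>2 \<partial>M) < \<infinity>}"

definition flat_off :: "'a measure \<Rightarrow> (real \<Rightarrow> 'a \<Rightarrow> real) \<Rightarrow> ('a \<Rightarrow> real set) \<Rightarrow> bool" where
  "flat_off M \<theta> \<Gamma> \<longleftrightarrow>
     (AE \<omega> in M. (\<integral>\<^sup>+ t\<in>{0..}. indicator (- \<Gamma> \<omega>) t \<partial>stieltjes \<theta> \<omega>) = 0)"

section \<open>Costs, objective and subgradient\<close>

definition min_cost :: "real \<Rightarrow> (real \<Rightarrow> real \<Rightarrow> real \<Rightarrow> real) \<Rightarrow> real \<Rightarrow> real \<Rightarrow> real \<Rightarrow> ereal" where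
  "min_cost r c t x \<kappa> = (INF z\<in>{0..}. ereal (c t x z + r * \<kappa> * z))"

definition objective ::
    "'a measure \<Rightarrow> (real \<Rightarrow> 'a \<Rightarrow> real) \<Rightarrow> (real \<Rightarrow> 'a \<Rightarrow> real) \<Rightarrow> (real \<Rightarrow> real \<Rightarrow> real \<Rightarrow> real) \<Rightarrow> real
      \<Rightarrow> (real \<Rightarrow> 'a \<Rightarrow> real) \<Rightarrow> ereal" where
  "objective M X k c r \<theta> =
     ext_integral M (\<lambda>\<omega>.
       ext_integral time_measure (\<lambda>t. ereal (c t (X t \<omega>) (\<theta> t \<omega>) * exp (- r * t))) +
       enn2ereal (\<integral>\<^sup>+ t\<in>{0..}. ennreal (k t \<omega> * exp (- r * t)) \<partial>stieltjes \<theta> \<omega>))"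

definition optimal_control ::
    "'a measure \<Rightarrow> (real \<Rightarrow> 'a measure) \<Rightarrow> (real \<Rightarrow> 'a \<Rightarrow> real) \<Rightarrow> (real \<Rightarrow> 'a \<Rightarrow> real)
      \<Rightarrow> (real \<Rightarrow> real \<Rightarrow> real \<Rightarrow> real) \<Rightarrow> real \<Rightarrow> (real \<Rightarrow> 'a \<Rightarrow> real) \<Rightarrow> bool" where
  "optimal_control M F X k c r \<theta> \<longleftrightarrow>
     \<theta> \<in> controls M F r \<and>
     objective M X k c r \<theta> = (INF \<eta>\<in>controls M F r. objective M X k c r \<eta>)"

text \<open>\<open>p\<close> is a cadlag version of the process \<open>p\<^sup>\<theta>\<close>; here \<open>c\<theta>\<close> is the partial derivative
  of the running cost in its last argument.\<close>

definition is_adjoint ::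
    "'a measure \<Rightarrow> (real \<Rightarrow> 'a measure) \<Rightarrow> (real \<Rightarrow> 'a \<Rightarrow> real) \<Rightarrow> (real \<Rightarrow> real \<Rightarrow> real \<Rightarrow> real) \<Rightarrow> real
      \<Rightarrow> (real \<Rightarrow> 'a \<Rightarrow> real) \<Rightarrow> (real \<Rightarrow> 'a \<Rightarrow> real) \<Rightarrow> bool" where
  "is_adjoint M F X c\<theta> r \<theta> p \<longleftrightarrow>
     adapted F p \<and> cadlag_process M p \<and>
     (\<forall>s\<ge>0. AE \<omega> in M. p s \<omega> =
        real_cond_exp M (F s)
          (\<lambda>\<omega>'. LINT u:{s..}|lborel. c\<theta> u (X u \<omega>') (\<theta> u \<omega>') * exp (- r * (u - s))) \<omega>)"

definition subgradient ::
    "(real \<Rightarrow> 'a \<Rightarrow> real) \<Rightarrow> (real \<Rightarrow> 'a \<Rightarrow> real) \<Rightarrow> real \<Rightarrow> 'a \<Rightarrow> real" where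
  "subgradient k p t \<omega> = k t \<omega> + p t \<omega>"

section \<open>Snell envelope\<close>

text \<open>\<open>at_time Y \<tau>\<close> is \<open>Y\<^sub>\<tau>\<close>, and \<open>discounted r Y \<tau> \<sigma>\<close> is \<open>Y\<^sub>\<sigma> exp (- r (\<sigma> - \<tau>))\<close> for \<open>\<tau> \<le> \<sigma>\<close>;
  both are read as \<open>0\<close> at infinity.\<close>

definition at_time :: "(real \<Rightarrow> 'a \<Rightarrow> real) \<Rightarrow> ('a \<Rightarrow> ennreal) \<Rightarrow> 'a \<Rightarrow> real" where
  "at_time Y \<tau> \<omega> = (if \<tau> \<omega> = \<infinity> then 0 else Y (enn2real (\<tau> \<omega>)) \<omega>)"

definition discounted ::
    "real \<Rightarrow> (real \<Rightarrow> 'a \<Rightarrow> real) \<Rightarrow> ('a \<Rightarrow> ennreal) \<Rightarrow> ('a \<Rightarrow> ennreal) \<Rightarrow> 'a \<Rightarrow> real" where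
  "discounted r Y \<tau> \<sigma> \<omega> =
     (if \<sigma> \<omega> = \<infinity> then 0
      else Y (enn2real (\<sigma> \<omega>)) \<omega> * exp (- r * (enn2real (\<sigma> \<omega>) - enn2real (\<tau> \<omega>))))"

definition is_snell_envelope ::
    "'a measure \<Rightarrow> (real \<Rightarrow> 'a measure) \<Rightarrow> real \<Rightarrow> (real \<Rightarrow> 'a \<Rightarrow> real) \<Rightarrow> (real \<Rightarrow> 'a \<Rightarrow> real) \<Rightarrow> bool" where
  "is_snell_envelope M F r Y S \<longleftrightarrow>
     progressive F S \<and>
     (\<forall>\<tau>. is_stopping_time M F \<tau> \<longrightarrow>
        is_ess_inf M
          {real_cond_exp M (stopped_sigma M F \<tau>) (discounted r Y \<tau> \<sigma>) | \<sigma>.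
             is_stopping_time M F \<sigma> \<and> (\<forall>\<omega>\<in>space M. \<tau> \<omega> \<le> \<sigma> \<omega>)}
          (at_time S \<tau>))"

section \<open>The setting\<close>

text \<open>\<open>A\<close> carries the measurable space on which all the laws \<open>P z\<close> live. The derivative at
  \<open>\<theta> = 0\<close> is one-sided. Joint Borel measurability of the running cost is what makes the cost integrals
  meaningful.\<close>

locale singular_control_setting =
  fixes A :: "'a measure" and F :: "real \<Rightarrow> 'a measure" and P :: "real \<Rightarrow> 'a measure"
    and X :: "real \<Rightarrow> 'a \<Rightarrow> real" and k :: "real \<Rightarrow> 'a \<Rightarrow> real"
    and c c\<theta> :: "real \<Rightarrow> real \<Rightarrow> real \<Rightarrow> real" and r x :: real
  assumes sub_F: "\<And>t. 0 \<le> t \<Longrightarrow> subalgebra A (F t)"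
    and mono_F: "\<And>s t. 0 \<le> s \<Longrightarrow> s \<le> t \<Longrightarrow> sets (F s) \<subseteq> sets (F t)"
    and prob_P: "\<And>z. prob_space (P z)"
    and sets_P: "\<And>z. sets (P z) = sets A"
    and adapted_X: "adapted F X"
    and levy_X: "\<And>z. levy_process (P z) X z"
    and r_pos: "0 < r"
    and adapted_k: "adapted F k"
    and cadlag_k: "cadlag_process A k"
    and k_pos: "\<And>t \<omega>. 0 \<le> t \<Longrightarrow> \<omega> \<in> space A \<Longrightarrow> 0 < k t \<omega>"
    and k_L2: "(\<integral>\<^sup>+ \<omega>. (SUP t\<in>{0..}. ennreal (\<bar>k t \<omega>\<bar>\<^sup>2)) \<partial>P x) < \<infinity>"
    and measurable_c: "(\<lambda>(t, y, \<theta>). c t y \<theta>)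
          \<in> borel_measurable (restrict_space borel ({0..} \<times> UNIV \<times> {0..}))"
    and deriv_c: "\<And>t y \<theta>. 0 \<le> t \<Longrightarrow> 0 \<le> \<theta> \<Longrightarrow>
          (c t y has_real_derivative c\<theta> t y \<theta>) (at \<theta> within {0..})"
    and cont_c\<theta>: "\<And>t y. 0 \<le> t \<Longrightarrow> continuous_on {0..} (c\<theta> t y)"
    and strict_mono_c\<theta>: "\<And>t y. 0 \<le> t \<Longrightarrow> strict_mono_on {0..} (c\<theta> t y)"
    and bounded_c\<theta>: "\<exists>L. \<forall>t\<ge>0. \<forall>y. \<forall>\<theta>\<ge>0. \<bar>c\<theta> t y \<theta>\<bar> \<le> L"
    and finite_cost: "\<exists>y\<ge>0. \<forall>z. ext_integral (P z) (\<lambda>\<omega>.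
          ext_integral time_measure (\<lambda>t. ereal (c t (X t \<omega>) y * exp (- r * t)))) < \<infinity>"
    and min_cost_bound: "- \<infinity> < ext_integral (P x) (\<lambda>\<omega>.
          ext_integral time_measure (\<lambda>t. min_cost r c t (X t \<omega>) (k t \<omega>) * ereal (exp (- r * t))))"

end

theory Submission
  imports Defs
begin

text \<open>The argument looks at the control \<open>\<theta>\<close> through its levels rather than through time. Let \<open>\<tau> b\<close>
  be the first time at which \<open>\<theta>\<close> has reached the level \<open>b\<close>. Since \<open>\<tau> b \<le> t\<close> holds exactly when \<open>b \<le>
  \<theta> t\<close>, the Stieltjes measure of \<open>\<theta>\<close> is the image of Lebesgue measure on the levels under \<open>\<tau>\<close>
  (\<open>nn_integral_stieltjes_levels\<close>). Flatness thus means that for almost every level \<open>b\<close> the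
  subgradient \<open>Y = k + p\<close> and its Snell envelope \<open>S\<close> agree at \<open>\<tau> b\<close>, almost surely on \<open>\<tau> b < \<infinity>\<close>
  (\<open>flat_off_levels\<close>). One inequality is the choice \<open>\<sigma> = \<tau> b\<close> in the essential infimum; the other
  one says that, starting from \<open>\<tau> b\<close>, stopping at once is optimal for the discounted subgradient.

  This is where optimality enters. Given a level \<open>a\<close> and a stopping time \<open>\<sigma> \<ge> \<tau> a\<close>, withhold the
  part of the control that lies in the band \<open>(a, a + \<epsilon>]\<close> of levels until \<open>\<sigma>\<close> (\<open>delayed\<close>). The new
  control is below \<open>\<theta>\<close> by at most \<open>\<epsilon>\<close>, so it is admissible, and the costs of both controls can be
  subtracted because the optimal cost is finite: a constant control bounds it from above, the
  pointwise minimal cost \<open>C\<close> bounds it from below. Convexity bounds the change of the running cost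
  by the derivative of the cost at the new control (\<open>variational_inequality\<close>). Dividing by \<open>\<epsilon>\<close> and
  letting \<open>\<epsilon>\<close> tend to \<open>0\<close> gives (\<open>first_variation\<close>) \<open>E \<integral>_{\<tau> a}^\<sigma> c\<theta>(u) e^{-r u} du \<le> E [k_\<sigma> e^{-r \<sigma>}
  - k_{\<tau> a} e^{-r \<tau> a}]\<close>, provided that \<open>\<theta>\<close> exceeds \<open>a\<close> immediately after \<open>\<tau> a\<close>. For all but
  countably many levels this holds almost surely, because \<open>a \<mapsto> E [e^{-\<tau> a}]\<close> is monotone and so has
  countably many discontinuities (\<open>almost_all_levels_crossed\<close>).

  At stopping times the adjoint process \<open>p\<close> has the expectation of the remaining discounted marginal
  cost (\<open>adjoint_at_stopping_time\<close>), so the displayed inequality says that the expected discounted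
  subgradient at \<open>\<tau> a\<close> is at most that at \<open>\<sigma>\<close> (\<open>delaying_does_not_pay\<close>). Applying this to the
  stopping time that equals \<open>\<sigma>\<close> on an event of the stopped sigma-algebra and \<open>\<tau> a\<close> off it turns the
  inequality into one between conditional expectations (\<open>subgradient_le_conditional_expectation\<close>).

  The level times are stopping times in the strict sense that the event \<open>\<tau> b \<le> t\<close> belongs to \<open>F t\<close>,
  because right-continuity of \<open>\<theta>\<close> makes the infimum that defines them a minimum.\<close>

section \<open>Right-continuous paths\<close>

text \<open>The first point of the grid of mesh \<open>1 / Suc n\<close> that lies strictly to the right of \<open>t\<close>. Being strict
  also at grid points, it approaches \<open>t\<close> from the right, so right-continuous paths converge along
  it.\<close>

definition grid_above :: "nat \<Rightarrow> real \<Rightarrow> real" where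
  "grid_above n t = (of_int \<lfloor>real (Suc n) * t\<rfloor> + 1) / real (Suc n)"

lemma grid_above_bounds: "t < grid_above n t" "grid_above n t \<le> t + 1 / Suc n"
proof -
  have "real (Suc n) * t < of_int \<lfloor>real (Suc n) * t\<rfloor> + 1" by linarith
  then show "t < grid_above n t"
    unfolding grid_above_def
    by (subst pos_less_divide_eq) (simp_all only: mult.commute of_nat_0_less_iff zero_less_Suc)
  have "of_int \<lfloor>real (Suc n) * t\<rfloor> \<le> real (Suc n) * t" by linarith
  then have "grid_above n t \<le> (real (Suc n) * t + 1) / Suc n"
    unfolding grid_above_def by (intro divide_right_mono) auto
  then show "grid_above n t \<le> t + 1 / Suc n" by (simp add: add_divide_distrib)
qed

lemma measurable_grid_above [measurable]: "grid_above n \<in> borel_measurable borel"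
  unfolding grid_above_def by measurable

lemma filterlim_grid_above: "filterlim (\<lambda>n. grid_above n t) (at_right t) sequentially"
proof (rule tendsto_imp_filterlim_at_right)
  show "(\<lambda>n. grid_above n t) \<longlonglongrightarrow> t"
  proof (rule tendsto_sandwich[OF _ _ tendsto_const])
    show "(\<lambda>n. t + 1 / Suc n) \<longlonglongrightarrow> t"
      using tendsto_add[OF tendsto_const LIMSEQ_Suc[OF lim_1_over_n], of t] by simp
    show "\<forall>\<^sub>F n in sequentially. t \<le> grid_above n t"
      by (intro always_eventually allI less_imp_le grid_above_bounds)
    show "\<forall>\<^sub>F n in sequentially. grid_above n t \<le> t + 1 / Suc n"
      by (intro always_eventually allI grid_above_bounds)
  qed
qed (intro always_eventually allI grid_above_bounds)

lemma right_continuous_le_from_rationals: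
  fixes f :: "real \<Rightarrow> real"
  assumes "continuous (at_right t) f" "\<And>q. q \<in> \<rat> \<Longrightarrow> t < q \<Longrightarrow> f q \<le> C"
  shows "f t \<le> C"
proof (rule ccontr)
  assume "\<not> f t \<le> C"
  then have "\<forall>\<^sub>F s in at_right t. C < f s"
    using assms(1) by (intro order_tendstoD(1)[of f "f t"]) (auto simp: continuous_within)
  then obtain b where b: "t < b" "\<And>s. t < s \<Longrightarrow> s < b \<Longrightarrow> C < f s"
    by (auto simp: eventually_at_right_field)
  then obtain q where "q \<in> \<rat>" "t < q" "q < b" using Rats_dense_in_real by blast
  then show False using assms(2)[of q] b(2)[of q] by simp
qed

text \<open>The path is sampled at \<open>grid_above n\<close>, which takes countably many values, and right-continuity
  gives convergence. The maximum with \<open>0\<close> makes the time variable range over the whole real line.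
  With \<open>N\<close> a member of a filtration and \<open>Y\<close> stopped at the same time, this is progressive
  measurability.\<close>

lemma measurable_right_continuous_process:
  fixes Y :: "real \<Rightarrow> 'a \<Rightarrow> real"
  assumes meas: "\<And>t. 0 \<le> t \<Longrightarrow> Y t \<in> borel_measurable N"
    and right_cont: "\<And>\<omega> t. \<omega> \<in> space N \<Longrightarrow> 0 \<le> t \<Longrightarrow> continuous (at_right t) (\<lambda>t. Y t \<omega>)"
  shows "(\<lambda>(t, \<omega>). Y (max 0 t) \<omega>) \<in> borel_measurable (borel \<Otimes>\<^sub>M N)"
proof -
  have approx: "(\<lambda>z. Y (grid_above n (max 0 (fst z))) (snd z)) \<in> borel_measurable (borel \<Otimes>\<^sub>M N)" for n
  proof -
    have "(\<lambda>z. (\<lambda>i z. Y (of_int (max 0 i + 1) / Suc n) (snd z)) \<lfloor>real (Suc n) * max 0 (fst z)\<rfloor> z)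
        \<in> borel_measurable (borel \<Otimes>\<^sub>M N)"
    proof (rule measurable_compose_countable[where
          f="\<lambda>i z. Y (of_int (max 0 i + 1) / Suc n) (snd z)"])
      show "(\<lambda>z. Y (of_int (max 0 i + 1) / Suc n) (snd z)) \<in> borel_measurable (borel \<Otimes>\<^sub>M N)"
        for i :: int
        by (rule measurable_compose[OF measurable_snd meas]) simp
    qed measurable
    moreover have "of_int (max 0 \<lfloor>real (Suc n) * max 0 t\<rfloor> + 1) / Suc n = grid_above n (max 0 t)" for t
    proof -
      have "0 \<le> \<lfloor>real (Suc n) * max 0 t\<rfloor>" by simp
      then show ?thesis unfolding grid_above_def by (simp add: max_def)
    qed
    ultimately show ?thesis by (simp add: case_prod_beta)
  qed
  have "(\<lambda>n. Y (grid_above n (max 0 (fst z))) (snd z)) \<longlonglongrightarrow> Y (max 0 (fst z)) (snd z)"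
    if "z \<in> space (borel \<Otimes>\<^sub>M N)" for z
  proof -
    have "((\<lambda>u. Y u (snd z)) \<longlongrightarrow> Y (max 0 (fst z)) (snd z)) (at_right (max 0 (fst z)))"
      using right_cont[of "snd z" "max 0 (fst z)"] that
      by (auto simp: space_pair_measure continuous_within)
    from filterlim_compose[OF this filterlim_grid_above] show ?thesis .
  qed
  from borel_measurable_LIMSEQ_real[OF this approx] show ?thesis
    by (simp add: case_prod_beta)
qed

section \<open>Level times and Stieltjes integrals\<close>

text \<open>Levels that are never reached have level time \<open>\<infinity>\<close>, the infimum of the empty set.\<close>

definition level_time :: "(real \<Rightarrow> 'a \<Rightarrow> real) \<Rightarrow> real \<Rightarrow> 'a \<Rightarrow> ennreal" where
  "level_time \<theta> b \<omega> = Inf (ennreal ` {t. 0 \<le> t \<and> b \<le> \<theta> t \<omega>})"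

text \<open>Right-continuity makes the infimum a minimum. This equivalence is the only property of level
  times used in comparisons with deterministic times.\<close>

lemma level_time_le_iff:
  assumes mono: "mono_on {0..} (\<lambda>t. \<theta> t \<omega>)"
    and right_cont: "\<And>t. 0 \<le> t \<Longrightarrow> continuous (at_right t) (\<lambda>t. \<theta> t \<omega>)"
    and "0 \<le> t"
  shows "level_time \<theta> b \<omega> \<le> ennreal t \<longleftrightarrow> b \<le> \<theta> t \<omega>"
proof
  assume "b \<le> \<theta> t \<omega>"
  then show "level_time \<theta> b \<omega> \<le> ennreal t"
    unfolding level_time_def using \<open>0 \<le> t\<close> by (intro Inf_lower) auto
next
  assume le: "level_time \<theta> b \<omega> \<le> ennreal t"
  have above: "b \<le> \<theta> s \<omega>" if "t < s" for s
  proof -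
    have "level_time \<theta> b \<omega> < ennreal s"
      using le that \<open>0 \<le> t\<close> by (auto intro: le_less_trans simp: ennreal_less_iff)
    then obtain u where u: "0 \<le> u" "b \<le> \<theta> u \<omega>" "ennreal u < ennreal s"
      unfolding level_time_def Inf_less_iff by auto
    then have "u \<le> s" by (simp add: ennreal_less_iff)
    then show ?thesis using mono_onD[OF mono, of u s] u that \<open>0 \<le> t\<close> by simp
  qed
  have "((\<lambda>t. \<theta> t \<omega>) \<longlongrightarrow> \<theta> t \<omega>) (at_right t)"
    using right_cont[OF \<open>0 \<le> t\<close>] by (simp add: continuous_within)
  moreover have "\<forall>\<^sub>F s in at_right t. b \<le> \<theta> s \<omega>"
    using above by (auto simp: eventually_at_right_less intro!: eventually_at_right_less[THEN eventually_mono])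
  ultimately show "b \<le> \<theta> t \<omega>" by (rule tendsto_lowerbound) simp
qed

lemma level_time_mono: "b \<le> b' \<Longrightarrow> level_time \<theta> b \<omega> \<le> level_time \<theta> b' \<omega>"
  unfolding level_time_def by (intro Inf_superset_mono) auto

text \<open>Both sides integrate against measures with the same distribution function \<open>\<theta>\<close>. The map \<open>T\<close>
  from levels to times is arbitrary up to this requirement, in particular it may be non-monotone: a
  control in which some levels are postponed is described by changing \<open>T\<close> on these levels only.\<close>

lemma nn_integral_stieltjes_levels:
  fixes \<theta> :: "real \<Rightarrow> 'a \<Rightarrow> real" and T :: "real \<Rightarrow> ennreal"
  assumes mono: "mono_on {0..} (\<lambda>t. \<theta> t \<omega>)" and init: "0 \<le> \<theta> 0 \<omega>"
    and right_cont: "\<And>t. 0 \<le> t \<Longrightarrow> continuous (at_right t) (\<lambda>t. \<theta> t \<omega>)"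
    and T [measurable]: "T \<in> borel_measurable borel"
    and levels: "\<And>t. 0 \<le> t \<Longrightarrow> emeasure lborel {b. 0 < b \<and> T b \<le> ennreal t} = ennreal (\<theta> t \<omega>)"
    and f: "f \<in> borel_measurable time_measure"
  shows "(\<integral>\<^sup>+ t\<in>{0..}. f t \<partial>stieltjes \<theta> \<omega>)
    = (\<integral>\<^sup>+ b. f (enn2real (T b)) * indicator {b. 0 < b \<and> T b < \<infinity>} b \<partial>lborel)"
proof -
  define D where "D = {b. 0 < b \<and> T b < \<infinity>}"
  have D [measurable]: "D \<in> sets borel" unfolding D_def by measurable
  define \<nu> where "\<nu> = distr (density lborel (indicator D)) borel (\<lambda>b. enn2real (T b))"
  define G where "G = (\<lambda>t. if t < 0 then 0 else \<theta> t \<omega>)"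
  have nonneg: "0 \<le> \<theta> t \<omega>" if "0 \<le> t" for t
    using mono init that unfolding mono_on_def by force
  have monoG: "G s \<le> G t" if "s \<le> t" for s t
    using mono nonneg that unfolding G_def mono_on_def by auto
  have right_contG: "continuous (at_right t) G" for t
  proof (cases "t < 0")
    case True
    have "(G \<longlongrightarrow> 0) (at_right t)"
    proof (rule tendsto_eventually)
      show "\<forall>\<^sub>F s in at_right t. G s = 0"
        using True unfolding G_def eventually_at_right_field by (auto intro!: exI[of _ 0])
    qed
    then show ?thesis using True by (simp add: continuous_within G_def)
  next
    case False
    then have "((\<lambda>t. \<theta> t \<omega>) \<longlongrightarrow> \<theta> t \<omega>) (at_right t)"
      using right_cont[of t] by (simp add: continuous_within)
    then have "(G \<longlongrightarrow> \<theta> t \<omega>) (at_right t)"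
    proof (rule Lim_transform_eventually)
      show "\<forall>\<^sub>F s in at_right t. \<theta> s \<omega> = G s"
        using False unfolding G_def by (intro eventually_at_right_less[THEN eventually_mono]) auto
    qed
    then show ?thesis using False by (simp add: continuous_within G_def)
  qed
  have \<nu>_Iic: "emeasure \<nu> {..t} = ennreal (G t)" for t
  proof -
    have "emeasure \<nu> {..t} = (\<integral>\<^sup>+ b. indicator D b * indicator {..t} (enn2real (T b)) \<partial>lborel)"
      unfolding \<nu>_def
      by (subst emeasure_distr; (subst emeasure_density)?)
        (auto intro!: nn_integral_cong split: split_indicator simp: vimage_def)
    also have "\<dots> = (\<integral>\<^sup>+ b. indicator {b \<in> D. enn2real (T b) \<le> t} b \<partial>lborel)"
      by (intro nn_integral_cong) (auto split: split_indicator)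
    also have "\<dots> = emeasure lborel {b \<in> D. enn2real (T b) \<le> t}"
      by (rule nn_integral_indicator) measurable
    also have "\<dots> = ennreal (G t)"
    proof (cases "t < 0")
      case True
      then have "enn2real (T b) > t" for b
        using enn2real_nonneg[of "T b"] by linarith
      then have none: "{b \<in> D. enn2real (T b) \<le> t} = {}" by (auto simp: not_le)
      show ?thesis unfolding none using True by (simp add: G_def)
    next
      case False
      have "{b \<in> D. enn2real (T b) \<le> t} = {b. 0 < b \<and> T b \<le> ennreal t}"
      proof -
        have "enn2real x \<le> t \<and> x < \<infinity> \<longleftrightarrow> x \<le> ennreal t" for x :: ennreal
          using False by (cases x) (auto simp: top_unique)
        then show ?thesis unfolding D_def by auto
      qed
      then show ?thesis using levels[of t] False by (simp add: G_def)
    qed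
    finally show ?thesis .
  qed
  have \<nu>_Ioc: "emeasure \<nu> {s<..t} = ennreal (G t - G s)" if "s \<le> t" for s t
  proof -
    have "emeasure \<nu> ({..t} - {..s}) = emeasure \<nu> {..t} - emeasure \<nu> {..s}"
      by (rule emeasure_Diff) (use that in \<open>simp_all add: \<nu>_Iic, simp_all add: \<nu>_def\<close>)
    moreover have "{..t} - {..s} = {s<..t}" by auto
    moreover have "0 \<le> G s" using nonneg by (simp add: G_def)
    ultimately show ?thesis by (simp add: \<nu>_Iic ennreal_minus)
  qed
  have range_Ioc: "range (\<lambda>(a, b). {a<..b :: real}) = {{a<..b} | a b. True}" by auto
  have "stieltjes \<theta> \<omega> = \<nu>"
  proof (rule measure_eqI_generator_eq[where \<Omega>=UNIV and E="{{a<..b :: real} | a b. True}"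
        and A="\<lambda>n. {- real n<..real n}"])
    show "Int_stable {{a<..b :: real} | a b. True}"
      by (auto simp: Int_stable_def Int_greaterThanAtMost) blast
    show "(\<Union>i. {- real i<..real i}) = UNIV"
    proof safe
      fix y :: real
      obtain n where "\<bar>y\<bar> < real n" using reals_Archimedean2 by blast
      then show "y \<in> (\<Union>i. {- real i<..real i})" by (intro UN_I[of n]) auto
    qed auto
    show "emeasure (stieltjes \<theta> \<omega>) Z = emeasure \<nu> Z" if Ioc: "Z \<in> {{a<..b} | a b. True}" for Z
    proof -
      obtain a b where Z: "Z = {a<..b}" using Ioc by blast
      show ?thesis
      proof (cases "a \<le> b")
        case True
        then show ?thesis
          unfolding Z stieltjes_def using emeasure_interval_measure_Ioc[OF True monoG right_contG] \<nu>_Ioc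
          by (simp add: G_def)
      qed (simp add: Z)
    qed
    show "emeasure (stieltjes \<theta> \<omega>) {- real i<..real i} \<noteq> \<infinity>" for i
      unfolding stieltjes_def
      using emeasure_interval_measure_Ioc[OF _ monoG right_contG, of "- real i" "real i"]
      by (simp add: G_def)
  qed (auto simp only: stieltjes_def \<nu>_def borel_sigma_sets_Ioc sets_interval_measure sets_distr range_Ioc
      sets_measure_of Pow_UNIV subset_UNIV)
  then have "(\<integral>\<^sup>+ t\<in>{0..}. f t \<partial>stieltjes \<theta> \<omega>) = (\<integral>\<^sup>+ t\<in>{0..}. f t \<partial>\<nu>)" by simp
  also have "\<dots> = (\<integral>\<^sup>+ b. f (enn2real (T b)) * indicator D b \<partial>lborel)"
  proof -
    have [measurable]: "(\<lambda>t. f t * indicator {0..} t) \<in> borel_measurable borel"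
      using f by (simp add: borel_measurable_restrict_space_iff_ennreal)
    have "(\<integral>\<^sup>+ t\<in>{0..}. f t \<partial>\<nu>) = (\<integral>\<^sup>+ b. f (enn2real (T b)) * indicator {0..} (enn2real (T b))
        \<partial>density lborel (indicator D))"
      unfolding \<nu>_def by (subst nn_integral_distr) auto
    also have "\<dots> = (\<integral>\<^sup>+ b. indicator D b * (f (enn2real (T b)) * indicator {0..} (enn2real (T b)))
        \<partial>lborel)"
    proof (rule nn_integral_density)
      show "(\<lambda>b. f (enn2real (T b)) * indicator {0..} (enn2real (T b))) \<in> borel_measurable lborel"
        by (rule measurable_compose[where f="\<lambda>b. enn2real (T b)" and N=borel]) auto
    qed auto
    finally show ?thesis by (simp add: mult.commute)
  qed
  finally show ?thesis unfolding D_def .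
qed

section \<open>Integrals with values in the extended reals\<close>

lemma ext_integral_cong_AE:
  assumes "AE \<omega> in M. f \<omega> = g \<omega>"
  shows "ext_integral M f = ext_integral M g"
proof -
  have "(\<integral>\<^sup>+ \<omega>. e2ennreal (f \<omega>) \<partial>M) = (\<integral>\<^sup>+ \<omega>. e2ennreal (g \<omega>) \<partial>M)"
    by (rule nn_integral_cong_AE) (use assms in auto)
  moreover have "(\<integral>\<^sup>+ \<omega>. e2ennreal (- f \<omega>) \<partial>M) = (\<integral>\<^sup>+ \<omega>. e2ennreal (- g \<omega>) \<partial>M)"
    by (rule nn_integral_cong_AE) (use assms in auto)
  ultimately show ?thesis by (simp add: ext_integral_def)
qed

lemma ext_integral_integrable:
  fixes h :: "'a \<Rightarrow> real"
  assumes "integrable M h"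
  shows "ext_integral M (\<lambda>\<omega>. ereal (h \<omega>)) = ereal (\<integral>\<omega>. h \<omega> \<partial>M)"
proof -
  have fin: "(\<integral>\<^sup>+ \<omega>. ennreal (h \<omega>) \<partial>M) < \<infinity>" "(\<integral>\<^sup>+ \<omega>. ennreal (- h \<omega>) \<partial>M) < \<infinity>"
    using assms unfolding real_integrable_def by (auto simp: less_top)
  have split: "(\<integral>\<omega>. h \<omega> \<partial>M) = enn2real (\<integral>\<^sup>+ \<omega>. ennreal (h \<omega>) \<partial>M) - enn2real (\<integral>\<^sup>+ \<omega>. ennreal (- h \<omega>) \<partial>M)"
    by (rule real_lebesgue_integral_def[OF assms])
  have real: "enn2ereal x = ereal (enn2real x)" if "x < \<infinity>" for x
    using that by (cases x) auto
  show ?thesis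
    unfolding ext_integral_def split using fin
    by (simp add: e2ennreal_ereal real)
qed

lemma ext_integral_finite_imp:
  fixes f :: "'a \<Rightarrow> ereal"
  assumes [measurable]: "f \<in> borel_measurable M"
    and finite: "(\<integral>\<^sup>+ \<omega>. e2ennreal (f \<omega>) \<partial>M) < \<infinity>" "(\<integral>\<^sup>+ \<omega>. e2ennreal (- f \<omega>) \<partial>M) < \<infinity>"
  shows "AE \<omega> in M. \<bar>f \<omega>\<bar> \<noteq> \<infinity>" "integrable M (\<lambda>\<omega>. real_of_ereal (f \<omega>))"
proof -
  have "AE \<omega> in M. e2ennreal (f \<omega>) \<noteq> \<infinity>" "AE \<omega> in M. e2ennreal (- f \<omega>) \<noteq> \<infinity>"
    using finite by (intro nn_integral_noteq_infinite; simp)+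
  then show AE: "AE \<omega> in M. \<bar>f \<omega>\<bar> \<noteq> \<infinity>"
  proof eventually_elim
    case (elim \<omega>)
    then show ?case by (cases "f \<omega>") auto
  qed
  have "(\<integral>\<^sup>+ \<omega>. ennreal (real_of_ereal (f \<omega>)) \<partial>M) \<le> (\<integral>\<^sup>+ \<omega>. e2ennreal (f \<omega>) \<partial>M)"
  proof (rule nn_integral_mono)
    show "ennreal (real_of_ereal (f \<omega>)) \<le> e2ennreal (f \<omega>)" for \<omega>
      by (cases "f \<omega>") (auto simp: e2ennreal_ereal)
  qed
  moreover have "(\<integral>\<^sup>+ \<omega>. ennreal (- real_of_ereal (f \<omega>)) \<partial>M) \<le> (\<integral>\<^sup>+ \<omega>. e2ennreal (- f \<omega>) \<partial>M)"
  proof (rule nn_integral_mono)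
    show "ennreal (- real_of_ereal (f \<omega>)) \<le> e2ennreal (- f \<omega>)" for \<omega>
      by (cases "f \<omega>") (auto simp: e2ennreal_ereal)
  qed
  ultimately show "integrable M (\<lambda>\<omega>. real_of_ereal (f \<omega>))"
    unfolding real_integrable_def using finite by (auto simp: top_unique)
qed

text \<open>The integrand \<open>g\<close> is arbitrary because the pointwise minimal cost, an infimum over uncountably
  many values, will take its place. Monotonicity bounds its positive part by that of \<open>f + h\<close> from
  above and its negative part from below, and only \<open>f\<close> and \<open>h\<close> are added up.\<close>

lemma ext_integral_le_add:
  fixes f h :: "'a \<Rightarrow> real" and g :: "'a \<Rightarrow> ereal"
  assumes [measurable]: "f \<in> borel_measurable M" "h \<in> borel_measurable M"
    and h: "\<And>\<omega>. \<omega> \<in> space M \<Longrightarrow> 0 \<le> h \<omega>" "(\<integral>\<^sup>+ \<omega>. ennreal (h \<omega>) \<partial>M) < \<infinity>"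
    and le: "\<And>\<omega>. \<omega> \<in> space M \<Longrightarrow> g \<omega> \<le> ereal (f \<omega> + h \<omega>)"
  shows "ext_integral M g \<le> ext_integral M (\<lambda>\<omega>. ereal (f \<omega>)) + enn2ereal (\<integral>\<^sup>+ \<omega>. ennreal (h \<omega>) \<partial>M)"
proof -
  define H where "H = (\<integral>\<^sup>+ \<omega>. ennreal (h \<omega>) \<partial>M)"
  define p where "p = (\<integral>\<^sup>+ \<omega>. ennreal (f \<omega>) \<partial>M)"
  define n where "n = (\<integral>\<^sup>+ \<omega>. ennreal (- f \<omega>) \<partial>M)"
  define p' where "p' = (\<integral>\<^sup>+ \<omega>. ennreal (f \<omega> + h \<omega>) \<partial>M)"
  define n' where "n' = (\<integral>\<^sup>+ \<omega>. ennreal (- (f \<omega> + h \<omega>)) \<partial>M)"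
  have "ext_integral M g \<le> enn2ereal p' - enn2ereal n'"
    unfolding ext_integral_def
  proof (rule ereal_minus_mono)
    show "enn2ereal (\<integral>\<^sup>+ \<omega>. e2ennreal (g \<omega>) \<partial>M) \<le> enn2ereal p'"
      unfolding p'_def less_eq_ennreal.rep_eq[symmetric]
      by (intro nn_integral_mono) (metis e2ennreal_ereal e2ennreal_mono le)
    show "enn2ereal n' \<le> enn2ereal (\<integral>\<^sup>+ \<omega>. e2ennreal (- g \<omega>) \<partial>M)"
      unfolding n'_def less_eq_ennreal.rep_eq[symmetric]
      by (intro nn_integral_mono)
        (metis e2ennreal_ereal e2ennreal_mono ereal_minus_le_minus le uminus_ereal.simps(1))
  qed
  also have "\<dots> \<le> enn2ereal p - enn2ereal n + enn2ereal H"
  proof (cases "p = \<infinity>")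
    case True
    then show ?thesis by (cases "enn2ereal n"; cases "enn2ereal H") auto
  next
    case False
    have "p' \<le> p + H"
      unfolding p_def p'_def H_def by (subst nn_integral_add[symmetric])
        (auto intro!: nn_integral_mono simp: ennreal_plus_if h(1) add_mono)
    then have p': "p' < \<infinity>" using False h(2) unfolding H_def
      by (metis ennreal_add_eq_top infinity_ennreal_def le_less_trans less_top top.not_eq_extremum top_unique)
    have n_le: "n \<le> n' + H"
      unfolding n_def n'_def H_def by (subst nn_integral_add[symmetric])
        (auto intro!: nn_integral_mono simp: ennreal_plus_if h(1) ennreal_leI)
    show ?thesis
    proof (cases "n' = \<infinity>")
      case True
      then show ?thesis using p' by (cases p') auto
    next
      case fin': False
      then have "n < \<infinity>" using n_le h(2) unfolding H_def
        by (metis ennreal_add_eq_top infinity_ennreal_def le_less_trans less_top top.not_eq_extremum top_unique)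
      then have f: "integrable M f"
        using False unfolding real_integrable_def p_def n_def by auto
      have int_h: "integrable M h"
        using h by (intro integrableI_nonneg) auto
      have H: "enn2ereal H = ereal (\<integral>\<omega>. h \<omega> \<partial>M)"
        unfolding H_def using h int_h by (subst nn_integral_eq_integral) auto
      have "enn2ereal p' - enn2ereal n' = ext_integral M (\<lambda>\<omega>. ereal (f \<omega> + h \<omega>))"
        by (simp add: ext_integral_def p'_def n'_def e2ennreal_ereal)
      also have "\<dots> = ereal ((\<integral>\<omega>. f \<omega> \<partial>M) + (\<integral>\<omega>. h \<omega> \<partial>M))"
        using f int_h by (subst ext_integral_integrable) auto
      also have "\<dots> = ext_integral M (\<lambda>\<omega>. ereal (f \<omega>)) + enn2ereal H"
        using f by (subst ext_integral_integrable) (auto simp: H)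
      also have "\<dots> = enn2ereal p - enn2ereal n + enn2ereal H"
        by (simp add: ext_integral_def p_def n_def e2ennreal_ereal)
      finally show ?thesis by simp
    qed
  qed
  also have "\<dots> = ext_integral M (\<lambda>\<omega>. ereal (f \<omega>)) + enn2ereal H"
    by (simp add: ext_integral_def p_def n_def e2ennreal_ereal)
  finally show ?thesis unfolding H_def .
qed

lemma ext_integral_less_infinity:
  assumes "ext_integral M f < \<infinity>"
  shows "(\<integral>\<^sup>+ \<omega>. e2ennreal (f \<omega>) \<partial>M) < \<infinity>"
proof (rule ccontr)
  assume "\<not> ?thesis"
  then have "(\<integral>\<^sup>+ \<omega>. e2ennreal (f \<omega>) \<partial>M) = \<infinity>" by (simp add: less_top[symmetric])
  with assms show False by (simp add: ext_integral_def)
qed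

lemma ext_integral_less_infinityI:
  assumes "(\<integral>\<^sup>+ \<omega>. e2ennreal (f \<omega>) \<partial>M) < \<infinity>"
  shows "ext_integral M f < \<infinity>"
proof -
  obtain a where "(\<integral>\<^sup>+ \<omega>. e2ennreal (f \<omega>) \<partial>M) = ennreal a" "0 \<le> a"
    using assms by (cases "\<integral>\<^sup>+ \<omega>. e2ennreal (f \<omega>) \<partial>M") auto
  then show ?thesis
    by (cases "\<integral>\<^sup>+ \<omega>. e2ennreal (- f \<omega>) \<partial>M") (auto simp: ext_integral_def)
qed

lemma ext_integral_greater_minus_infinity:
  assumes "- \<infinity> < ext_integral M f" "(\<integral>\<^sup>+ \<omega>. e2ennreal (f \<omega>) \<partial>M) < \<infinity>"
  shows "(\<integral>\<^sup>+ \<omega>. e2ennreal (- f \<omega>) \<partial>M) < \<infinity>"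
proof (rule ccontr)
  assume "\<not> ?thesis"
  then have "(\<integral>\<^sup>+ \<omega>. e2ennreal (- f \<omega>) \<partial>M) = \<infinity>" by (simp add: less_top[symmetric])
  moreover obtain a where "(\<integral>\<^sup>+ \<omega>. e2ennreal (f \<omega>) \<partial>M) = ennreal a" "0 \<le> a"
    using assms(2) by (cases "\<integral>\<^sup>+ \<omega>. e2ennreal (f \<omega>) \<partial>M") auto
  ultimately show False using assms(1) by (simp add: ext_integral_def)
qed

lemma e2ennreal_add_le: "e2ennreal (a + enn2ereal b) \<le> e2ennreal a + b"
proof (cases b)
  case (real v)
  then show ?thesis
    by (cases a) (auto simp: ennreal_plus_if ennreal_leI)
qed simp

section \<open>Processes and costs under the law\<close>

lemma sigma_finite_time_measure: "sigma_finite_measure time_measure"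
  by (rule sigma_finite_measure_restrict_space[OF sigma_finite_lborel]) simp

lemma measurable_time: "(\<lambda>t. t) \<in> time_measure \<rightarrow>\<^sub>M borel"
  by (intro measurable_restrict_space1) simp

lemma measurable_pair_time:
  assumes "(\<lambda>(t, \<omega>). Y (max 0 t) \<omega>) \<in> borel_measurable (borel \<Otimes>\<^sub>M M)"
  shows "(\<lambda>z. Y (snd z) (fst z)) \<in> borel_measurable (M \<Otimes>\<^sub>M time_measure)"
proof -
  have "(\<lambda>z. (snd z, fst z)) \<in> M \<Otimes>\<^sub>M time_measure \<rightarrow>\<^sub>M borel \<Otimes>\<^sub>M M"
    by (intro measurable_Pair measurable_compose[OF measurable_snd measurable_time] measurable_fst)
  from measurable_compose[OF this assms]
  have "(\<lambda>z. Y (max 0 (snd z)) (fst z)) \<in> borel_measurable (M \<Otimes>\<^sub>M time_measure)" by simp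
  then show ?thesis
    by (rule measurable_cong[THEN iffD1, rotated]) (auto simp: space_pair_measure space_restrict_space max_def)
qed

lemma nn_integral_discount_from:
  fixes T :: ennreal
  assumes "0 < r"
  shows "(\<integral>\<^sup>+ t. ennreal (r * exp (- r * t)) * indicator {t. T \<le> ennreal t} t \<partial>time_measure)
    = (if T = \<infinity> then 0 else ennreal (exp (- r * enn2real T)))"
proof (cases T)
  case (real s)
  have "(\<integral>\<^sup>+ t. ennreal (r * exp (- r * t)) * indicator {t. T \<le> ennreal t} t \<partial>time_measure)
      = (\<integral>\<^sup>+ t. ennreal (r * exp (- r * t)) * indicator {s..} t \<partial>lborel)"
    using real by (subst nn_integral_restrict_space) (auto intro!: nn_integral_cong split: split_indicator)
  also have "\<dots> = ennreal (0 - (- exp (- r * s)))"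
  proof (rule nn_integral_FTC_atLeast)
    show "((\<lambda>t. - exp (- r * t)) has_real_derivative r * exp (- r * t)) (at t)" for t
      by (auto intro!: derivative_eq_intros)
    have "filterlim (\<lambda>t. r * t) at_top at_top"
      using assms by (intro filterlim_tendsto_pos_mult_at_top[OF tendsto_const]) (auto simp: filterlim_ident)
    then have "((\<lambda>t. exp (- (r * t))) \<longlongrightarrow> 0) at_top"
      by (intro filterlim_compose[OF exp_at_bot]) (simp add: filterlim_uminus_at_bot)
    then show "((\<lambda>t. - exp (- r * t)) \<longlongrightarrow> 0) at_top"
      using tendsto_minus by fastforce
  qed (use assms in auto)
  finally show ?thesis using real by simp
next
  case top
  then show ?thesis by (simp add: top_unique)
qed

context singular_control_setting
begin

sublocale law: prob_space "P x"
  by (rule prob_P)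

sublocale time: sigma_finite_measure time_measure
  by (rule sigma_finite_time_measure)

sublocale law_time: pair_sigma_finite "P x" time_measure ..

lemma sets_law [measurable_cong]: "sets (P x) = sets A"
  by (rule sets_P)

lemma space_law: "space (P x) = space A"
  using sets_P by (rule sets_eq_imp_space_eq)

lemma subalgebra_law: "0 \<le> t \<Longrightarrow> subalgebra (P x) (F t)"
  using sub_F[of t] by (simp add: subalgebra_def space_law sets_law)

lemma adapted_measurable: "adapted F Y \<Longrightarrow> 0 \<le> t \<Longrightarrow> Y t \<in> borel_measurable (P x)"
  using measurable_from_subalg[OF subalgebra_law] by (auto simp: adapted_def)

lemma cadlag_right_continuous:
  "cadlag_process (P x) Y \<Longrightarrow> \<omega> \<in> space (P x) \<Longrightarrow> 0 \<le> t \<Longrightarrow> continuous (at_right t) (\<lambda>t. Y t \<omega>)"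
  by (simp add: cadlag_process_def cadlag_def)

lemma measurable_process:
  assumes "adapted F Y" "cadlag_process (P x) Y"
  shows "(\<lambda>(t, \<omega>). Y (max 0 t) \<omega>) \<in> borel_measurable (borel \<Otimes>\<^sub>M P x)"
  using assms by (intro measurable_right_continuous_process adapted_measurable cadlag_right_continuous)

lemma measurable_process_time:
  assumes "adapted F Y" "cadlag_process (P x) Y"
  shows "(\<lambda>z. Y (snd z) (fst z)) \<in> borel_measurable (P x \<Otimes>\<^sub>M time_measure)"
  by (intro measurable_pair_time measurable_process assms)

lemma cadlag_X: "cadlag_process (P x) X"
  using levy_X[of x] by (simp add: levy_process_def)

lemma cadlag_cost: "cadlag_process (P x) k"
  using cadlag_k by (simp add: cadlag_process_def space_law)

text \<open>Exhibits the marginal cost as a limit of measurable difference quotients; steps to the right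
  stay in the domain even at \<open>\<theta> = 0\<close>.\<close>

lemma derivative_as_limit:
  assumes "0 \<le> t" "0 \<le> \<theta>"
  shows "(\<lambda>n. (c t y (\<theta> + 1 / Suc n) - c t y \<theta>) * Suc n) \<longlonglongrightarrow> c\<theta> t y \<theta>"
proof -
  have "((\<lambda>z. (c t y z - c t y \<theta>) / (z - \<theta>)) \<longlongrightarrow> c\<theta> t y \<theta>) (at \<theta> within {0..})"
    using deriv_c[OF assms] by (simp add: has_field_derivative_iff)
  moreover have "filterlim (\<lambda>n. \<theta> + 1 / Suc n) (at \<theta> within {0..}) sequentially"
  proof -
    have "(\<lambda>n. \<theta> + 1 / Suc n) \<longlonglongrightarrow> \<theta>"
      using tendsto_add[OF tendsto_const LIMSEQ_Suc[OF lim_1_over_n], of \<theta>] by simp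
    then show ?thesis
      unfolding filterlim_at using assms by (auto intro!: always_eventually add_nonneg_nonneg)
  qed
  ultimately have "(\<lambda>n. (c t y (\<theta> + 1 / Suc n) - c t y \<theta>) / (\<theta> + 1 / Suc n - \<theta>)) \<longlonglongrightarrow> c\<theta> t y \<theta>"
    by (rule filterlim_compose)
  then show ?thesis by simp
qed

lemma measurable_running_cost:
  assumes "f \<in> borel_measurable N" "g \<in> borel_measurable N" "h \<in> borel_measurable N"
    and "\<And>z. z \<in> space N \<Longrightarrow> 0 \<le> f z" "\<And>z. z \<in> space N \<Longrightarrow> 0 \<le> h z"
  shows "(\<lambda>z. c (f z) (g z) (h z)) \<in> borel_measurable N"
proof -
  have "(\<lambda>z. (f z, g z, h z)) \<in> N \<rightarrow>\<^sub>M restrict_space borel ({0..} \<times> UNIV \<times> {0..})"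
    using assms by (intro measurable_restrict_space2 borel_measurable_Pair) auto
  from measurable_compose[OF this measurable_c] show ?thesis by simp
qed

lemma measurable_marginal_cost:
  assumes [measurable]: "f \<in> borel_measurable N" "g \<in> borel_measurable N" "h \<in> borel_measurable N"
    and nonneg: "\<And>z. z \<in> space N \<Longrightarrow> 0 \<le> f z" "\<And>z. z \<in> space N \<Longrightarrow> 0 \<le> h z"
  shows "(\<lambda>z. c\<theta> (f z) (g z) (h z)) \<in> borel_measurable N"
proof (rule borel_measurable_LIMSEQ_real[where
      u="\<lambda>n z. (c (f z) (g z) (h z + 1 / Suc n) - c (f z) (g z) (h z)) * Suc n"])
  show "(\<lambda>n. (c (f z) (g z) (h z + 1 / Suc n) - c (f z) (g z) (h z)) * Suc n)
      \<longlonglongrightarrow> c\<theta> (f z) (g z) (h z)" if "z \<in> space N" for z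
    using nonneg that by (intro derivative_as_limit)
  have "(\<lambda>z. c (f z) (g z) (h z + 1 / Suc n)) \<in> borel_measurable N" for n
    using nonneg by (intro measurable_running_cost) (auto intro!: add_nonneg_nonneg)
  moreover have "(\<lambda>z. c (f z) (g z) (h z)) \<in> borel_measurable N"
    using nonneg by (intro measurable_running_cost) auto
  ultimately show "(\<lambda>z. (c (f z) (g z) (h z + 1 / Suc n) - c (f z) (g z) (h z)) * Suc n)
      \<in> borel_measurable N" for n
    by measurable
qed

lemma mean_value:
  assumes "0 \<le> t" "0 \<le> a" "a < b"
  obtains \<xi> where "a < \<xi>" "\<xi> < b" "c t y b - c t y a = c\<theta> t y \<xi> * (b - a)"
proof -
  have "\<exists>\<xi>\<in>{a<..<b}. c t y b - c t y a = (\<lambda>h. c\<theta> t y \<xi> * h) (b - a)"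
  proof (rule mvt_simple[OF \<open>a < b\<close>])
    show "(c t y has_derivative (\<lambda>h. c\<theta> t y z * h)) (at z within {a..b})" if "a \<le> z" "z \<le> b" for z
    proof -
      have "(c t y has_real_derivative c\<theta> t y z) (at z within {0..})"
        using assms that by (intro deriv_c) auto
      then have "(c t y has_real_derivative c\<theta> t y z) (at z within {a..b})"
        using assms by (elim has_field_derivative_subset) auto
      then show ?thesis by (simp add: has_field_derivative_def)
    qed
  qed
  then obtain \<xi> where "\<xi> \<in> {a<..<b}" "c t y b - c t y a = c\<theta> t y \<xi> * (b - a)" by blast
  then show ?thesis by (intro that[of \<xi>]) auto
qed

text \<open>The running cost is convex in the control, as its derivative increases, so it lies above its
  tangent at \<open>a\<close>.\<close>

lemma running_cost_tangent:
  assumes "0 \<le> t" "0 \<le> a" "a \<le> b"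
  shows "c t y a - c t y b \<le> - c\<theta> t y a * (b - a)"
proof (cases "a = b")
  case False
  with assms have "a < b" by simp
  obtain \<xi> where \<xi>: "a < \<xi>" "c t y b - c t y a = c\<theta> t y \<xi> * (b - a)"
    by (rule mean_value[OF assms(1,2) \<open>a < b\<close>])
  have "c\<theta> t y a \<le> c\<theta> t y \<xi>"
    using strict_mono_onD[OF strict_mono_c\<theta>[OF assms(1)], of a \<xi> y] \<xi> assms by auto
  then have "c\<theta> t y a * (b - a) \<le> c\<theta> t y \<xi> * (b - a)"
    using assms by (intro mult_right_mono) auto
  then show ?thesis using \<xi> by simp
qed simp

lemma marginal_cost_bound:
  obtains L where "0 \<le> L" "\<forall>t\<ge>0. \<forall>\<theta>\<ge>0. \<forall>y. \<bar>c\<theta> t y \<theta>\<bar> \<le> L"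
    "\<forall>t\<ge>0. \<forall>a\<ge>0. \<forall>b\<ge>a. \<forall>y. \<bar>c t y a - c t y b\<bar> \<le> L * (b - a)"
proof -
  obtain L where L: "\<And>t y \<theta>. 0 \<le> t \<Longrightarrow> 0 \<le> \<theta> \<Longrightarrow> \<bar>c\<theta> t y \<theta>\<bar> \<le> L"
    using bounded_c\<theta> by blast
  have "0 \<le> L" using L[of 0 0 0] by fastforce
  have lipschitz: "\<bar>c t y a - c t y b\<bar> \<le> L * (b - a)" if ab: "0 \<le> t" "0 \<le> a" "a \<le> b" for t y a b
  proof (cases "a = b")
    case False
    with ab have "a < b" by simp
    obtain \<xi> where \<xi>: "a < \<xi>" "c t y b - c t y a = c\<theta> t y \<xi> * (b - a)"
      by (rule mean_value[OF ab(1,2) \<open>a < b\<close>])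
    have "\<bar>c t y a - c t y b\<bar> = \<bar>c t y b - c t y a\<bar>" by (rule abs_minus_commute)
    also have "\<dots> = \<bar>c\<theta> t y \<xi>\<bar> * (b - a)"
      using ab unfolding \<xi>(2) by (simp add: abs_mult)
    finally have "\<bar>c t y a - c t y b\<bar> = \<bar>c\<theta> t y \<xi>\<bar> * (b - a)" .
    then show ?thesis using L[of t \<xi> y] \<xi>(1) ab by (simp add: mult_right_mono)
  qed simp
  show ?thesis using \<open>0 \<le> L\<close> L lipschitz by (intro that[of L]) auto
qed

text \<open>The supremum over all times need not be measurable, so it is taken over the rational times,
  which suffices for a right-continuous path.\<close>

lemma intervention_cost_dominated:
  obtains R where "R \<in> borel_measurable (P x)" "\<forall>\<omega>. 0 \<le> R \<omega>"
    "AE \<omega> in P x. \<forall>t\<ge>0. k t \<omega> \<le> R \<omega>" "(\<integral>\<^sup>+ \<omega>. ennreal ((R \<omega>)\<^sup>2) \<partial>P x) < \<infinity>"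
proof -
  define Q :: "real set" where "Q = {q\<in>\<rat>. 0 \<le> q}"
  have Q: "countable Q" "\<And>q. q \<in> Q \<Longrightarrow> 0 \<le> q"
    unfolding Q_def by (auto intro: countable_subset[OF _ countable_rat])
  define W where "W \<omega> = (SUP q\<in>Q. ennreal ((k q \<omega>)\<^sup>2))" for \<omega>
  have [measurable]: "W \<in> borel_measurable (P x)"
    unfolding W_def[abs_def]
    using Q adapted_measurable[OF adapted_k] by (intro borel_measurable_SUP) auto
  have "(\<integral>\<^sup>+ \<omega>. W \<omega> \<partial>P x) \<le> (\<integral>\<^sup>+ \<omega>. (SUP t\<in>{0..}. ennreal (\<bar>k t \<omega>\<bar>\<^sup>2)) \<partial>P x)"
    unfolding W_def using Q by (intro nn_integral_mono SUP_subset_mono) auto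
  then have fin: "(\<integral>\<^sup>+ \<omega>. W \<omega> \<partial>P x) < \<infinity>" using k_L2 by (rule le_less_trans)
  then have "AE \<omega> in P x. W \<omega> \<noteq> \<infinity>"
    by (intro nn_integral_noteq_infinite) auto
  then have "AE \<omega> in P x. \<forall>t\<ge>0. k t \<omega> \<le> sqrt (enn2real (W \<omega>))"
    using AE_space
  proof eventually_elim
    case (elim \<omega>)
    show ?case
    proof (intro allI impI)
      fix t :: real assume "0 \<le> t"
      show "k t \<omega> \<le> sqrt (enn2real (W \<omega>))"
      proof (rule right_continuous_le_from_rationals[where f="\<lambda>t. k t \<omega>"])
        show "continuous (at_right t) (\<lambda>t. k t \<omega>)"
          by (rule cadlag_right_continuous[OF cadlag_cost elim(2) \<open>0 \<le> t\<close>])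
        fix q :: real assume "q \<in> \<rat>" "t < q"
        then have "ennreal ((k q \<omega>)\<^sup>2) \<le> W \<omega>"
          unfolding W_def Q_def using \<open>0 \<le> t\<close> by (intro SUP_upper) auto
        then have "(k q \<omega>)\<^sup>2 \<le> enn2real (W \<omega>)" using elim(1) by (cases "W \<omega>") auto
        then show "k q \<omega> \<le> sqrt (enn2real (W \<omega>))" by (rule real_le_rsqrt)
      qed
    qed
  qed
  moreover have "(\<integral>\<^sup>+ \<omega>. ennreal ((sqrt (enn2real (W \<omega>)))\<^sup>2) \<partial>P x) < \<infinity>"
  proof -
    have "(\<integral>\<^sup>+ \<omega>. ennreal ((sqrt (enn2real (W \<omega>)))\<^sup>2) \<partial>P x) \<le> (\<integral>\<^sup>+ \<omega>. W \<omega> \<partial>P x)"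
      by (intro nn_integral_mono) (simp add: ennreal_enn2real_if)
    then show ?thesis using fin by (rule le_less_trans)
  qed
  ultimately show ?thesis by (intro that[of "\<lambda>\<omega>. sqrt (enn2real (W \<omega>))"]) auto
qed

end

section \<open>Increasing processes\<close>

text \<open>The controls without the square integrability condition.\<close>

definition increasing_process :: "'a measure \<Rightarrow> (real \<Rightarrow> 'a measure) \<Rightarrow> (real \<Rightarrow> 'a \<Rightarrow> real) \<Rightarrow> bool" where
  "increasing_process M F \<theta> \<longleftrightarrow> adapted F \<theta> \<and> cadlag_process M \<theta> \<and>
     (\<forall>\<omega>\<in>space M. 0 \<le> \<theta> 0 \<omega> \<and> mono_on {0..} (\<lambda>t. \<theta> t \<omega>))"

definition discounted_mass :: "real \<Rightarrow> (real \<Rightarrow> 'a \<Rightarrow> real) \<Rightarrow> 'a \<Rightarrow> ennreal" where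
  "discounted_mass r \<theta> \<omega> = (\<integral>\<^sup>+ t\<in>{0..}. ennreal (exp (- r * t)) \<partial>stieltjes \<theta> \<omega>)"

lemma ennreal_mult_le_sum_squares: "a * b \<le> a\<^sup>2 + b\<^sup>2" for a b :: ennreal
proof (cases "a \<le> b")
  case True
  then have "a * b \<le> b\<^sup>2" unfolding power2_eq_square by (rule mult_right_mono) simp
  also have "\<dots> \<le> a\<^sup>2 + b\<^sup>2" by simp
  finally show ?thesis .
next
  case False
  then have "a * b \<le> a\<^sup>2" unfolding power2_eq_square by (intro mult_left_mono) auto
  also have "\<dots> \<le> a\<^sup>2 + b\<^sup>2" by simp
  finally show ?thesis .
qed

context singular_control_setting
begin

abbreviation "intervention_cost \<theta> \<omega> \<equiv>
  (\<integral>\<^sup>+ t\<in>{0..}. ennreal (k t \<omega> * exp (- r * t)) \<partial>stieltjes \<theta> \<omega>)"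

abbreviation "running_cost \<theta> t \<omega> \<equiv> c t (X t \<omega>) (\<theta> t \<omega>) * exp (- r * t)"

lemma controls_iff:
  "\<theta> \<in> controls (P x) F r \<longleftrightarrow>
    increasing_process (P x) F \<theta> \<and> (\<integral>\<^sup>+ \<omega>. (discounted_mass r \<theta> \<omega>)\<^sup>2 \<partial>P x) < \<infinity>"
  unfolding controls_def increasing_process_def discounted_mass_def by auto

context
  fixes \<theta> :: "real \<Rightarrow> 'a \<Rightarrow> real"
  assumes \<theta>: "increasing_process (P x) F \<theta>"
begin

lemma increasing_adapted: "adapted F \<theta>" and increasing_cadlag: "cadlag_process (P x) \<theta>"
  using \<theta> by (auto simp: increasing_process_def)

lemma increasing_mono: "\<omega> \<in> space (P x) \<Longrightarrow> 0 \<le> s \<Longrightarrow> s \<le> t \<Longrightarrow> \<theta> s \<omega> \<le> \<theta> t \<omega>"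
  using \<theta> by (auto simp: increasing_process_def mono_on_def)

lemma increasing_nonneg: "\<omega> \<in> space (P x) \<Longrightarrow> 0 \<le> t \<Longrightarrow> 0 \<le> \<theta> t \<omega>"
  using \<theta> increasing_mono[of \<omega> 0 t] by (force simp: increasing_process_def)

lemma level_time_le:
  "\<omega> \<in> space (P x) \<Longrightarrow> 0 \<le> t \<Longrightarrow> level_time \<theta> b \<omega> \<le> ennreal t \<longleftrightarrow> b \<le> \<theta> t \<omega>"
  using \<theta> cadlag_right_continuous[OF increasing_cadlag]
  by (intro level_time_le_iff) (auto simp: increasing_process_def)

lemma measurable_level_time: "(\<lambda>(b, \<omega>). level_time \<theta> b \<omega>) \<in> borel_measurable (borel \<Otimes>\<^sub>M P x)"
proof (rule borel_measurableI_le)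
  fix y :: ennreal
  show "{z \<in> space (borel \<Otimes>\<^sub>M P x). (case z of (b, \<omega>) \<Rightarrow> level_time \<theta> b \<omega>) \<le> y} \<in> sets (borel \<Otimes>\<^sub>M P x)"
  proof (cases y)
    case (real t)
    have [measurable]: "\<theta> t \<in> borel_measurable (P x)"
      using real by (intro adapted_measurable increasing_adapted)
    have "{z \<in> space (borel \<Otimes>\<^sub>M P x). (case z of (b, \<omega>) \<Rightarrow> level_time \<theta> b \<omega>) \<le> y}
        = {z \<in> space (borel \<Otimes>\<^sub>M P x). fst z \<le> \<theta> t (snd z)}"
      using real by (auto simp: space_pair_measure level_time_le)
    then show ?thesis by simp
  qed simp
qed

lemma measurable_level_time_level:
  "\<omega> \<in> space (P x) \<Longrightarrow> (\<lambda>b. level_time \<theta> b \<omega>) \<in> borel_measurable borel"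
  using measurable_compose[OF measurable_Pair2' measurable_level_time] by simp

lemma measurable_level_time_state: "level_time \<theta> b \<in> borel_measurable (P x)"
  using measurable_compose[OF measurable_Pair1' measurable_level_time] by simp

lemma emeasure_levels:
  assumes "\<omega> \<in> space (P x)" "0 \<le> t"
  shows "emeasure lborel {b. 0 < b \<and> level_time \<theta> b \<omega> \<le> ennreal t} = ennreal (\<theta> t \<omega>)"
proof -
  have "{b. 0 < b \<and> level_time \<theta> b \<omega> \<le> ennreal t} = {0<..\<theta> t \<omega>}"
    using assms by (auto simp: level_time_le)
  then show ?thesis using increasing_nonneg[OF assms] by simp
qed

lemma nn_integral_stieltjes_image:
  fixes T :: "real \<Rightarrow> ennreal"
  assumes "\<omega> \<in> space (P x)" "T \<in> borel_measurable borel" "f \<in> borel_measurable time_measure"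
    and "\<And>t. 0 \<le> t \<Longrightarrow> emeasure lborel {b. 0 < b \<and> T b \<le> ennreal t} = ennreal (\<theta> t \<omega>)"
  shows "(\<integral>\<^sup>+ t\<in>{0..}. f t \<partial>stieltjes \<theta> \<omega>)
    = (\<integral>\<^sup>+ b. f (enn2real (T b)) * indicator {b. 0 < b \<and> T b < \<infinity>} b \<partial>lborel)"
proof (rule nn_integral_stieltjes_levels[where \<theta>=\<theta> and \<omega>=\<omega> and T=T and f=f])
  show "mono_on {0..} (\<lambda>t. \<theta> t \<omega>)" "0 \<le> \<theta> 0 \<omega>"
    using \<theta> assms(1) by (auto simp: increasing_process_def)
  show "continuous (at_right t) (\<lambda>t. \<theta> t \<omega>)" if "0 \<le> t" for t
    using that by (intro cadlag_right_continuous[OF increasing_cadlag] assms(1))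
qed (use assms in auto)

lemma nn_integral_stieltjes:
  assumes "\<omega> \<in> space (P x)" "f \<in> borel_measurable time_measure"
  shows "(\<integral>\<^sup>+ t\<in>{0..}. f t \<partial>stieltjes \<theta> \<omega>)
    = (\<integral>\<^sup>+ b. f (enn2real (level_time \<theta> b \<omega>)) * indicator {b. 0 < b \<and> level_time \<theta> b \<omega> < \<infinity>} b \<partial>lborel)"
  using assms by (intro nn_integral_stieltjes_image measurable_level_time_level emeasure_levels)

text \<open>Integration by parts, obtained by swapping the integrals over levels and over times: a level
  reached at time \<open>T\<close> contributes \<open>exp (- r * T)\<close>, which is \<open>r * exp (- r * t)\<close> integrated over \<open>t \<ge>
  T\<close>. On the right-hand side monotonicity in \<open>\<theta>\<close> is visible.\<close>

lemma discounted_mass_eq: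
  assumes \<omega>: "\<omega> \<in> space (P x)"
  shows "discounted_mass r \<theta> \<omega> = (\<integral>\<^sup>+ t. ennreal (r * exp (- r * t) * \<theta> t \<omega>) \<partial>time_measure)"
proof -
  interpret levels_time: pair_sigma_finite lborel time_measure ..
  note [measurable] = measurable_level_time_level[OF \<omega>]
  have [measurable]: "(\<lambda>t. t) \<in> time_measure \<rightarrow>\<^sub>M borel"
    by (intro measurable_restrict_space1) simp
  let ?w = "\<lambda>t. ennreal (r * exp (- r * t))"
  let ?T = "\<lambda>b. level_time \<theta> b \<omega>"
  have "discounted_mass r \<theta> \<omega>
      = (\<integral>\<^sup>+ b. ennreal (exp (- r * enn2real (?T b))) * indicator {b. 0 < b \<and> ?T b < \<infinity>} b \<partial>lborel)"
    unfolding discounted_mass_def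
    by (intro nn_integral_stieltjes \<omega>) measurable
  also have "\<dots> = (\<integral>\<^sup>+ b. (\<integral>\<^sup>+ t. ?w t * indicator {t. ?T b \<le> ennreal t} t * indicator {0<..} b \<partial>time_measure) \<partial>lborel)"
  proof (rule nn_integral_cong)
    fix b :: real
    have "(\<integral>\<^sup>+ t. ?w t * indicator {t. ?T b \<le> ennreal t} t * indicator {0<..} b \<partial>time_measure)
        = (\<integral>\<^sup>+ t. ?w t * indicator {t. ?T b \<le> ennreal t} t \<partial>time_measure) * indicator {0<..} b"
      by (rule nn_integral_multc) measurable
    then show "ennreal (exp (- r * enn2real (?T b))) * indicator {b. 0 < b \<and> ?T b < \<infinity>} b
        = (\<integral>\<^sup>+ t. ?w t * indicator {t. ?T b \<le> ennreal t} t * indicator {0<..} b \<partial>time_measure)"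
      unfolding nn_integral_discount_from[OF r_pos]
      by (auto simp: less_top split: split_indicator)
  qed
  also have "\<dots> = (\<integral>\<^sup>+ t. (\<integral>\<^sup>+ b. ?w t * indicator {t. ?T b \<le> ennreal t} t * indicator {0<..} b \<partial>lborel) \<partial>time_measure)"
  proof (rule levels_time.Fubini'[symmetric])
    have [measurable]: "Measurable.pred (lborel \<Otimes>\<^sub>M time_measure) (\<lambda>z. ?T (fst z) \<le> ennreal (snd z))"
      by measurable
    have "(\<lambda>z. ?w (snd z) * indicator {z. ?T (fst z) \<le> ennreal (snd z)} z * indicator {0<..} (fst z))
        \<in> borel_measurable (lborel \<Otimes>\<^sub>M time_measure)"
      by measurable
    then show "(\<lambda>(b, t). ?w t * indicator {t. ?T b \<le> ennreal t} t * indicator {0<..} b)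
        \<in> borel_measurable (lborel \<Otimes>\<^sub>M time_measure)"
      by (simp add: case_prod_beta indicator_def)
  qed
  also have "\<dots> = (\<integral>\<^sup>+ t. ennreal (r * exp (- r * t) * \<theta> t \<omega>) \<partial>time_measure)"
  proof (rule nn_integral_cong)
    fix t assume "t \<in> space time_measure"
    then have t: "0 \<le> t" by (simp add: space_restrict_space)
    have "(\<integral>\<^sup>+ b. ?w t * indicator {t. ?T b \<le> ennreal t} t * indicator {0<..} b \<partial>lborel)
        = (\<integral>\<^sup>+ b. ?w t * indicator {b. 0 < b \<and> ?T b \<le> ennreal t} b \<partial>lborel)"
      by (intro nn_integral_cong) (auto split: split_indicator)
    also have "\<dots> = ?w t * emeasure lborel {b. 0 < b \<and> ?T b \<le> ennreal t}"
      by (rule nn_integral_cmult_indicator) measurable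
    also have "\<dots> = ennreal (r * exp (- r * t) * \<theta> t \<omega>)"
      using r_pos increasing_nonneg[OF \<omega> t] by (simp add: emeasure_levels[OF \<omega> t] ennreal_mult)
    finally show "(\<integral>\<^sup>+ b. ?w t * indicator {t. ?T b \<le> ennreal t} t * indicator {0<..} b \<partial>lborel)
        = ennreal (r * exp (- r * t) * \<theta> t \<omega>)" .
  qed
  finally show ?thesis .
qed

lemma measurable_discounted_mass: "discounted_mass r \<theta> \<in> borel_measurable (P x)"
proof -
  note [measurable] = measurable_process_time[OF increasing_adapted increasing_cadlag]
  have [measurable]: "(\<lambda>t. t) \<in> time_measure \<rightarrow>\<^sub>M borel"
    by (intro measurable_restrict_space1) simp
  have "(\<lambda>\<omega>. \<integral>\<^sup>+ t. ennreal (r * exp (- r * t) * \<theta> t \<omega>) \<partial>time_measure) \<in> borel_measurable (P x)"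
  proof (rule time.borel_measurable_nn_integral)
    have "(\<lambda>z. ennreal (r * exp (- r * snd z) * \<theta> (snd z) (fst z))) \<in> borel_measurable (P x \<Otimes>\<^sub>M time_measure)"
      by measurable
    then show "(\<lambda>(\<omega>, t). ennreal (r * exp (- r * t) * \<theta> t \<omega>)) \<in> borel_measurable (P x \<Otimes>\<^sub>M time_measure)"
      by (simp add: case_prod_beta)
  qed
  then show ?thesis
    by (rule measurable_cong[THEN iffD1, rotated]) (simp add: discounted_mass_eq)
qed

lemma measurable_intervention_cost: "(\<lambda>\<omega>. intervention_cost \<theta> \<omega>) \<in> borel_measurable (P x)"
proof -
  note [measurable] = measurable_process[OF adapted_k cadlag_cost] measurable_level_time
  have T [measurable]: "(\<lambda>z. level_time \<theta> (snd z) (fst z)) \<in> borel_measurable (P x \<Otimes>\<^sub>M lborel)"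
    using measurable_compose[OF _ measurable_level_time, of "\<lambda>z. (snd z, fst z)" "P x \<Otimes>\<^sub>M lborel"]
    by simp
  have "(\<lambda>z. (enn2real (level_time \<theta> (snd z) (fst z)), fst z)) \<in> P x \<Otimes>\<^sub>M lborel \<rightarrow>\<^sub>M borel \<Otimes>\<^sub>M P x"
    by measurable
  from measurable_compose[OF this measurable_process[OF adapted_k cadlag_cost]]
  have [measurable]: "(\<lambda>z. k (enn2real (level_time \<theta> (snd z) (fst z))) (fst z)) \<in> borel_measurable (P x \<Otimes>\<^sub>M lborel)"
    by simp
  have "(\<lambda>\<omega>. \<integral>\<^sup>+ b. ennreal (k (enn2real (level_time \<theta> b \<omega>)) \<omega> * exp (- r * enn2real (level_time \<theta> b \<omega>)))
      * indicator {b. 0 < b \<and> level_time \<theta> b \<omega> < \<infinity>} b \<partial>lborel) \<in> borel_measurable (P x)"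
  proof (rule lborel.borel_measurable_nn_integral)
    have "(\<lambda>z. ennreal (k (enn2real (level_time \<theta> (snd z) (fst z))) (fst z)
          * exp (- r * enn2real (level_time \<theta> (snd z) (fst z))))
        * indicator {z. 0 < snd z \<and> level_time \<theta> (snd z) (fst z) < \<infinity>} z)
        \<in> borel_measurable (P x \<Otimes>\<^sub>M lborel)"
      by measurable
    then show "(\<lambda>(\<omega>, b). ennreal (k (enn2real (level_time \<theta> b \<omega>)) \<omega> * exp (- r * enn2real (level_time \<theta> b \<omega>)))
      * indicator {b. 0 < b \<and> level_time \<theta> b \<omega> < \<infinity>} b) \<in> borel_measurable (P x \<Otimes>\<^sub>M lborel)"
      by (simp add: case_prod_beta indicator_def)
  qed
  then show ?thesis
  proof (rule measurable_cong[THEN iffD1, rotated])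
    fix \<omega> assume \<omega>: "\<omega> \<in> space (P x)"
    have "(\<lambda>t. ennreal (k t \<omega> * exp (- r * t))) \<in> borel_measurable time_measure"
    proof -
      have [measurable]: "(\<lambda>t. t) \<in> time_measure \<rightarrow>\<^sub>M borel"
        by (intro measurable_restrict_space1) simp
      have [measurable]: "(\<lambda>t. k t \<omega>) \<in> borel_measurable time_measure"
        using measurable_compose[OF measurable_Pair1'[OF \<omega>] measurable_process_time[OF adapted_k cadlag_cost]]
        by simp
      show ?thesis by measurable
    qed
    from nn_integral_stieltjes[OF \<omega> this] show "(\<integral>\<^sup>+ b. ennreal (k (enn2real (level_time \<theta> b \<omega>)) \<omega>
          * exp (- r * enn2real (level_time \<theta> b \<omega>)))
        * indicator {b. 0 < b \<and> level_time \<theta> b \<omega> < \<infinity>} b \<partial>lborel) = intervention_cost \<theta> \<omega>"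
      by simp
  qed
qed

lemma intervention_cost_le:
  assumes "\<And>t. 0 \<le> t \<Longrightarrow> k t \<omega> \<le> R"
  shows "intervention_cost \<theta> \<omega> \<le> ennreal R * discounted_mass r \<theta> \<omega>"
proof -
  have "intervention_cost \<theta> \<omega> \<le> (\<integral>\<^sup>+ t. ennreal R * (ennreal (exp (- r * t)) * indicator {0..} t) \<partial>stieltjes \<theta> \<omega>)"
  proof (rule nn_integral_mono)
    fix t
    show "ennreal (k t \<omega> * exp (- r * t)) * indicator {0..} t \<le> ennreal R * (ennreal (exp (- r * t)) * indicator {0..} t)"
      using assms[of t]
      by (auto split: split_indicator simp: ennreal_mult''[symmetric] intro!: ennreal_leI)
  qed
  also have "\<dots> = ennreal R * discounted_mass r \<theta> \<omega>"
    unfolding discounted_mass_def by (rule nn_integral_cmult) (simp add: stieltjes_def)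
  finally show ?thesis .
qed

end

end

section \<open>Finiteness of the optimal cost\<close>

context singular_control_setting
begin

lemma controlsD:
  assumes "\<theta> \<in> controls (P x) F r"
  shows "increasing_process (P x) F \<theta>" "(\<integral>\<^sup>+ \<omega>. (discounted_mass r \<theta> \<omega>)\<^sup>2 \<partial>P x) < \<infinity>"
    "AE \<omega> in P x. discounted_mass r \<theta> \<omega> < \<infinity>"
proof -
  show inc: "increasing_process (P x) F \<theta>" and fin: "(\<integral>\<^sup>+ \<omega>. (discounted_mass r \<theta> \<omega>)\<^sup>2 \<partial>P x) < \<infinity>"
    using assms by (auto simp: controls_iff)
  have "AE \<omega> in P x. (discounted_mass r \<theta> \<omega>)\<^sup>2 \<noteq> \<infinity>"
    using fin measurable_discounted_mass[OF inc] by (intro nn_integral_noteq_infinite) auto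
  then show "AE \<omega> in P x. discounted_mass r \<theta> \<omega> < \<infinity>"
    by eventually_elim (auto simp: less_top power2_eq_square ennreal_mult_eq_top_iff)
qed

lemma control_below:
  assumes "\<theta> \<in> controls (P x) F r" "increasing_process (P x) F \<eta>"
    and "\<And>\<omega> t. \<omega> \<in> space (P x) \<Longrightarrow> 0 \<le> t \<Longrightarrow> \<eta> t \<omega> \<le> \<theta> t \<omega>"
  shows "\<eta> \<in> controls (P x) F r"
proof -
  have "(\<integral>\<^sup>+ \<omega>. (discounted_mass r \<eta> \<omega>)\<^sup>2 \<partial>P x) \<le> (\<integral>\<^sup>+ \<omega>. (discounted_mass r \<theta> \<omega>)\<^sup>2 \<partial>P x)"
  proof (intro nn_integral_mono power_mono)
    fix \<omega> assume "\<omega> \<in> space (P x)"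
    then show "discounted_mass r \<eta> \<omega> \<le> discounted_mass r \<theta> \<omega>"
      using assms(2,3) controlsD(1)[OF assms(1)] r_pos
      by (auto simp: discounted_mass_eq space_restrict_space intro!: nn_integral_mono ennreal_leI mult_left_mono)
  qed simp
  then show ?thesis using assms controlsD(2)[OF assms(1)] by (auto simp: controls_iff intro: le_less_trans)
qed

lemma constant_control:
  assumes "0 \<le> y"
  shows "(\<lambda>_ _. y) \<in> controls (P x) F r"
proof -
  have inc: "increasing_process (P x) F (\<lambda>_ _. y)"
    using assms by (auto simp: increasing_process_def adapted_def cadlag_process_def cadlag_def mono_on_def
        intro!: exI tendsto_const)
  have "discounted_mass r (\<lambda>_ _. y) \<omega> = ennreal y" if "\<omega> \<in> space (P x)" for \<omega>
  proof -
    have "discounted_mass r (\<lambda>_ _. y) \<omega> = (\<integral>\<^sup>+ t. ennreal y * (ennreal (r * exp (- r * t)) * indicator {t. 0 \<le> ennreal t} t) \<partial>time_measure)"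
      unfolding discounted_mass_eq[OF inc that] using assms r_pos
      by (intro nn_integral_cong) (simp add: ennreal_mult'' mult.commute)
    also have "\<dots> = ennreal y * (\<integral>\<^sup>+ t. ennreal (r * exp (- r * t)) * indicator {t. 0 \<le> ennreal t} t \<partial>time_measure)"
    proof (rule nn_integral_cmult)
      have [measurable]: "(\<lambda>t. t) \<in> time_measure \<rightarrow>\<^sub>M borel"
        by (intro measurable_restrict_space1) simp
      show "(\<lambda>t. ennreal (r * exp (- r * t)) * indicator {t. 0 \<le> ennreal t} t) \<in> borel_measurable time_measure"
        by simp
    qed
    finally show ?thesis by (simp only: nn_integral_discount_from[OF r_pos]) simp
  qed
  then have "(\<integral>\<^sup>+ \<omega>. (discounted_mass r (\<lambda>_ _. y) \<omega>)\<^sup>2 \<partial>P x) = (\<integral>\<^sup>+ \<omega>. ennreal (y\<^sup>2) \<partial>P x)"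
    using assms by (intro nn_integral_cong) (simp add: ennreal_power)
  then show ?thesis using inc by (simp add: controls_iff law.emeasure_space_1)
qed

lemma measurable_running_cost_process:
  assumes "increasing_process (P x) F \<theta>"
  shows "(\<lambda>z. running_cost \<theta> (snd z) (fst z)) \<in> borel_measurable (P x \<Otimes>\<^sub>M time_measure)"
proof -
  have [measurable]: "(\<lambda>t. t) \<in> time_measure \<rightarrow>\<^sub>M borel"
    by (intro measurable_restrict_space1) simp
  have "(\<lambda>z. c (snd z) (X (snd z) (fst z)) (\<theta> (snd z) (fst z))) \<in> borel_measurable (P x \<Otimes>\<^sub>M time_measure)"
  proof (rule measurable_running_cost)
    show "(\<lambda>z. X (snd z) (fst z)) \<in> borel_measurable (P x \<Otimes>\<^sub>M time_measure)"
      by (intro measurable_process_time adapted_X cadlag_X)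
    show "(\<lambda>z. \<theta> (snd z) (fst z)) \<in> borel_measurable (P x \<Otimes>\<^sub>M time_measure)"
      by (intro measurable_process_time increasing_adapted[OF assms] increasing_cadlag[OF assms])
  qed (auto simp: space_pair_measure space_restrict_space intro: increasing_nonneg[OF assms])
  then show ?thesis by measurable
qed

lemma measurable_running_cost_path:
  assumes "increasing_process (P x) F \<theta>" "\<omega> \<in> space (P x)"
  shows "(\<lambda>t. running_cost \<theta> t \<omega>) \<in> borel_measurable time_measure"
  using measurable_compose[OF measurable_Pair1'[OF assms(2)] measurable_running_cost_process[OF assms(1)]]
  by simp

abbreviation "total_running_cost \<theta> \<omega> \<equiv> ext_integral time_measure (\<lambda>t. ereal (running_cost \<theta> t \<omega>))"

lemma measurable_total_running_cost:
  assumes "increasing_process (P x) F \<theta>"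
  shows "(\<lambda>\<omega>. total_running_cost \<theta> \<omega>) \<in> borel_measurable (P x)"
proof -
  note [measurable] = measurable_running_cost_process[OF assms]
  have "(\<lambda>(\<omega>, t). ennreal (running_cost \<theta> t \<omega>)) \<in> borel_measurable (P x \<Otimes>\<^sub>M time_measure)"
    "(\<lambda>(\<omega>, t). ennreal (- running_cost \<theta> t \<omega>)) \<in> borel_measurable (P x \<Otimes>\<^sub>M time_measure)"
    using measurable_running_cost_process[OF assms] by (simp_all add: case_prod_beta)
  note [measurable] = this[THEN time.borel_measurable_nn_integral]
  have "(\<lambda>\<omega>. enn2ereal (\<integral>\<^sup>+ t. ennreal (running_cost \<theta> t \<omega>) \<partial>time_measure)
      - enn2ereal (\<integral>\<^sup>+ t. ennreal (- running_cost \<theta> t \<omega>) \<partial>time_measure)) \<in> borel_measurable (P x)"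
    by measurable
  then show ?thesis by (simp add: ext_integral_def)
qed

abbreviation "total_min_cost \<omega> \<equiv>
  ext_integral time_measure (\<lambda>t. min_cost r c t (X t \<omega>) (k t \<omega>) * ereal (exp (- r * t)))"

text \<open>By definition of the minimal cost, \<open>C \<le> c + r * k * \<theta>\<close> along every control, and the last term
  integrates to at most \<open>R\<close> times the discounted mass by \<open>discounted_mass_eq\<close>.\<close>

lemma total_min_cost_le:
  assumes inc: "increasing_process (P x) F \<theta>" and \<omega>: "\<omega> \<in> space (P x)"
    and bound: "\<And>t. 0 \<le> t \<Longrightarrow> k t \<omega> \<le> R" and fin: "discounted_mass r \<theta> \<omega> < \<infinity>"
  shows "total_min_cost \<omega> \<le> total_running_cost \<theta> \<omega> + enn2ereal (ennreal R * discounted_mass r \<theta> \<omega>)"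
proof -
  have [measurable]: "(\<lambda>t. t) \<in> time_measure \<rightarrow>\<^sub>M borel"
    by (intro measurable_restrict_space1) simp
  note [measurable] = measurable_running_cost_path[OF inc \<omega>]
    measurable_compose[OF measurable_Pair1'[OF \<omega>] measurable_process_time[OF adapted_k cadlag_cost], simplified]
    measurable_compose[OF measurable_Pair1'[OF \<omega>] measurable_process_time[OF increasing_adapted[OF inc] increasing_cadlag[OF inc]], simplified]
  let ?h = "\<lambda>t. r * k t \<omega> * \<theta> t \<omega> * exp (- r * t)"
  have k_nonneg: "0 \<le> k t \<omega>" if "0 \<le> t" for t
    using k_pos[OF that, of \<omega>] \<omega> by (simp add: space_law)
  have h_le: "(\<integral>\<^sup>+ t. ennreal (?h t) \<partial>time_measure) \<le> ennreal R * discounted_mass r \<theta> \<omega>"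
  proof -
    have "(\<integral>\<^sup>+ t. ennreal (?h t) \<partial>time_measure)
        \<le> (\<integral>\<^sup>+ t. ennreal R * ennreal (r * exp (- r * t) * \<theta> t \<omega>) \<partial>time_measure)"
    proof (rule nn_integral_mono)
      fix t assume "t \<in> space time_measure"
      then have t: "0 \<le> t" by (simp add: space_restrict_space)
      have "?h t = k t \<omega> * (r * exp (- r * t) * \<theta> t \<omega>)" by simp
      also have "\<dots> \<le> R * (r * exp (- r * t) * \<theta> t \<omega>)"
        using bound[OF t] increasing_nonneg[OF inc \<omega> t] r_pos by (intro mult_right_mono) auto
      finally show "ennreal (?h t) \<le> ennreal R * ennreal (r * exp (- r * t) * \<theta> t \<omega>)"
        using increasing_nonneg[OF inc \<omega> t] r_pos by (subst ennreal_mult''[symmetric]) (auto intro!: ennreal_leI)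
    qed
    also have "\<dots> = ennreal R * discounted_mass r \<theta> \<omega>"
      unfolding discounted_mass_eq[OF inc \<omega>] by (rule nn_integral_cmult) measurable
    finally show ?thesis .
  qed
  have "total_min_cost \<omega> \<le> total_running_cost \<theta> \<omega> + enn2ereal (\<integral>\<^sup>+ t. ennreal (?h t) \<partial>time_measure)"
  proof (rule ext_integral_le_add)
    show "(\<integral>\<^sup>+ t. ennreal (?h t) \<partial>time_measure) < \<infinity>"
      using h_le fin by (auto simp: ennreal_mult_less_top intro: le_less_trans)
    fix t assume "t \<in> space time_measure"
    then have t: "0 \<le> t" by (simp add: space_restrict_space)
    then show "0 \<le> ?h t" using k_nonneg increasing_nonneg[OF inc \<omega>] r_pos by simp
    have "min_cost r c t (X t \<omega>) (k t \<omega>) \<le> ereal (c t (X t \<omega>) (\<theta> t \<omega>) + r * k t \<omega> * \<theta> t \<omega>)"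
      unfolding min_cost_def using increasing_nonneg[OF inc \<omega> t] by (intro INF_lower) auto
    then have "min_cost r c t (X t \<omega>) (k t \<omega>) * ereal (exp (- r * t))
        \<le> ereal (c t (X t \<omega>) (\<theta> t \<omega>) + r * k t \<omega> * \<theta> t \<omega>) * ereal (exp (- r * t))"
      by (intro ereal_mult_right_mono) auto
    then show "min_cost r c t (X t \<omega>) (k t \<omega>) * ereal (exp (- r * t)) \<le> ereal (running_cost \<theta> t \<omega> + ?h t)"
      by (simp add: distrib_right)
  qed measurable
  also have "\<dots> \<le> total_running_cost \<theta> \<omega> + enn2ereal (ennreal R * discounted_mass r \<theta> \<omega>)"
    using h_le by (intro add_left_mono) (simp add: less_eq_ennreal.rep_eq[symmetric])
  finally show ?thesis .
qed

lemma nn_integral_dominated_product: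
  assumes "\<theta> \<in> controls (P x) F r" "R \<in> borel_measurable (P x)" "\<And>\<omega>. 0 \<le> R \<omega>"
    "(\<integral>\<^sup>+ \<omega>. ennreal ((R \<omega>)\<^sup>2) \<partial>P x) < \<infinity>"
  shows "(\<integral>\<^sup>+ \<omega>. ennreal (R \<omega>) * discounted_mass r \<theta> \<omega> \<partial>P x) < \<infinity>"
proof -
  note [measurable] = measurable_discounted_mass[OF controlsD(1)[OF assms(1)]] assms(2)
  have "(\<integral>\<^sup>+ \<omega>. ennreal (R \<omega>) * discounted_mass r \<theta> \<omega> \<partial>P x)
      \<le> (\<integral>\<^sup>+ \<omega>. ennreal ((R \<omega>)\<^sup>2) + (discounted_mass r \<theta> \<omega>)\<^sup>2 \<partial>P x)"
    using assms(3) by (intro nn_integral_mono) (metis ennreal_mult_le_sum_squares ennreal_power)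
  also have "\<dots> = (\<integral>\<^sup>+ \<omega>. ennreal ((R \<omega>)\<^sup>2) \<partial>P x) + (\<integral>\<^sup>+ \<omega>. (discounted_mass r \<theta> \<omega>)\<^sup>2 \<partial>P x)"
    by (rule nn_integral_add) measurable
  also have "\<dots> < \<infinity>" using assms(4) controlsD(2)[OF assms(1)] by simp
  finally show ?thesis .
qed

lemma intervention_cost_integrable:
  assumes "\<theta> \<in> controls (P x) F r"
  shows "(\<integral>\<^sup>+ \<omega>. intervention_cost \<theta> \<omega> \<partial>P x) < \<infinity>"
    "AE \<omega> in P x. intervention_cost \<theta> \<omega> < \<infinity>"
    "integrable (P x) (\<lambda>\<omega>. enn2real (intervention_cost \<theta> \<omega>))"
proof -
  note inc = controlsD(1)[OF assms]
  note [measurable] = measurable_intervention_cost[OF inc]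
  obtain R where R: "R \<in> borel_measurable (P x)" "\<forall>\<omega>. 0 \<le> R \<omega>"
    "AE \<omega> in P x. \<forall>t\<ge>0. k t \<omega> \<le> R \<omega>" "(\<integral>\<^sup>+ \<omega>. ennreal ((R \<omega>)\<^sup>2) \<partial>P x) < \<infinity>"
    by (rule intervention_cost_dominated)
  have "AE \<omega> in P x. intervention_cost \<theta> \<omega> \<le> ennreal (R \<omega>) * discounted_mass r \<theta> \<omega>"
    using R(3) by eventually_elim (intro intervention_cost_le[OF inc], blast)
  then have "(\<integral>\<^sup>+ \<omega>. intervention_cost \<theta> \<omega> \<partial>P x) \<le> (\<integral>\<^sup>+ \<omega>. ennreal (R \<omega>) * discounted_mass r \<theta> \<omega> \<partial>P x)"
    by (rule nn_integral_mono_AE)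
  then show fin: "(\<integral>\<^sup>+ \<omega>. intervention_cost \<theta> \<omega> \<partial>P x) < \<infinity>"
    using nn_integral_dominated_product[OF assms R(1) R(2)[rule_format] R(4)] by (rule le_less_trans)
  then have "AE \<omega> in P x. intervention_cost \<theta> \<omega> \<noteq> \<infinity>"
    by (intro nn_integral_noteq_infinite measurable_intervention_cost[OF inc]) simp
  then show AE: "AE \<omega> in P x. intervention_cost \<theta> \<omega> < \<infinity>" by (simp add: less_top)
  show "integrable (P x) (\<lambda>\<omega>. enn2real (intervention_cost \<theta> \<omega>))"
  proof (rule integrableI_nonneg)
    show "(\<lambda>\<omega>. enn2real (intervention_cost \<theta> \<omega>)) \<in> borel_measurable (P x)" by measurable
    have "(\<integral>\<^sup>+ \<omega>. ennreal (enn2real (intervention_cost \<theta> \<omega>)) \<partial>P x) \<le> (\<integral>\<^sup>+ \<omega>. intervention_cost \<theta> \<omega> \<partial>P x)"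
      by (intro nn_integral_mono) (simp add: ennreal_enn2real_if)
    then show "(\<integral>\<^sup>+ \<omega>. ennreal (enn2real (intervention_cost \<theta> \<omega>)) \<partial>P x) < \<infinity>"
      using fin by (rule le_less_trans)
  qed simp
qed

text \<open>A constant control acts only by its jump at time \<open>0\<close>, and the setting provides a constant with
  integrable running cost.\<close>

lemma objective_constant_control:
  obtains y where "0 \<le> y" "(\<integral>\<^sup>+ \<omega>. e2ennreal (total_running_cost (\<lambda>_ _. y) \<omega>) \<partial>P x) < \<infinity>"
    "objective (P x) X k c r (\<lambda>_ _. y) < \<infinity>"
proof -
  obtain y where y: "0 \<le> y" "ext_integral (P x) (total_running_cost (\<lambda>_ _. y)) < \<infinity>"
    using finite_cost by blast
  note con = constant_control[OF y(1)]
  note [measurable] = measurable_total_running_cost[OF controlsD(1)[OF con]]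
    measurable_intervention_cost[OF controlsD(1)[OF con]]
  have pos: "(\<integral>\<^sup>+ \<omega>. e2ennreal (total_running_cost (\<lambda>_ _. y) \<omega>) \<partial>P x) < \<infinity>"
    using y(2) by (rule ext_integral_less_infinity)
  have "(\<integral>\<^sup>+ \<omega>. e2ennreal (total_running_cost (\<lambda>_ _. y) \<omega> + enn2ereal (intervention_cost (\<lambda>_ _. y) \<omega>)) \<partial>P x)
      \<le> (\<integral>\<^sup>+ \<omega>. e2ennreal (total_running_cost (\<lambda>_ _. y) \<omega>) + intervention_cost (\<lambda>_ _. y) \<omega> \<partial>P x)"
    by (intro nn_integral_mono e2ennreal_add_le)
  also have "\<dots> = (\<integral>\<^sup>+ \<omega>. e2ennreal (total_running_cost (\<lambda>_ _. y) \<omega>) \<partial>P x)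
      + (\<integral>\<^sup>+ \<omega>. intervention_cost (\<lambda>_ _. y) \<omega> \<partial>P x)"
    by (rule nn_integral_add) measurable
  also have "\<dots> < \<infinity>" using pos intervention_cost_integrable(1)[OF con] by simp
  finally have "objective (P x) X k c r (\<lambda>_ _. y) < \<infinity>"
    unfolding objective_def by (rule ext_integral_less_infinityI)
  then show ?thesis using that y(1) pos by blast
qed

text \<open>The assumption on the total minimal cost also holds when both its positive and its negative
  part have infinite expectation. The comparison with the constant control excludes this, and the
  comparison with \<open>\<theta>\<close> then passes the bound on the negative part on to the running cost of \<open>\<theta>\<close>.\<close>

lemma running_cost_negative_part:
  assumes \<theta>: "\<theta> \<in> controls (P x) F r"
  shows "(\<integral>\<^sup>+ \<omega>. e2ennreal (- total_running_cost \<theta> \<omega>) \<partial>P x) < \<infinity>"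
proof -
  obtain R where R: "R \<in> borel_measurable (P x)" "\<forall>\<omega>. 0 \<le> R \<omega>"
    "AE \<omega> in P x. \<forall>t\<ge>0. k t \<omega> \<le> R \<omega>" "(\<integral>\<^sup>+ \<omega>. ennreal ((R \<omega>)\<^sup>2) \<partial>P x) < \<infinity>"
    by (rule intervention_cost_dominated)
  note [measurable] = R(1)
  define G where "G \<eta> \<omega> = ennreal (R \<omega>) * discounted_mass r \<eta> \<omega>" for \<eta> \<omega>
  have G: "G \<eta> \<in> borel_measurable (P x)" "(\<integral>\<^sup>+ \<omega>. G \<eta> \<omega> \<partial>P x) < \<infinity>"
    "AE \<omega> in P x. total_min_cost \<omega> \<le> total_running_cost \<eta> \<omega> + enn2ereal (G \<eta> \<omega>) \<and> G \<eta> \<omega> < \<infinity>"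
    if \<eta>: "\<eta> \<in> controls (P x) F r" for \<eta>
  proof -
    note [measurable] = measurable_discounted_mass[OF controlsD(1)[OF \<eta>]]
    show "G \<eta> \<in> borel_measurable (P x)" unfolding G_def[abs_def] by measurable
    show "(\<integral>\<^sup>+ \<omega>. G \<eta> \<omega> \<partial>P x) < \<infinity>"
      unfolding G_def using nn_integral_dominated_product[OF \<eta> R(1) R(2)[rule_format] R(4)] .
    show "AE \<omega> in P x. total_min_cost \<omega> \<le> total_running_cost \<eta> \<omega> + enn2ereal (G \<eta> \<omega>) \<and> G \<eta> \<omega> < \<infinity>"
      using R(3) controlsD(3)[OF \<eta>] AE_space unfolding G_def
    proof eventually_elim
      case (elim \<omega>)
      then show ?case
        using total_min_cost_le[OF controlsD(1)[OF \<eta>], of \<omega> "R \<omega>"] by (simp add: ennreal_mult_less_top)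
    qed
  qed
  obtain y where y: "0 \<le> y" "(\<integral>\<^sup>+ \<omega>. e2ennreal (total_running_cost (\<lambda>_ _. y) \<omega>) \<partial>P x) < \<infinity>"
    by (rule objective_constant_control)
  note con = constant_control[OF y(1)]
  have min_neg: "(\<integral>\<^sup>+ \<omega>. e2ennreal (- total_min_cost \<omega>) \<partial>P x) < \<infinity>"
  proof (rule ext_integral_greater_minus_infinity[OF min_cost_bound])
    note [measurable] = measurable_total_running_cost[OF controlsD(1)[OF con]] G(1)[OF con]
    have "(\<integral>\<^sup>+ \<omega>. e2ennreal (total_min_cost \<omega>) \<partial>P x)
        \<le> (\<integral>\<^sup>+ \<omega>. e2ennreal (total_running_cost (\<lambda>_ _. y) \<omega>) + G (\<lambda>_ _. y) \<omega> \<partial>P x)"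
    proof (rule nn_integral_mono_AE)
      show "AE \<omega> in P x. e2ennreal (total_min_cost \<omega>)
          \<le> e2ennreal (total_running_cost (\<lambda>_ _. y) \<omega>) + G (\<lambda>_ _. y) \<omega>"
        using G(3)[OF con]
        by eventually_elim (blast intro: order_trans[OF e2ennreal_mono e2ennreal_add_le])
    qed
    also have "\<dots> = (\<integral>\<^sup>+ \<omega>. e2ennreal (total_running_cost (\<lambda>_ _. y) \<omega>) \<partial>P x) + (\<integral>\<^sup>+ \<omega>. G (\<lambda>_ _. y) \<omega> \<partial>P x)"
      by (rule nn_integral_add) measurable
    also have "\<dots> < \<infinity>" using y(2) G(2)[OF con] by simp
    finally show "(\<integral>\<^sup>+ \<omega>. e2ennreal (total_min_cost \<omega>) \<partial>P x) < \<infinity>" .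
  qed
  note [measurable] = measurable_total_running_cost[OF controlsD(1)[OF \<theta>]] G(1)[OF \<theta>]
  \<comment> \<open>The pathwise minimal cost need not be measurable, so the sum of integrals is split off on the
    measurable side of the inequality.\<close>
  have "(\<integral>\<^sup>+ \<omega>. e2ennreal (- total_running_cost \<theta> \<omega>) \<partial>P x)
      \<le> (\<integral>\<^sup>+ \<omega>. (e2ennreal (- total_running_cost \<theta> \<omega>) - G \<theta> \<omega>) + G \<theta> \<omega> \<partial>P x)"
  proof (rule nn_integral_mono)
    show "a \<le> (a - b) + b" for a b :: ennreal
      by (cases "b \<le> a") (simp_all add: diff_add_cancel_ennreal add_increasing)
  qed
  also have "\<dots> = (\<integral>\<^sup>+ \<omega>. e2ennreal (- total_running_cost \<theta> \<omega>) - G \<theta> \<omega> \<partial>P x) + (\<integral>\<^sup>+ \<omega>. G \<theta> \<omega> \<partial>P x)"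
    by (rule nn_integral_add) measurable
  also have "\<dots> \<le> (\<integral>\<^sup>+ \<omega>. e2ennreal (- total_min_cost \<omega>) \<partial>P x) + (\<integral>\<^sup>+ \<omega>. G \<theta> \<omega> \<partial>P x)"
  proof (intro add_right_mono nn_integral_mono_AE)
    show "AE \<omega> in P x. e2ennreal (- total_running_cost \<theta> \<omega>) - G \<theta> \<omega> \<le> e2ennreal (- total_min_cost \<omega>)"
      using G(3)[OF \<theta>]
    proof eventually_elim
      case (elim \<omega>)
      obtain g where g: "G \<theta> \<omega> = ennreal g" "0 \<le> g"
        using elim by (cases "G \<theta> \<omega>") auto
      have "- total_running_cost \<theta> \<omega> \<le> - total_min_cost \<omega> + enn2ereal (G \<theta> \<omega>)"
        using elim g by (cases "total_running_cost \<theta> \<omega>"; cases "total_min_cost \<omega>") auto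
      then have "e2ennreal (- total_running_cost \<theta> \<omega>) \<le> e2ennreal (- total_min_cost \<omega>) + G \<theta> \<omega>"
        by (rule order_trans[OF e2ennreal_mono e2ennreal_add_le])
      then show ?case using g by (simp add: ennreal_minus_le_iff add.commute)
    qed
  qed
  also have "\<dots> < \<infinity>" using min_neg G(2)[OF \<theta>] by simp
  finally show ?thesis .
qed

end

section \<open>First-order comparison with a smaller control\<close>

context singular_control_setting
begin

text \<open>The objective at the optimum is bounded above by that of a constant control and below by
  \<open>running_cost_negative_part\<close>. As the intervention cost of a control is integrable, the running
  cost has to be integrable on its own.\<close>

lemma optimal_control_integrable:
  assumes opt: "optimal_control (P x) F X k c r \<theta>"
  shows "AE \<omega> in P x. integrable time_measure (\<lambda>t. running_cost \<theta> t \<omega>)"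
    "integrable (P x) (\<lambda>\<omega>. LINT t|time_measure. running_cost \<theta> t \<omega>)"
proof -
  have \<theta>: "\<theta> \<in> controls (P x) F r" using opt by (simp add: optimal_control_def)
  note inc = controlsD(1)[OF \<theta>]
  note total_meas [measurable] = measurable_total_running_cost[OF inc]
  note cost_meas [measurable] = measurable_intervention_cost[OF inc]
  define f where "f \<omega> = total_running_cost \<theta> \<omega> + enn2ereal (intervention_cost \<theta> \<omega>)" for \<omega>
  have [measurable]: "f \<in> borel_measurable (P x)"
    unfolding f_def[abs_def] using total_meas cost_meas by (intro borel_measurable_ereal_add) simp_all
  obtain y where y: "0 \<le> y" "objective (P x) X k c r (\<lambda>_ _. y) < \<infinity>"
    by (rule objective_constant_control)
  have "objective (P x) X k c r \<theta> \<le> objective (P x) X k c r (\<lambda>_ _. y)"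
    using opt constant_control[OF y(1)] by (auto simp: optimal_control_def intro: INF_lower)
  then have "ext_integral (P x) f < \<infinity>"
    using y(2) unfolding f_def[abs_def] objective_def by (rule le_less_trans)
  then have pos: "(\<integral>\<^sup>+ \<omega>. e2ennreal (f \<omega>) \<partial>P x) < \<infinity>" by (rule ext_integral_less_infinity)
  have "(\<integral>\<^sup>+ \<omega>. e2ennreal (- f \<omega>) \<partial>P x) \<le> (\<integral>\<^sup>+ \<omega>. e2ennreal (- total_running_cost \<theta> \<omega>) \<partial>P x)"
  proof (intro nn_integral_mono e2ennreal_mono)
    have "a \<le> a + enn2ereal b" for a b by (simp add: add_increasing2)
    then show "- f \<omega> \<le> - total_running_cost \<theta> \<omega>" for \<omega> unfolding f_def by simp
  qed
  then have neg: "(\<integral>\<^sup>+ \<omega>. e2ennreal (- f \<omega>) \<partial>P x) < \<infinity>"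
    using running_cost_negative_part[OF \<theta>] by (rule le_less_trans)
  have path: "integrable time_measure (\<lambda>t. running_cost \<theta> t \<omega>)
      \<and> f \<omega> = ereal ((LINT t|time_measure. running_cost \<theta> t \<omega>) + enn2real (intervention_cost \<theta> \<omega>))"
    if \<omega>: "\<omega> \<in> space (P x)" and fin: "\<bar>f \<omega>\<bar> \<noteq> \<infinity>" "intervention_cost \<theta> \<omega> < \<infinity>" for \<omega>
  proof -
    let ?K = "intervention_cost \<theta> \<omega>"
    have K: "enn2ereal ?K = ereal (enn2real ?K)"
      using fin(2) by (cases ?K) auto
    have total: "\<bar>total_running_cost \<theta> \<omega>\<bar> \<noteq> \<infinity>"
      using fin(1) unfolding f_def K by (cases "total_running_cost \<theta> \<omega>") auto
    have int: "integrable time_measure (\<lambda>t. running_cost \<theta> t \<omega>)"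
      unfolding real_integrable_def
    proof (intro conjI)
      let ?p = "\<integral>\<^sup>+ t. ennreal (running_cost \<theta> t \<omega>) \<partial>time_measure"
      let ?n = "\<integral>\<^sup>+ t. ennreal (- running_cost \<theta> t \<omega>) \<partial>time_measure"
      have eq: "total_running_cost \<theta> \<omega> = enn2ereal ?p - enn2ereal ?n"
        by (simp add: ext_integral_def)
      show "?p \<noteq> \<infinity>"
      proof
        assume "?p = \<infinity>"
        then show False using total unfolding eq by simp
      qed
      then have p: "enn2ereal ?p = ereal (enn2real ?p)" by (cases ?p) auto
      show "?n \<noteq> \<infinity>"
      proof
        assume "?n = \<infinity>"
        then show False using total unfolding eq p by simp
      qed
    qed (rule measurable_running_cost_path[OF inc \<omega>])
    show ?thesis using int unfolding f_def K ext_integral_integrable[OF int] by simp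
  qed
  have finite_AE: "AE \<omega> in P x. \<bar>f \<omega>\<bar> \<noteq> \<infinity>"
    by (rule ext_integral_finite_imp(1)[OF _ pos neg]) measurable
  have AE: "AE \<omega> in P x. integrable time_measure (\<lambda>t. running_cost \<theta> t \<omega>)
      \<and> f \<omega> = ereal ((LINT t|time_measure. running_cost \<theta> t \<omega>) + enn2real (intervention_cost \<theta> \<omega>))"
    using finite_AE intervention_cost_integrable(2)[OF \<theta>] AE_space
    by eventually_elim (intro path)
  then show "AE \<omega> in P x. integrable time_measure (\<lambda>t. running_cost \<theta> t \<omega>)" by eventually_elim simp
  have int: "integrable (P x) (\<lambda>\<omega>. real_of_ereal (f \<omega>) - enn2real (intervention_cost \<theta> \<omega>))"
    by (intro Bochner_Integration.integrable_diff ext_integral_finite_imp(2)[OF _ pos neg]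
        intervention_cost_integrable(3)[OF \<theta>]) simp
  show "integrable (P x) (\<lambda>\<omega>. LINT t|time_measure. running_cost \<theta> t \<omega>)"
  proof (rule integrable_cong_AE_imp[OF int])
    show "(\<lambda>\<omega>. LINT t|time_measure. running_cost \<theta> t \<omega>) \<in> borel_measurable (P x)"
      using measurable_running_cost_process[OF inc]
      by (intro time.borel_measurable_lebesgue_integral) (simp add: case_prod_beta)
    show "AE \<omega> in P x. real_of_ereal (f \<omega>) - enn2real (intervention_cost \<theta> \<omega>)
        = (LINT t|time_measure. running_cost \<theta> t \<omega>)"
      using AE by eventually_elim simp
  qed
qed

lemma objective_eq_integral:
  assumes \<theta>: "\<theta> \<in> controls (P x) F r"
    and path: "AE \<omega> in P x. integrable time_measure (\<lambda>t. running_cost \<theta> t \<omega>)"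
    and int: "integrable (P x) (\<lambda>\<omega>. LINT t|time_measure. running_cost \<theta> t \<omega>)"
  shows "objective (P x) X k c r \<theta> = ereal ((\<integral>\<omega>. (LINT t|time_measure. running_cost \<theta> t \<omega>) \<partial>P x)
    + (\<integral>\<omega>. enn2real (intervention_cost \<theta> \<omega>) \<partial>P x))"
proof -
  note K = intervention_cost_integrable[OF \<theta>]
  have "objective (P x) X k c r \<theta> = ext_integral (P x) (\<lambda>\<omega>.
      ereal ((LINT t|time_measure. running_cost \<theta> t \<omega>) + enn2real (intervention_cost \<theta> \<omega>)))"
    unfolding objective_def
  proof (rule ext_integral_cong_AE)
    show "AE \<omega> in P x. total_running_cost \<theta> \<omega> + enn2ereal (intervention_cost \<theta> \<omega>)
        = ereal ((LINT t|time_measure. running_cost \<theta> t \<omega>) + enn2real (intervention_cost \<theta> \<omega>))"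
      using path K(2)
    proof eventually_elim
      case (elim \<omega>)
      then have "enn2ereal (intervention_cost \<theta> \<omega>) = ereal (enn2real (intervention_cost \<theta> \<omega>))"
        by (cases "intervention_cost \<theta> \<omega>") auto
      then show ?case using ext_integral_integrable[OF elim(1)] by simp
    qed
  qed
  then show ?thesis using int K(3) by (simp only: ext_integral_integrable Bochner_Integration.integrable_add Bochner_Integration.integral_add)
qed

lemma integrable_discount: "integrable time_measure (\<lambda>t. exp (- r * t))"
  "integrable (P x \<Otimes>\<^sub>M time_measure) (\<lambda>z. exp (- r * snd z))"
proof -
  have [measurable]: "(\<lambda>t. t) \<in> time_measure \<rightarrow>\<^sub>M borel"
    by (intro measurable_restrict_space1) simp
  have "(\<integral>\<^sup>+ t. ennreal (r * exp (- r * t)) * indicator {t. 0 \<le> ennreal t} t \<partial>time_measure) = 1"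
    unfolding nn_integral_discount_from[OF r_pos] by simp
  then have one: "(\<integral>\<^sup>+ t. ennreal (r * exp (- r * t)) \<partial>time_measure) = 1" by simp
  then have "integrable time_measure (\<lambda>t. r * exp (- r * t))"
    using r_pos by (intro integrableI_nonneg) auto
  then have int: "integrable time_measure (\<lambda>t. (1 / r) * (r * exp (- r * t)))"
    by (rule integrable_mult_right)
  then show time: "integrable time_measure (\<lambda>t. exp (- r * t))" using r_pos by simp
  have "integrable (P x \<Otimes>\<^sub>M time_measure) (\<lambda>(\<omega>, t). exp (- r * t))"
  proof (rule law_time.Fubini_integrable)
    have "(\<lambda>z. exp (- r * snd z)) \<in> borel_measurable (P x \<Otimes>\<^sub>M time_measure)" by measurable
    then show "(\<lambda>(\<omega>, t). exp (- r * t)) \<in> borel_measurable (P x \<Otimes>\<^sub>M time_measure)"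
      by (simp add: case_prod_beta)
  qed (use time in auto)
  then show "integrable (P x \<Otimes>\<^sub>M time_measure) (\<lambda>z. exp (- r * snd z))"
    unfolding case_prod_beta .
qed

text \<open>The bounded gap makes the change of the running cost integrable, since the marginal cost is
  bounded, so the optimality of \<open>\<theta>\<close> can be expressed by subtracting real expectations. The tangent
  inequality then replaces the change of the running cost by a marginal cost.\<close>

lemma variational_inequality:
  assumes opt: "optimal_control (P x) F X k c r \<theta>" and \<eta>: "\<eta> \<in> controls (P x) F r"
    and below: "\<And>\<omega> t. \<omega> \<in> space (P x) \<Longrightarrow> 0 \<le> t \<Longrightarrow> \<eta> t \<omega> \<le> \<theta> t \<omega>"
    and gap: "\<And>\<omega> t. \<omega> \<in> space (P x) \<Longrightarrow> 0 \<le> t \<Longrightarrow> \<theta> t \<omega> - \<eta> t \<omega> \<le> B"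
  shows "(\<integral>(\<omega>, t). c\<theta> t (X t \<omega>) (\<eta> t \<omega>) * (\<theta> t \<omega> - \<eta> t \<omega>) * exp (- r * t) \<partial>(P x \<Otimes>\<^sub>M time_measure))
    \<le> (\<integral>\<omega>. enn2real (intervention_cost \<eta> \<omega>) - enn2real (intervention_cost \<theta> \<omega>) \<partial>P x)"
proof -
  let ?N = "P x \<Otimes>\<^sub>M time_measure"
  have \<theta>: "\<theta> \<in> controls (P x) F r" using opt by (simp add: optimal_control_def)
  note inc = controlsD(1)[OF \<theta>] controlsD(1)[OF \<eta>]
  note opt_int = optimal_control_integrable[OF opt]
  obtain L where "0 \<le> L" "\<forall>t\<ge>0. \<forall>\<theta>\<ge>0. \<forall>y. \<bar>c\<theta> t y \<theta>\<bar> \<le> L"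
    "\<forall>t\<ge>0. \<forall>a\<ge>0. \<forall>b\<ge>a. \<forall>y. \<bar>c t y a - c t y b\<bar> \<le> L * (b - a)"
    by (rule marginal_cost_bound)
  note L = this(1) this(2,3)[rule_format]
  have [measurable]: "(\<lambda>t. t) \<in> time_measure \<rightarrow>\<^sub>M borel"
    by (intro measurable_restrict_space1) simp
  define d where "d = (\<lambda>(\<omega>, t). running_cost \<eta> t \<omega> - running_cost \<theta> t \<omega>)"
  define m where "m = (\<lambda>(\<omega>, t). c\<theta> t (X t \<omega>) (\<eta> t \<omega>) * (\<theta> t \<omega> - \<eta> t \<omega>) * exp (- r * t))"
  have d_meas [measurable]: "d \<in> borel_measurable ?N"
    using borel_measurable_diff[OF measurable_running_cost_process[OF inc(2)] measurable_running_cost_process[OF inc(1)]]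
    unfolding d_def case_prod_beta .
  have m_meas [measurable]: "m \<in> borel_measurable ?N"
  proof -
    have [measurable]: "(\<lambda>z. c\<theta> (snd z) (X (snd z) (fst z)) (\<eta> (snd z) (fst z))) \<in> borel_measurable ?N"
    proof (rule measurable_marginal_cost)
      show "(\<lambda>z. X (snd z) (fst z)) \<in> borel_measurable ?N"
        by (intro measurable_process_time adapted_X cadlag_X)
      show "(\<lambda>z. \<eta> (snd z) (fst z)) \<in> borel_measurable ?N"
        by (intro measurable_process_time increasing_adapted increasing_cadlag inc)
    qed (auto simp: space_pair_measure space_restrict_space intro: increasing_nonneg[OF inc(2)])
    have [measurable]: "(\<lambda>z. \<theta> (snd z) (fst z)) \<in> borel_measurable ?N" "(\<lambda>z. \<eta> (snd z) (fst z)) \<in> borel_measurable ?N"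
      by (intro measurable_process_time increasing_adapted increasing_cadlag inc)+
    show ?thesis unfolding m_def case_prod_beta by measurable
  qed
  have bounds: "\<bar>d z\<bar> \<le> L * B * exp (- r * snd z) \<and> \<bar>m z\<bar> \<le> L * B * exp (- r * snd z) \<and> d z \<le> - m z"
    if "z \<in> space ?N" for z
  proof -
    obtain \<omega> t where z: "z = (\<omega>, t)" and \<omega>: "\<omega> \<in> space (P x)" and t: "0 \<le> t"
      using \<open>z \<in> space ?N\<close> by (cases z) (auto simp: space_pair_measure space_restrict_space)
    have nonneg: "0 \<le> \<eta> t \<omega>" using \<omega> t by (rule increasing_nonneg[OF inc(2)])
    have g: "0 \<le> \<theta> t \<omega> - \<eta> t \<omega>" "\<theta> t \<omega> - \<eta> t \<omega> \<le> B" using below[OF \<omega> t] gap[OF \<omega> t] by auto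
    have LB: "L * (\<theta> t \<omega> - \<eta> t \<omega>) \<le> L * B" using g L(1) by (intro mult_left_mono) auto
    have d: "d (\<omega>, t) = (c t (X t \<omega>) (\<eta> t \<omega>) - c t (X t \<omega>) (\<theta> t \<omega>)) * exp (- r * t)"
      by (simp add: d_def left_diff_distrib)
    have "\<bar>c t (X t \<omega>) (\<eta> t \<omega>) - c t (X t \<omega>) (\<theta> t \<omega>)\<bar> \<le> L * B"
      using L(3)[OF t nonneg below[OF \<omega> t], of "X t \<omega>"] LB by linarith
    then have "\<bar>d z\<bar> \<le> L * B * exp (- r * snd z)"
      unfolding z d by (simp add: abs_mult mult_right_mono)
    moreover have "\<bar>c\<theta> t (X t \<omega>) (\<eta> t \<omega>)\<bar> * (\<theta> t \<omega> - \<eta> t \<omega>) \<le> L * B"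
      using mult_right_mono[OF L(2)[OF t nonneg, of "X t \<omega>"] g(1)] LB by linarith
    then have "\<bar>m z\<bar> \<le> L * B * exp (- r * snd z)"
      unfolding m_def z using g(1) by (simp add: abs_mult mult_right_mono)
    moreover have "d z \<le> - m z"
      using mult_right_mono[OF running_cost_tangent[OF t nonneg below[OF \<omega> t], of "X t \<omega>"], of "exp (- r * t)"]
      unfolding z d m_def by simp
    ultimately show ?thesis by blast
  qed
  have dom: "integrable ?N (\<lambda>z. L * B * exp (- r * snd z))"
    by (intro integrable_mult_right integrable_discount)
  have d_int: "integrable ?N d"
    using dom by (rule Bochner_Integration.integrable_bound) (use bounds in \<open>auto intro!: AE_I2 intro: order_trans[OF _ abs_ge_self]\<close>)
  have m_int: "integrable ?N m"
    using dom by (rule Bochner_Integration.integrable_bound) (use bounds in \<open>auto intro!: AE_I2 intro: order_trans[OF _ abs_ge_self]\<close>)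
  have d_path: "integrable time_measure (\<lambda>t. d (\<omega>, t))" if \<omega>: "\<omega> \<in> space (P x)" for \<omega>
  proof (rule Bochner_Integration.integrable_bound)
    show "integrable time_measure (\<lambda>t. L * B * exp (- r * t))"
      by (intro integrable_mult_right integrable_discount)
    show "(\<lambda>t. d (\<omega>, t)) \<in> borel_measurable time_measure"
      using measurable_compose[OF measurable_Pair1'[OF \<omega>] d_meas] .
    show "AE t in time_measure. norm (d (\<omega>, t)) \<le> norm (L * B * exp (- r * t))"
      using bounds[of "(\<omega>, _)"] \<omega>
      by (intro AE_I2) (auto simp: space_pair_measure intro: order_trans[OF _ abs_ge_self])
  qed
  have split: "AE \<omega> in P x. integrable time_measure (\<lambda>t. running_cost \<eta> t \<omega>) \<and>
      (LINT t|time_measure. running_cost \<eta> t \<omega>) = (LINT t|time_measure. running_cost \<theta> t \<omega>) + (LINT t|time_measure. d (\<omega>, t))"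
    using opt_int(1) AE_space
  proof eventually_elim
    case (elim \<omega>)
    have eq: "running_cost \<eta> t \<omega> = running_cost \<theta> t \<omega> + d (\<omega>, t)" for t by (simp add: d_def)
    show ?case unfolding eq using elim d_path by simp
  qed
  have d_marg: "integrable (P x) (\<lambda>\<omega>. LINT t|time_measure. d (\<omega>, t))"
    using law_time.integrable_fst'[OF d_int] .
  have sum_int: "integrable (P x) (\<lambda>\<omega>. (LINT t|time_measure. running_cost \<theta> t \<omega>) + (LINT t|time_measure. d (\<omega>, t)))"
    using opt_int(2) d_marg by (rule Bochner_Integration.integrable_add)
  have \<eta>_meas: "(\<lambda>\<omega>. LINT t|time_measure. running_cost \<eta> t \<omega>) \<in> borel_measurable (P x)"
    using measurable_running_cost_process[OF inc(2)]
    by (intro time.borel_measurable_lebesgue_integral) (simp add: case_prod_beta)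
  have AE_eq: "AE \<omega> in P x. (LINT t|time_measure. running_cost \<eta> t \<omega>)
      = (LINT t|time_measure. running_cost \<theta> t \<omega>) + (LINT t|time_measure. d (\<omega>, t))"
    using split by eventually_elim blast
  have \<eta>_int: "integrable (P x) (\<lambda>\<omega>. LINT t|time_measure. running_cost \<eta> t \<omega>)"
    by (rule integrable_cong_AE_imp[OF sum_int \<eta>_meas AE_symmetric[OF AE_eq]])
  have \<eta>_path: "AE \<omega> in P x. integrable time_measure (\<lambda>t. running_cost \<eta> t \<omega>)"
    using split by eventually_elim blast
  have "objective (P x) X k c r \<theta> \<le> objective (P x) X k c r \<eta>"
    using opt \<eta> by (auto simp: optimal_control_def intro: INF_lower)
  then have "(\<integral>\<omega>. (LINT t|time_measure. running_cost \<theta> t \<omega>) \<partial>P x) + (\<integral>\<omega>. enn2real (intervention_cost \<theta> \<omega>) \<partial>P x)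
      \<le> (\<integral>\<omega>. (LINT t|time_measure. running_cost \<eta> t \<omega>) \<partial>P x) + (\<integral>\<omega>. enn2real (intervention_cost \<eta> \<omega>) \<partial>P x)"
    unfolding objective_eq_integral[OF \<theta> opt_int] objective_eq_integral[OF \<eta> \<eta>_path \<eta>_int] by simp
  moreover have "(\<integral>\<omega>. (LINT t|time_measure. running_cost \<eta> t \<omega>) \<partial>P x)
      = (\<integral>\<omega>. (LINT t|time_measure. running_cost \<theta> t \<omega>) \<partial>P x) + (\<integral>\<omega>. (LINT t|time_measure. d (\<omega>, t)) \<partial>P x)"
    using integral_cong_AE[OF \<eta>_meas borel_measurable_integrable[OF sum_int] AE_eq] opt_int(2) d_marg
    by simp
  moreover have "(\<integral>\<omega>. (LINT t|time_measure. d (\<omega>, t)) \<partial>P x) = (\<integral>z. d z \<partial>?N)"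
    by (rule law_time.integral_fst'[OF d_int])
  moreover have "(\<integral>z. d z \<partial>?N) \<le> (\<integral>z. - m z \<partial>?N)"
    using bounds by (intro integral_mono d_int Bochner_Integration.integrable_minus m_int) auto
  moreover have "(\<integral>\<omega>. enn2real (intervention_cost \<eta> \<omega>) - enn2real (intervention_cost \<theta> \<omega>) \<partial>P x)
      = (\<integral>\<omega>. enn2real (intervention_cost \<eta> \<omega>) \<partial>P x) - (\<integral>\<omega>. enn2real (intervention_cost \<theta> \<omega>) \<partial>P x)"
    by (intro Bochner_Integration.integral_diff intervention_cost_integrable(3) \<theta> \<eta>)
  ultimately show ?thesis unfolding m_def by simp
qed

end

section \<open>Delaying a band of levels\<close>

definition present_value :: "real \<Rightarrow> (real \<Rightarrow> 'a \<Rightarrow> real) \<Rightarrow> 'a \<Rightarrow> ennreal \<Rightarrow> real" where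
  "present_value r Y \<omega> T = (if T = \<infinity> then 0 else Y (enn2real T) \<omega> * exp (- r * enn2real T))"

lemma measurable_present_value:
  assumes Y: "(\<lambda>(t, \<omega>). Y (max 0 t) \<omega>) \<in> borel_measurable (borel \<Otimes>\<^sub>M M)"
    and T [measurable]: "T \<in> borel_measurable N" and g [measurable]: "g \<in> N \<rightarrow>\<^sub>M M"
  shows "(\<lambda>z. present_value r Y (g z) (T z)) \<in> borel_measurable N"
proof -
  have "(\<lambda>z. (enn2real (T z), g z)) \<in> N \<rightarrow>\<^sub>M borel \<Otimes>\<^sub>M M" by measurable
  from measurable_compose[OF this Y] have [measurable]: "(\<lambda>z. Y (enn2real (T z)) (g z)) \<in> borel_measurable N"
    by simp
  show ?thesis unfolding present_value_def by measurable
qed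

text \<open>Right-continuity in the level: the times \<open>T b\<close> approach \<open>T a\<close> from the right as \<open>b\<close> decreases
  to \<open>a\<close>, and \<open>Y\<close> is right-continuous in time. If \<open>T a\<close> is infinite, so are all later times and the
  value is constantly \<open>0\<close>.\<close>

lemma present_value_right_continuous:
  fixes T :: "real \<Rightarrow> ennreal"
  assumes right_cont: "\<And>t. 0 \<le> t \<Longrightarrow> continuous (at_right t) (\<lambda>t. Y t \<omega>)"
    and later: "\<And>b. a < b \<Longrightarrow> T a \<le> T b"
    and soon: "\<And>t. 0 \<le> t \<Longrightarrow> T a < ennreal t \<Longrightarrow> \<forall>\<^sub>F b in at_right a. T b \<le> ennreal t"
  shows "((\<lambda>b. present_value r Y \<omega> (T b)) \<longlongrightarrow> present_value r Y \<omega> (T a)) (at_right a)"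
proof (cases "T a")
  case (real s)
  let ?g = "\<lambda>t. Y t \<omega> * exp (- r * t)"
  have ev_later: "\<forall>\<^sub>F b in at_right a. T a \<le> T b"
    by (rule eventually_mono[OF eventually_at_right_less[of a]]) (rule later)
  have near: "\<forall>\<^sub>F b in at_right a. s \<le> enn2real (T b) \<and> enn2real (T b) \<le> t \<and> T b \<noteq> \<infinity>" if "s < t" for t
  proof -
    have "\<forall>\<^sub>F b in at_right a. T b \<le> ennreal t"
      using real that by (intro soon) (auto simp: ennreal_less_iff)
    then show ?thesis using ev_later
    proof eventually_elim
      case (elim b)
      then obtain v where "T b = ennreal v" "0 \<le> v" by (cases "T b") (auto simp: top_unique)
      then show ?case using elim real that by auto
    qed
  qed
  have lim: "((\<lambda>b. enn2real (T b)) \<longlongrightarrow> s) (at_right a)"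
  proof (rule order_tendstoI)
    show "\<forall>\<^sub>F b in at_right a. u < enn2real (T b)" if "u < s" for u
      by (rule eventually_mono[OF near[OF less_add_one]]) (use that in auto)
    show "\<forall>\<^sub>F b in at_right a. enn2real (T b) < u" if "s < u" for u
      using near[of "(s + u) / 2"] that by (auto elim!: eventually_mono)
  qed
  have "(?g \<longlongrightarrow> ?g s) (at_right s)"
    using right_cont[of s] real by (auto simp: continuous_within intro!: tendsto_intros)
  then have "continuous (at s within {s..}) ?g"
    by (simp add: continuous_within at_within_Ici_at_right)
  then have "((\<lambda>b. ?g (enn2real (T b))) \<longlongrightarrow> ?g s) (at_right a)"
  proof (rule continuous_within_tendsto_compose[OF _ _ lim])
    show "\<forall>\<^sub>F b in at_right a. enn2real (T b) \<in> {s..}"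
      by (rule eventually_mono[OF near[OF less_add_one]]) auto
  qed
  then have "((\<lambda>b. present_value r Y \<omega> (T b)) \<longlongrightarrow> ?g s) (at_right a)"
    by (rule Lim_transform_eventually) (rule eventually_mono[OF near[OF less_add_one]], auto simp: present_value_def)
  then show ?thesis using real by (simp add: present_value_def)
next
  case top
  have "\<forall>\<^sub>F b in at_right a. present_value r Y \<omega> (T b) = present_value r Y \<omega> (T a)"
    by (rule eventually_mono[OF eventually_at_right_less[of a]]) (use later top in \<open>force simp: top_unique\<close>)
  then show ?thesis by (rule tendsto_eventually)
qed

lemma tendsto_right_average:
  fixes h :: "real \<Rightarrow> real"
  assumes [measurable]: "h \<in> borel_measurable borel" and bound: "\<And>b. \<bar>h b\<bar> \<le> C"
    and lim: "(h \<longlongrightarrow> h a) (at_right a)"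
  shows "(\<lambda>n. real (Suc n) * (LINT b:{a<..a + 1 / Suc n}|lborel. h b)) \<longlonglongrightarrow> h a"
proof (rule LIMSEQ_I)
  fix e :: real assume "0 < e"
  then have "\<forall>\<^sub>F b in at_right a. dist (h b) (h a) < e / 2"
    using lim by (intro tendstoD) auto
  then obtain d where d: "a < d" "\<And>b. a < b \<Longrightarrow> b < d \<Longrightarrow> dist (h b) (h a) < e / 2"
    by (auto simp: eventually_at_right_field)
  obtain N where N: "1 / Suc N < d - a"
    using reals_Archimedean[of "d - a"] d(1) by (auto simp: inverse_eq_divide)
  have "norm (real (Suc n) * (LINT b:{a<..a + 1 / Suc n}|lborel. h b) - h a) < e" if "N \<le> n" for n
  proof -
    let ?I = "{a<..a + 1 / real (Suc n)}"
    have "1 / real (Suc n) \<le> 1 / Suc N" using that by (intro divide_left_mono) auto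
    then have I: "dist (h b) (h a) < e / 2" if "b \<in> ?I" for b using N that by (intro d) auto
    have int_const: "set_integrable lborel ?I (\<lambda>_. v)" for v :: real
      by (simp add: set_integrable_def)
    have int_h: "set_integrable lborel ?I h"
      unfolding set_integrable_def
    proof (rule Bochner_Integration.integrable_bound)
      show "integrable lborel (\<lambda>b. indicator ?I b *\<^sub>R C)" using int_const[of C] by (simp add: set_integrable_def)
      show "AE b in lborel. norm (indicator ?I b *\<^sub>R h b) \<le> norm (indicator ?I b *\<^sub>R C)"
        using bound by (auto split: split_indicator intro: order_trans[OF _ abs_ge_self])
    qed measurable
    have const: "(LINT b:?I|lborel. v) = v / Suc n" for v :: real
      by (simp add: set_lebesgue_integral_def)
    have "real (Suc n) * (LINT b:?I|lborel. h b) - h a = real (Suc n) * ((LINT b:?I|lborel. h b) - (LINT b:?I|lborel. h a))"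
      unfolding const by (simp add: right_diff_distrib del: of_nat_Suc)
    also have "\<dots> = real (Suc n) * (LINT b:?I|lborel. h b - h a)"
      using int_h int_const by simp
    finally have eq: "real (Suc n) * (LINT b:?I|lborel. h b) - h a = real (Suc n) * (LINT b:?I|lborel. h b - h a)" .
    have "norm (LINT b:?I|lborel. h b - h a) \<le> (LINT b:?I|lborel. norm (h b - h a))"
      using int_h int_const by (intro set_integral_norm_bound) auto
    also have "\<dots> \<le> (LINT b:?I|lborel. e / 2)"
      using I by (intro set_integral_mono set_integrable_norm set_integral_diff int_h int_const)
        (auto simp: dist_norm intro: less_imp_le)
    finally have "norm (LINT b:?I|lborel. h b - h a) \<le> e / 2 / Suc n" unfolding const .
    then have "real (Suc n) * norm (LINT b:?I|lborel. h b - h a) \<le> real (Suc n) * (e / 2 / Suc n)"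
      by (intro mult_left_mono) auto
    also have "\<dots> < e" using \<open>0 < e\<close> by (simp del: of_nat_Suc)
    finally show ?thesis unfolding eq norm_mult by simp
  qed
  then show "\<exists>N. \<forall>n\<ge>N. norm (real (Suc n) * (LINT b:{a<..a + 1 / Suc n}|lborel. h b) - h a) < e"
    by blast
qed

text \<open>The length of the part of \<open>(a, a + \<epsilon>]\<close> that lies below \<open>y\<close>.\<close>

definition band :: "real \<Rightarrow> real \<Rightarrow> real \<Rightarrow> real" where
  "band a \<epsilon> y = max 0 (min y (a + \<epsilon>) - a)"

text \<open>The increments of \<open>\<theta>\<close> between the levels \<open>a\<close> and \<open>a + \<epsilon>\<close> are withheld until \<open>\<sigma>\<close> and made up
  for by a jump at \<open>\<sigma>\<close>.\<close>

definition delayed :: "(real \<Rightarrow> 'a \<Rightarrow> real) \<Rightarrow> real \<Rightarrow> real \<Rightarrow> ('a \<Rightarrow> ennreal) \<Rightarrow> real \<Rightarrow> 'a \<Rightarrow> real" where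
  "delayed \<theta> a \<epsilon> \<sigma> t \<omega> = \<theta> t \<omega> - (if ennreal t < \<sigma> \<omega> then band a \<epsilon> (\<theta> t \<omega>) else 0)"

lemma band_bounds: "0 \<le> \<epsilon> \<Longrightarrow> 0 \<le> band a \<epsilon> y \<and> band a \<epsilon> y \<le> \<epsilon>"
  by (auto simp: band_def)

lemma cadlag_delayed:
  assumes "cadlag (\<lambda>t. \<theta> t \<omega>)"
  shows "cadlag (\<lambda>t. delayed \<theta> a \<epsilon> \<sigma> t \<omega>)"
proof -
  let ?h = "\<lambda>y. y - band a \<epsilon> y"
  have lim_h: "((\<lambda>t. ?h (\<theta> t \<omega>)) \<longlongrightarrow> ?h l) G" if "((\<lambda>t. \<theta> t \<omega>) \<longlongrightarrow> l) G" for l G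
    unfolding band_def using that by (intro tendsto_intros)
  show ?thesis
    unfolding cadlag_def
  proof (intro conjI allI impI)
    fix t :: real assume "0 \<le> t"
    then have lim: "((\<lambda>t. \<theta> t \<omega>) \<longlongrightarrow> \<theta> t \<omega>) (at_right t)"
      using assms by (simp add: cadlag_def continuous_within)
    show "continuous (at_right t) (\<lambda>t. delayed \<theta> a \<epsilon> \<sigma> t \<omega>)"
    proof (cases "ennreal t < \<sigma> \<omega>")
      case True
      have "\<forall>\<^sub>F s in at_right t. ennreal s < \<sigma> \<omega>"
      proof (cases "\<sigma> \<omega>")
        case (real u)
        then have "t < u" using True by (simp add: ennreal_less_iff \<open>0 \<le> t\<close>)
        then have "\<forall>\<^sub>F s in at_right t. s \<in> {t<..<u}" by (intro eventually_at_rightI[of t u]) auto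
        then show ?thesis
          by (rule eventually_mono) (use real \<open>0 \<le> t\<close> in \<open>auto simp: ennreal_less_iff\<close>)
      qed simp
      then have "((\<lambda>s. delayed \<theta> a \<epsilon> \<sigma> s \<omega>) \<longlongrightarrow> ?h (\<theta> t \<omega>)) (at_right t)"
        by (intro Lim_transform_eventually[OF lim_h[OF lim]])
          (auto elim!: eventually_mono simp: delayed_def)
      then show ?thesis using True by (simp add: continuous_within delayed_def)
    next
      case False
      have "\<forall>\<^sub>F s in at_right t. \<not> ennreal s < \<sigma> \<omega>"
        by (rule eventually_mono[OF eventually_at_right_less[of t]])
          (meson False ennreal_leI less_imp_le not_less order_trans)
      then have "((\<lambda>s. delayed \<theta> a \<epsilon> \<sigma> s \<omega>) \<longlongrightarrow> \<theta> t \<omega>) (at_right t)"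
        by (intro Lim_transform_eventually[OF lim])
          (auto elim!: eventually_mono simp: delayed_def)
      then show ?thesis using False by (simp add: continuous_within delayed_def)
    qed
  next
    fix t :: real assume "0 < t"
    then obtain l where l: "((\<lambda>t. \<theta> t \<omega>) \<longlongrightarrow> l) (at_left t)"
      using assms by (auto simp: cadlag_def)
    show "\<exists>l. ((\<lambda>t. delayed \<theta> a \<epsilon> \<sigma> t \<omega>) \<longlongrightarrow> l) (at_left t)"
    proof (cases "ennreal t \<le> \<sigma> \<omega>")
      case True
      have "\<forall>\<^sub>F s in at_left t. s \<in> {0<..<t}" using \<open>0 < t\<close> by (intro eventually_at_leftI[of 0 t]) auto
      then have "\<forall>\<^sub>F s in at_left t. ennreal s < \<sigma> \<omega>"
      proof eventually_elim
        case (elim s)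
        then have "ennreal s < ennreal t" by (simp add: ennreal_less_iff)
        then show ?case using True by simp
      qed
      then have "((\<lambda>s. delayed \<theta> a \<epsilon> \<sigma> s \<omega>) \<longlongrightarrow> ?h l) (at_left t)"
        by (intro Lim_transform_eventually[OF lim_h[OF l]])
          (auto elim!: eventually_mono simp: delayed_def)
      then show ?thesis by blast
    next
      case False
      then obtain u where u: "\<sigma> \<omega> = ennreal u" "0 \<le> u" "u < t"
        using \<open>0 < t\<close> by (cases "\<sigma> \<omega>") (auto simp: not_le ennreal_less_iff)
      then have "\<forall>\<^sub>F s in at_left t. s \<in> {u<..<t}" by (intro eventually_at_leftI[of u t]) auto
      then have "\<forall>\<^sub>F s in at_left t. \<not> ennreal s < \<sigma> \<omega>"
        using u by (auto elim!: eventually_mono simp: not_less intro!: ennreal_leI)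
      then have "((\<lambda>s. delayed \<theta> a \<epsilon> \<sigma> s \<omega>) \<longlongrightarrow> l) (at_left t)"
        by (intro Lim_transform_eventually[OF l])
          (auto elim!: eventually_mono simp: delayed_def)
      then show ?thesis by blast
    qed
  qed
qed

lemma emeasure_levels_outside_band:
  assumes "0 \<le> y" "0 \<le> a" "0 \<le> \<epsilon>"
  shows "emeasure lborel ({0<..y} - {a<..a + \<epsilon>}) = ennreal (y - band a \<epsilon> y)"
proof -
  have eq: "{0<..y} - {a<..a + \<epsilon>} = {0<..y} - {a<..min y (a + \<epsilon>)}" by auto
  have inner: "emeasure lborel {a<..min y (a + \<epsilon>)} = ennreal (band a \<epsilon> y)"
    by (cases "a \<le> min y (a + \<epsilon>)") (auto simp: band_def ennreal_neg)
  have "emeasure lborel ({0<..y} - {a<..min y (a + \<epsilon>)})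
      = emeasure lborel {0<..y} - emeasure lborel {a<..min y (a + \<epsilon>)}"
    using assms by (intro emeasure_Diff) (auto simp: inner)
  also note inner
  also have "emeasure lborel {0<..y} - ennreal (band a \<epsilon> y) = ennreal (y - band a \<epsilon> y)"
    using assms band_bounds[of \<epsilon> a y] by (simp add: ennreal_minus)
  finally show ?thesis unfolding eq .
qed

context singular_control_setting
begin

lemma filtration_law: "filtration (space (P x)) (ext_filtration (P x) F)"
  by (rule filtration_ext_filtration[OF subalgebra_law mono_F])

lemma ext_filtration_ennreal: "0 \<le> t \<Longrightarrow> ext_filtration (P x) F (ennreal t) = F t"
  by (simp add: ext_filtration_def)

lemma stopping_time_le:
  assumes "is_stopping_time (P x) F \<sigma>" "0 \<le> t"
  shows "{\<omega> \<in> space (P x). \<sigma> \<omega> \<le> ennreal t} \<in> sets (F t)"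
  using stopping_timeD[OF assms(1), of "ennreal t"] subalgebra_law[OF assms(2)] assms(2)
  by (simp add: ext_filtration_ennreal pred_def subalgebra_def)

lemma sets_ext_filtration: "sets (ext_filtration (P x) F t) \<subseteq> sets (P x)"
proof (cases "t = \<infinity>")
  case True
  have "(\<Union>s\<in>{0..}. sets (F s)) \<subseteq> sets (P x)"
    using subalgebra_law by (auto simp: subalgebra_def)
  then have "sigma_sets (space (P x)) (\<Union>s\<in>{0..}. sets (F s)) \<subseteq> sets (P x)"
    by (rule sets.sigma_sets_subset)
  moreover have "(\<Union>s\<in>{0..}. sets (F s)) \<subseteq> Pow (space (P x))"
    using \<open>(\<Union>s\<in>{0..}. sets (F s)) \<subseteq> sets (P x)\<close> sets.space_closed by blast
  ultimately show ?thesis using True by (simp add: ext_filtration_def)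
next
  case False
  then show ?thesis using subalgebra_law[of "enn2real t"] by (simp add: ext_filtration_def subalgebra_def)
qed

lemma measurable_stopping_time_law:
  assumes "is_stopping_time (P x) F \<sigma>"
  shows "\<sigma> \<in> borel_measurable (P x)"
  using assms sets_ext_filtration filtration.space_F[OF filtration_law]
  by (rule measurable_stopping_time)

lemma intervention_cost_levels:
  fixes T :: "real \<Rightarrow> ennreal"
  assumes "increasing_process (P x) F \<theta>" "\<omega> \<in> space (P x)" "T \<in> borel_measurable borel"
    and "\<And>t. 0 \<le> t \<Longrightarrow> emeasure lborel {b. 0 < b \<and> T b \<le> ennreal t} = ennreal (\<theta> t \<omega>)"
  shows "intervention_cost \<theta> \<omega> = (\<integral>\<^sup>+ b\<in>{0<..}. ennreal (present_value r k \<omega> (T b)) \<partial>lborel)"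
proof -
  have [measurable]: "(\<lambda>t. t) \<in> time_measure \<rightarrow>\<^sub>M borel"
    by (intro measurable_restrict_space1) simp
  have [measurable]: "(\<lambda>t. k t \<omega>) \<in> borel_measurable time_measure"
    using measurable_compose[OF measurable_Pair1'[OF assms(2)] measurable_process_time[OF adapted_k cadlag_cost]]
    by simp
  have "intervention_cost \<theta> \<omega> = (\<integral>\<^sup>+ b. ennreal (k (enn2real (T b)) \<omega> * exp (- r * enn2real (T b)))
      * indicator {b. 0 < b \<and> T b < \<infinity>} b \<partial>lborel)"
    using assms by (intro nn_integral_stieltjes_image) simp_all
  also have "\<dots> = (\<integral>\<^sup>+ b\<in>{0<..}. ennreal (present_value r k \<omega> (T b)) \<partial>lborel)"
    by (intro nn_integral_cong) (auto simp: present_value_def less_top split: split_indicator)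
  finally show ?thesis .
qed

lemma present_value_intervention_bounds:
  assumes "\<omega> \<in> space (P x)" "\<And>t. 0 \<le> t \<Longrightarrow> k t \<omega> \<le> R" "0 \<le> R"
  shows "0 \<le> present_value r k \<omega> T" "present_value r k \<omega> T \<le> R"
proof -
  have "0 \<le> k (enn2real T) \<omega>"
    using k_pos[of "enn2real T" \<omega>] assms(1) by (simp add: space_law less_imp_le)
  then show "0 \<le> present_value r k \<omega> T" by (simp add: present_value_def)
  have "k (enn2real T) \<omega> * exp (- r * enn2real T) \<le> R * 1"
    using assms r_pos by (intro mult_mono) auto
  then show "present_value r k \<omega> T \<le> R" using assms(3) by (simp add: present_value_def)
qed

context
  fixes \<theta> :: "real \<Rightarrow> 'a \<Rightarrow> real" and \<sigma> :: "'a \<Rightarrow> ennreal" and a :: real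
  assumes \<theta>: "\<theta> \<in> controls (P x) F r" and \<sigma>: "is_stopping_time (P x) F \<sigma>" and a: "0 \<le> a"
begin

lemma increasing_delayed:
  assumes "0 \<le> \<epsilon>"
  shows "increasing_process (P x) F (delayed \<theta> a \<epsilon> \<sigma>)"
  unfolding increasing_process_def
proof (intro conjI ballI)
  note inc = controlsD(1)[OF \<theta>]
  show "adapted F (delayed \<theta> a \<epsilon> \<sigma>)"
    unfolding adapted_def
  proof (intro allI impI)
    fix t :: real assume t: "0 \<le> t"
    have [measurable]: "\<theta> t \<in> borel_measurable (F t)"
      using increasing_adapted[OF inc] t by (simp add: adapted_def)
    have [measurable]: "Measurable.pred (F t) (\<lambda>\<omega>. ennreal t < \<sigma> \<omega>)"
      using stopping_timeD2[OF \<sigma>, of "ennreal t"] t by (simp add: ext_filtration_ennreal)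
    show "delayed \<theta> a \<epsilon> \<sigma> t \<in> borel_measurable (F t)"
      unfolding delayed_def[abs_def] band_def by measurable
  qed
  show "cadlag_process (P x) (delayed \<theta> a \<epsilon> \<sigma>)"
    using increasing_cadlag[OF inc] by (auto simp: cadlag_process_def intro: cadlag_delayed)
  fix \<omega> assume \<omega>: "\<omega> \<in> space (P x)"
  show "0 \<le> delayed \<theta> a \<epsilon> \<sigma> 0 \<omega>"
    using increasing_nonneg[OF inc \<omega>, of 0] a assms by (auto simp: delayed_def band_def)
  show "mono_on {0..} (\<lambda>t. delayed \<theta> a \<epsilon> \<sigma> t \<omega>)"
  proof (rule mono_onI)
    fix s t :: real assume st: "s \<in> {0..}" "t \<in> {0..}" "s \<le> t"
    then have le: "\<theta> s \<omega> \<le> \<theta> t \<omega>" by (intro increasing_mono[OF inc \<omega>]) auto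
    have "ennreal s < \<sigma> \<omega>" if "ennreal t < \<sigma> \<omega>"
      using ennreal_leI[OF st(3)] that by (rule le_less_trans)
    then show "delayed \<theta> a \<epsilon> \<sigma> s \<omega> \<le> delayed \<theta> a \<epsilon> \<sigma> t \<omega>"
      using le assms by (auto simp: delayed_def band_def)
  qed
qed

lemma delayed_bounds:
  assumes "0 \<le> \<epsilon>"
  shows "delayed \<theta> a \<epsilon> \<sigma> t \<omega> \<le> \<theta> t \<omega>" "\<theta> t \<omega> - delayed \<theta> a \<epsilon> \<sigma> t \<omega> \<le> \<epsilon>"
  using band_bounds[OF assms, of a "\<theta> t \<omega>"] assms by (auto simp: delayed_def)

lemma delayed_control: "0 \<le> \<epsilon> \<Longrightarrow> delayed \<theta> a \<epsilon> \<sigma> \<in> controls (P x) F r"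
  by (rule control_below[OF \<theta> increasing_delayed]) (auto intro: delayed_bounds)

text \<open>The levels inside the band are reached at \<open>\<sigma>\<close> if that is later than their level time under
  \<open>\<theta>\<close>, and all other levels at the same time as before. The map \<open>T\<close> need not be monotone in the
  level.\<close>

lemma emeasure_delayed_levels:
  assumes "0 \<le> \<epsilon>" "\<omega> \<in> space (P x)" "0 \<le> t"
  defines "T \<equiv> \<lambda>b. if b \<in> {a<..a + \<epsilon>} then max (level_time \<theta> b \<omega>) (\<sigma> \<omega>) else level_time \<theta> b \<omega>"
  shows "emeasure lborel {b. 0 < b \<and> T b \<le> ennreal t} = ennreal (delayed \<theta> a \<epsilon> \<sigma> t \<omega>)"
proof (cases "ennreal t < \<sigma> \<omega>")
  case True
  have "{b. 0 < b \<and> T b \<le> ennreal t} = {0<..\<theta> t \<omega>} - {a<..a + \<epsilon>}"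
    using True assms(2,3) level_time_le[OF controlsD(1)[OF \<theta>]] unfolding T_def by (auto simp: not_le[symmetric])
  then show ?thesis
    using True emeasure_levels_outside_band[OF increasing_nonneg[OF controlsD(1)[OF \<theta>] assms(2,3)] a assms(1)]
    by (simp add: delayed_def)
next
  case False
  then have "{b. 0 < b \<and> T b \<le> ennreal t} = {b. 0 < b \<and> level_time \<theta> b \<omega> \<le> ennreal t}"
    unfolding T_def by auto
  then show ?thesis
    using False emeasure_levels[OF controlsD(1)[OF \<theta>] assms(2,3)] by (simp add: delayed_def)
qed

text \<open>The levels outside the band contribute the same amount to both costs. This amount is finite by
  assumption and cancels.\<close>

lemma intervention_cost_delayed:
  assumes "0 \<le> \<epsilon>" and \<omega>: "\<omega> \<in> space (P x)" and R: "\<And>t. 0 \<le> t \<Longrightarrow> k t \<omega> \<le> R" "0 \<le> R"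
    and fin: "intervention_cost \<theta> \<omega> < \<infinity>"
  shows "enn2real (intervention_cost (delayed \<theta> a \<epsilon> \<sigma>) \<omega>) - enn2real (intervention_cost \<theta> \<omega>)
    = (LINT b:{a<..a + \<epsilon>}|lborel. present_value r k \<omega> (max (level_time \<theta> b \<omega>) (\<sigma> \<omega>))
        - present_value r k \<omega> (level_time \<theta> b \<omega>))"
proof -
  note inc = controlsD(1)[OF \<theta>]
  note [measurable] = measurable_level_time_level[OF inc \<omega>]
  let ?I = "{a<..a + \<epsilon>}"
  let ?D = "\<lambda>b. level_time \<theta> b \<omega>"
  let ?E = "\<lambda>b. max (?D b) (\<sigma> \<omega>)"
  let ?v = "\<lambda>T. present_value r k \<omega> T"
  let ?T = "\<lambda>b. if b \<in> ?I then ?E b else ?D b"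
  have v_meas: "(\<lambda>b. ?v (S b)) \<in> borel_measurable borel" if "S \<in> borel_measurable borel" for S :: "real \<Rightarrow> ennreal"
    using measurable_present_value[OF measurable_process[OF adapted_k cadlag_cost] that, of "\<lambda>_. \<omega>"] \<omega> by simp
  have [measurable]: "(\<lambda>b. ?v (?D b)) \<in> borel_measurable borel" "(\<lambda>b. ?v (?E b)) \<in> borel_measurable borel"
    "(\<lambda>b. ?v (?T b)) \<in> borel_measurable borel"
    by (intro v_meas; measurable)+
  have v_bounds: "0 \<le> ?v T \<and> ?v T \<le> R" for T
    using present_value_intervention_bounds[OF \<omega> R] by blast
  define rest where "rest = (\<integral>\<^sup>+ b\<in>{0<..} - ?I. ennreal (?v (?D b)) \<partial>lborel)"
  have split: "(\<integral>\<^sup>+ b\<in>{0<..}. ennreal (?v (S b)) \<partial>lborel)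
      = (\<integral>\<^sup>+ b\<in>{0<..} - ?I. ennreal (?v (S b)) \<partial>lborel) + (\<integral>\<^sup>+ b\<in>?I. ennreal (?v (S b)) \<partial>lborel)"
    if [measurable]: "(\<lambda>b. ?v (S b)) \<in> borel_measurable borel" for S :: "real \<Rightarrow> ennreal"
  proof -
    have "(\<integral>\<^sup>+ b\<in>{0<..} - ?I. ennreal (?v (S b)) \<partial>lborel) + (\<integral>\<^sup>+ b\<in>?I. ennreal (?v (S b)) \<partial>lborel)
        = (\<integral>\<^sup>+ b. ennreal (?v (S b)) * indicator ({0<..} - ?I) b + ennreal (?v (S b)) * indicator ?I b \<partial>lborel)"
      by (rule nn_integral_add[symmetric]) measurable
    also have "\<dots> = (\<integral>\<^sup>+ b\<in>{0<..}. ennreal (?v (S b)) \<partial>lborel)"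
      using a by (intro nn_integral_cong) (auto split: split_indicator)
    finally show ?thesis by simp
  qed
  have "intervention_cost \<theta> \<omega> = (\<integral>\<^sup>+ b\<in>{0<..}. ennreal (?v (?D b)) \<partial>lborel)"
    by (intro intervention_cost_levels inc \<omega> emeasure_levels[OF inc \<omega>]) measurable
  also have "\<dots> = rest + (\<integral>\<^sup>+ b\<in>?I. ennreal (?v (?D b)) \<partial>lborel)"
    unfolding rest_def by (rule split) measurable
  finally have cost: "intervention_cost \<theta> \<omega> = rest + (\<integral>\<^sup>+ b\<in>?I. ennreal (?v (?D b)) \<partial>lborel)" .
  have "intervention_cost (delayed \<theta> a \<epsilon> \<sigma>) \<omega> = (\<integral>\<^sup>+ b\<in>{0<..}. ennreal (?v (?T b)) \<partial>lborel)"
    by (intro intervention_cost_levels increasing_delayed assms(1) \<omega> emeasure_delayed_levels) measurable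
  also have "\<dots> = (\<integral>\<^sup>+ b\<in>{0<..} - ?I. ennreal (?v (?T b)) \<partial>lborel) + (\<integral>\<^sup>+ b\<in>?I. ennreal (?v (?T b)) \<partial>lborel)"
    by (rule split) measurable
  also have "(\<integral>\<^sup>+ b\<in>{0<..} - ?I. ennreal (?v (?T b)) \<partial>lborel) = rest"
    unfolding rest_def by (intro nn_integral_cong) (auto split: split_indicator)
  also have "(\<integral>\<^sup>+ b\<in>?I. ennreal (?v (?T b)) \<partial>lborel) = (\<integral>\<^sup>+ b\<in>?I. ennreal (?v (?E b)) \<partial>lborel)"
    by (intro nn_integral_cong) (auto split: split_indicator)
  finally have cost': "intervention_cost (delayed \<theta> a \<epsilon> \<sigma>) \<omega> = rest + (\<integral>\<^sup>+ b\<in>?I. ennreal (?v (?E b)) \<partial>lborel)" .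
  have real: "set_integrable lborel ?I (\<lambda>b. ?v (S b))
      \<and> (\<integral>\<^sup>+ b\<in>?I. ennreal (?v (S b)) \<partial>lborel) = ennreal (LINT b:?I|lborel. ?v (S b)) \<and> 0 \<le> (LINT b:?I|lborel. ?v (S b))"
    if [measurable]: "(\<lambda>b. ?v (S b)) \<in> borel_measurable borel" for S :: "real \<Rightarrow> ennreal"
  proof -
    have int: "integrable lborel (\<lambda>b. indicator ?I b *\<^sub>R ?v (S b))"
    proof (rule Bochner_Integration.integrable_bound)
      show "integrable lborel (\<lambda>b. indicator ?I b *\<^sub>R R)"
        using assms(1) by (intro integrable_scaleR_left integrable_real_indicator) auto
      show "AE b in lborel. norm (indicator ?I b *\<^sub>R ?v (S b)) \<le> norm (indicator ?I b *\<^sub>R R)"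
        using v_bounds by (auto split: split_indicator intro: order_trans[OF _ abs_ge_self])
    qed measurable
    have "(\<integral>\<^sup>+ b\<in>?I. ennreal (?v (S b)) \<partial>lborel) = (\<integral>\<^sup>+ b. ennreal (indicator ?I b *\<^sub>R ?v (S b)) \<partial>lborel)"
      by (intro nn_integral_cong) (auto split: split_indicator)
    also have "\<dots> = ennreal (LINT b:?I|lborel. ?v (S b))"
      unfolding set_lebesgue_integral_def using v_bounds
      by (intro nn_integral_eq_integral int) (auto split: split_indicator)
    finally show ?thesis
      using int v_bounds unfolding set_integrable_def set_lebesgue_integral_def
      by (auto intro!: integral_nonneg_AE split: split_indicator)
  qed
  have "rest < \<infinity>" using fin unfolding cost by (auto simp: less_top ennreal_add_eq_top)
  then obtain q where q: "rest = ennreal q" "0 \<le> q" by (cases rest) auto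
  have realD: "set_integrable lborel ?I (\<lambda>b. ?v (?D b))"
      "(\<integral>\<^sup>+ b\<in>?I. ennreal (?v (?D b)) \<partial>lborel) = ennreal (LINT b:?I|lborel. ?v (?D b))" "0 \<le> (LINT b:?I|lborel. ?v (?D b))"
    and realE: "set_integrable lborel ?I (\<lambda>b. ?v (?E b))"
      "(\<integral>\<^sup>+ b\<in>?I. ennreal (?v (?E b)) \<partial>lborel) = ennreal (LINT b:?I|lborel. ?v (?E b))" "0 \<le> (LINT b:?I|lborel. ?v (?E b))"
    using real[of ?D] real[of ?E] by auto
  show ?thesis
    unfolding cost cost' q realD(2) realE(2) set_integral_diff(2)[OF realE(1) realD(1)]
    using q(2) realD(3) realE(3) by (simp add: ennreal_plus[symmetric] del: ennreal_plus)
qed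

end

end

section \<open>Marginal running cost after a random time\<close>

lemma AE_time_neq: "AE t in time_measure. ennreal t \<noteq> T"
proof -
  have "AE t in lborel. t \<noteq> enn2real T" by (rule AE_lborel_singleton)
  then have "AE t in lborel. t \<in> {0..} \<longrightarrow> ennreal t \<noteq> T"
    by eventually_elim auto
  then show ?thesis by (subst AE_restrict_space_iff) auto
qed

context singular_control_setting
begin

definition marginal_after :: "(real \<Rightarrow> 'a \<Rightarrow> real) \<Rightarrow> ennreal \<Rightarrow> 'a \<Rightarrow> real" where
  "marginal_after \<theta> T \<omega> =
    (LINT t|time_measure. indicator {t. T < ennreal t} t * (c\<theta> t (X t \<omega>) (\<theta> t \<omega>) * exp (- r * t)))"

lemma measurable_marginal_process:
  assumes "increasing_process (P x) F \<eta>"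
  shows "(\<lambda>z. c\<theta> (snd z) (X (snd z) (fst z)) (\<eta> (snd z) (fst z))) \<in> borel_measurable (P x \<Otimes>\<^sub>M time_measure)"
proof (rule measurable_marginal_cost)
  show "snd \<in> borel_measurable (P x \<Otimes>\<^sub>M time_measure)"
    by (rule measurable_compose[OF measurable_snd measurable_time])
  show "(\<lambda>z. X (snd z) (fst z)) \<in> borel_measurable (P x \<Otimes>\<^sub>M time_measure)"
    by (intro measurable_process_time adapted_X cadlag_X)
  show "(\<lambda>z. \<eta> (snd z) (fst z)) \<in> borel_measurable (P x \<Otimes>\<^sub>M time_measure)"
    by (intro measurable_process_time increasing_adapted increasing_cadlag assms)
qed (auto simp: space_pair_measure space_restrict_space intro: increasing_nonneg[OF assms])

lemma integrable_intervention_bound: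
  assumes "R \<in> borel_measurable (P x)" "\<forall>\<omega>. 0 \<le> R \<omega>" "(\<integral>\<^sup>+ \<omega>. ennreal ((R \<omega>)\<^sup>2) \<partial>P x) < \<infinity>"
  shows "integrable (P x) R"
proof -
  note [measurable] = assms(1)
  have "integrable (P x) (\<lambda>\<omega>. (R \<omega>)\<^sup>2)"
    using assms(3) by (intro integrableI_nonneg) auto
  then have "integrable (P x) (\<lambda>\<omega>. 1 + (R \<omega>)\<^sup>2)" by simp
  then show ?thesis
  proof (rule Bochner_Integration.integrable_bound)
    have "\<bar>v\<bar> \<le> \<bar>1 + v\<^sup>2\<bar>" for v :: real
    proof -
      have "0 \<le> (\<bar>v\<bar> - 1)\<^sup>2" by simp
      then have "2 * \<bar>v\<bar> \<le> 1 + v\<^sup>2" by (simp add: power2_diff)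
      then show ?thesis using abs_ge_zero[of v] abs_ge_self[of "1 + v\<^sup>2"] by linarith
    qed
    then show "AE \<omega> in P x. norm (R \<omega>) \<le> norm (1 + (R \<omega>)\<^sup>2)" by simp
  qed fact
qed

lemma integral_discount_after:
  assumes "0 \<le> s"
  shows "integrable time_measure (\<lambda>t. indicator {t. ennreal s < ennreal t} t * exp (- r * t))"
    "(LINT t|time_measure. indicator {t. ennreal s < ennreal t} t * exp (- r * t)) = exp (- r * s) / r"
proof -
  let ?f = "\<lambda>t. indicator {t. ennreal s < ennreal t} t * exp (- r * t)"
  note [measurable] = measurable_time
  show int: "integrable time_measure ?f"
    using integrable_discount(1)
    by (rule Bochner_Integration.integrable_bound) (auto split: split_indicator)
  have "(\<integral>\<^sup>+ t. ennreal (r * ?f t) \<partial>time_measure)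
      = (\<integral>\<^sup>+ t. ennreal (r * exp (- r * t)) * indicator {t. ennreal s \<le> ennreal t} t \<partial>time_measure)"
  proof (rule nn_integral_cong_AE)
    show "AE t in time_measure. ennreal (r * ?f t) = ennreal (r * exp (- r * t)) * indicator {t. ennreal s \<le> ennreal t} t"
      using AE_time_neq[of "ennreal s"] by eventually_elim (auto split: split_indicator)
  qed
  also have "\<dots> = ennreal (exp (- r * s))"
    unfolding nn_integral_discount_from[OF r_pos] using assms by simp
  finally have "ennreal (LINT t|time_measure. r * ?f t) = ennreal (exp (- r * s))"
    using int r_pos by (subst nn_integral_eq_integral[symmetric]) auto
  then have "r * (LINT t|time_measure. ?f t) = exp (- r * s)"
    using r_pos by (subst (asm) ennreal_inj) (auto intro!: integral_nonneg_AE mult_nonneg_nonneg)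
  then show "(LINT t|time_measure. ?f t) = exp (- r * s) / r" using r_pos by (simp add: field_simps)
qed

context
  fixes \<theta> :: "real \<Rightarrow> 'a \<Rightarrow> real"
  assumes inc: "increasing_process (P x) F \<theta>"
begin

lemma marginal_path_measurable:
  assumes "\<omega> \<in> space (P x)"
  shows "(\<lambda>t. c\<theta> t (X t \<omega>) (\<theta> t \<omega>) * exp (- r * t)) \<in> borel_measurable time_measure"
proof -
  note [measurable] = measurable_time
  have [measurable]: "(\<lambda>t. c\<theta> t (X t \<omega>) (\<theta> t \<omega>)) \<in> borel_measurable time_measure"
    using measurable_compose[OF measurable_Pair1'[OF assms] measurable_marginal_process[OF inc]] by simp
  show ?thesis by measurable
qed

lemma marginal_path_integrable:
  assumes \<omega>: "\<omega> \<in> space (P x)"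
  shows "integrable time_measure (\<lambda>t. indicator {t. T < ennreal t} t * (c\<theta> t (X t \<omega>) (\<theta> t \<omega>) * exp (- r * t)))"
proof -
  obtain L where "0 \<le> L" "\<forall>t\<ge>0. \<forall>\<theta>\<ge>0. \<forall>y. \<bar>c\<theta> t y \<theta>\<bar> \<le> L"
    by (rule marginal_cost_bound)
  note L = this(1) this(2)[rule_format]
  note [measurable] = measurable_time marginal_path_measurable[OF \<omega>]
  have "integrable time_measure (\<lambda>t. L * exp (- r * t))"
    by (intro integrable_mult_right integrable_discount)
  then show ?thesis
  proof (rule Bochner_Integration.integrable_bound)
    show "AE t in time_measure. norm (indicator {t. T < ennreal t} t * (c\<theta> t (X t \<omega>) (\<theta> t \<omega>) * exp (- r * t)))
        \<le> norm (L * exp (- r * t))"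
      using L(1) L(2)[OF _ increasing_nonneg[OF inc \<omega>]]
      by (intro AE_I2) (auto simp: abs_mult space_restrict_space split: split_indicator)
  qed measurable
qed

lemma marginal_after_diff:
  assumes \<omega>: "\<omega> \<in> space (P x)" and "T \<le> U"
  shows "marginal_after \<theta> T \<omega> - marginal_after \<theta> U \<omega> = (LINT t|time_measure.
    indicator {t. T < ennreal t \<and> ennreal t < U} t * (c\<theta> t (X t \<omega>) (\<theta> t \<omega>) * exp (- r * t)))"
proof -
  note [measurable] = measurable_time marginal_path_measurable[OF \<omega>]
  let ?m = "\<lambda>t. c\<theta> t (X t \<omega>) (\<theta> t \<omega>) * exp (- r * t)"
  have "marginal_after \<theta> T \<omega> - marginal_after \<theta> U \<omega>
      = (LINT t|time_measure. indicator {t. T < ennreal t} t * ?m t - indicator {t. U < ennreal t} t * ?m t)"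
    unfolding marginal_after_def
    by (intro Bochner_Integration.integral_diff[symmetric] marginal_path_integrable \<omega>)
  also have "\<dots> = (LINT t|time_measure. indicator {t. T < ennreal t \<and> ennreal t < U} t * ?m t)"
  proof (rule integral_cong_AE)
    show "AE t in time_measure. indicator {t. T < ennreal t} t * ?m t - indicator {t. U < ennreal t} t * ?m t
        = indicator {t. T < ennreal t \<and> ennreal t < U} t * ?m t"
      by (rule eventually_mono[OF AE_time_neq[of U]])
        (use \<open>T \<le> U\<close> in \<open>auto split: split_indicator\<close>)
  qed measurable
  finally show ?thesis .
qed

lemma marginal_after_bound:
  obtains B where "0 \<le> B" "\<forall>\<omega>\<in>space (P x). \<forall>s\<ge>0. \<bar>marginal_after \<theta> (ennreal s) \<omega>\<bar> \<le> B * exp (- r * s)"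
proof -
  obtain L where "0 \<le> L" "\<forall>t\<ge>0. \<forall>\<theta>\<ge>0. \<forall>y. \<bar>c\<theta> t y \<theta>\<bar> \<le> L"
    by (rule marginal_cost_bound)
  note L = this(1) this(2)[rule_format]
  have "\<bar>marginal_after \<theta> (ennreal s) \<omega>\<bar> \<le> L / r * exp (- r * s)" if \<omega>: "\<omega> \<in> space (P x)" and s: "0 \<le> s" for \<omega> s
  proof -
    let ?m = "\<lambda>t. indicator {t. ennreal s < ennreal t} t * (c\<theta> t (X t \<omega>) (\<theta> t \<omega>) * exp (- r * t))"
    have "\<bar>marginal_after \<theta> (ennreal s) \<omega>\<bar> \<le> (LINT t|time_measure. \<bar>?m t\<bar>)"
      unfolding marginal_after_def by (rule integral_abs_bound)
    also have "\<dots> \<le> (LINT t|time_measure. L * (indicator {t. ennreal s < ennreal t} t * exp (- r * t)))"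
    proof (rule integral_mono)
      show "integrable time_measure (\<lambda>t. \<bar>?m t\<bar>)" by (intro integrable_abs marginal_path_integrable \<omega>)
      show "integrable time_measure (\<lambda>t. L * (indicator {t. ennreal s < ennreal t} t * exp (- r * t)))"
        by (intro integrable_mult_right integral_discount_after s)
      show "\<bar>?m t\<bar> \<le> L * (indicator {t. ennreal s < ennreal t} t * exp (- r * t))" if "t \<in> space time_measure" for t
        using L(1) L(2)[OF _ increasing_nonneg[OF inc \<omega>], of t] that
        by (auto simp: abs_mult space_restrict_space split: split_indicator)
    qed
    also have "\<dots> = L / r * exp (- r * s)" using integral_discount_after(2)[OF s] by simp
    finally show ?thesis .
  qed
  then show ?thesis using L(1) r_pos by (intro that[of "L / r"]) auto
qed

lemma measurable_marginal_after:
  assumes [measurable]: "T \<in> borel_measurable (P x)"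
  shows "(\<lambda>\<omega>. marginal_after \<theta> (T \<omega>) \<omega>) \<in> borel_measurable (P x)"
  unfolding marginal_after_def
proof (rule time.borel_measurable_lebesgue_integral)
  note [measurable] = measurable_time measurable_marginal_process[OF inc]
  have "(\<lambda>z. indicator {z. T (fst z) < ennreal (snd z)} z
      * (c\<theta> (snd z) (X (snd z) (fst z)) (\<theta> (snd z) (fst z)) * exp (- r * snd z)))
      \<in> borel_measurable (P x \<Otimes>\<^sub>M time_measure)"
    by measurable
  then show "(\<lambda>(\<omega>, t). indicator {t. T \<omega> < ennreal t} t * (c\<theta> t (X t \<omega>) (\<theta> t \<omega>) * exp (- r * t)))
      \<in> borel_measurable (P x \<Otimes>\<^sub>M time_measure)"
    by (simp add: case_prod_beta indicator_def)
qed

lemma marginal_after_top: "marginal_after \<theta> \<infinity> \<omega> = 0"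
  by (simp add: marginal_after_def)

lemma integrable_marginal_after:
  assumes "T \<in> borel_measurable (P x)"
  shows "integrable (P x) (\<lambda>\<omega>. marginal_after \<theta> (T \<omega>) \<omega>)"
proof -
  obtain B where B: "0 \<le> B" "\<forall>\<omega>\<in>space (P x). \<forall>s\<ge>0. \<bar>marginal_after \<theta> (ennreal s) \<omega>\<bar> \<le> B * exp (- r * s)"
    by (rule marginal_after_bound)
  show ?thesis
  proof (rule law.integrable_const_bound)
    show "AE \<omega> in P x. norm (marginal_after \<theta> (T \<omega>) \<omega>) \<le> B"
    proof (rule AE_I2)
      fix \<omega> assume \<omega>: "\<omega> \<in> space (P x)"
      show "norm (marginal_after \<theta> (T \<omega>) \<omega>) \<le> B"
      proof (cases "T \<omega>")
        case (real s)
        then have "\<bar>marginal_after \<theta> (T \<omega>) \<omega>\<bar> \<le> B * exp (- r * s)" using B(2) \<omega> by auto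
        also have "\<dots> \<le> B * 1" using B(1) real r_pos by (intro mult_left_mono) auto
        finally show ?thesis by simp
      next
        case top
        then show ?thesis using B(1) marginal_after_top by simp
      qed
    qed
  qed (rule measurable_marginal_after[OF assms])
qed

end

end

section \<open>First variation along a vanishing band\<close>

lemma tendsto_band_quotient:
  "(\<lambda>n. real (Suc n) * band a (1 / Suc n) y) \<longlonglongrightarrow> (if a < y then 1 else 0)"
proof (cases "a < y")
  case True
  obtain N where N: "1 / real (Suc N) < y - a"
    using reals_Archimedean[of "y - a"] True by (auto simp: inverse_eq_divide)
  have "real (Suc n) * band a (1 / Suc n) y = 1" if "N \<le> n" for n
  proof -
    have "1 / real (Suc n) \<le> 1 / Suc N" using that by (intro divide_left_mono) auto
    then have "band a (1 / Suc n) y = 1 / Suc n" using N by (simp add: band_def)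
    then show ?thesis by simp
  qed
  then have "\<forall>\<^sub>F n in sequentially. real (Suc n) * band a (1 / Suc n) y = 1"
    by (auto simp: eventually_sequentially)
  then show ?thesis using True by (simp add: tendsto_eventually)
next
  case False
  then have "band a (1 / Suc n) y = 0" for n by (auto simp: band_def)
  then show ?thesis using False by simp
qed

lemma abs_integral_right_average_le:
  fixes h :: "real \<Rightarrow> real"
  assumes [measurable]: "h \<in> borel_measurable borel" and bound: "\<And>b. \<bar>h b\<bar> \<le> C"
  shows "\<bar>real (Suc n) * (LINT b:{a<..a + 1 / Suc n}|lborel. h b)\<bar> \<le> C"
proof -
  let ?I = "{a<..a + 1 / real (Suc n)}"
  have int: "integrable lborel (\<lambda>b. indicator ?I b * C)" for C :: real
    by (intro integrable_mult_left integrable_real_indicator) auto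
  have int_h: "integrable lborel (\<lambda>b. indicator ?I b * h b)"
    using int[of C]
    by (rule Bochner_Integration.integrable_bound)
      (use bound in \<open>auto split: split_indicator intro: order_trans[OF _ abs_ge_self]\<close>)
  have "\<bar>LINT b:?I|lborel. h b\<bar> \<le> (LINT b|lborel. \<bar>indicator ?I b * h b\<bar>)"
    unfolding set_lebesgue_integral_def real_scaleR_def by (rule integral_abs_bound)
  also have "\<dots> \<le> (LINT b|lborel. indicator ?I b * C)"
    using bound by (intro integral_mono integrable_abs int_h int) (auto split: split_indicator)
  also have "\<dots> = C / Suc n" by simp
  finally have "real (Suc n) * \<bar>LINT b:?I|lborel. h b\<bar> \<le> real (Suc n) * (C / Suc n)"
    by (intro mult_left_mono) auto
  then show ?thesis by (simp add: abs_mult del: of_nat_Suc)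
qed

context singular_control_setting
begin

text \<open>The variational inequality for the control delayed on the band \<open>(a, a + 1 / Suc n]\<close>,
  multiplied by \<open>Suc n\<close>, in the limit of large \<open>n\<close>. On the left, the normalised gap between the
  controls tends to the indicator of \<open>a < \<theta> t\<close> before \<open>\<sigma>\<close>. On the right stands an average over the
  levels of the band, which tends to the value at the level \<open>a\<close> because, under the crossing
  condition, the level times are right-continuous at \<open>a\<close>.\<close>

lemma first_variation:
  assumes opt: "optimal_control (P x) F X k c r \<theta>" and \<sigma>: "is_stopping_time (P x) F \<sigma>"
    and a: "0 \<le> a" and later: "\<And>\<omega>. \<omega> \<in> space (P x) \<Longrightarrow> level_time \<theta> a \<omega> \<le> \<sigma> \<omega>"
    and crossing: "AE \<omega> in P x. \<forall>t\<ge>0. level_time \<theta> a \<omega> < ennreal t \<longrightarrow> a < \<theta> t \<omega>"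
  shows "(\<integral>\<omega>. marginal_after \<theta> (level_time \<theta> a \<omega>) \<omega> - marginal_after \<theta> (\<sigma> \<omega>) \<omega> \<partial>P x)
    \<le> (\<integral>\<omega>. present_value r k \<omega> (\<sigma> \<omega>) - present_value r k \<omega> (level_time \<theta> a \<omega>) \<partial>P x)"
proof -
  let ?N = "P x \<Otimes>\<^sub>M time_measure"
  let ?\<tau> = "\<lambda>\<omega>. level_time \<theta> a \<omega>"
  have \<theta>: "\<theta> \<in> controls (P x) F r" using opt by (simp add: optimal_control_def)
  note inc = controlsD(1)[OF \<theta>]
  obtain L where "0 \<le> L" "\<forall>t\<ge>0. \<forall>\<theta>\<ge>0. \<forall>y. \<bar>c\<theta> t y \<theta>\<bar> \<le> L"
    by (rule marginal_cost_bound)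
  note L = this(1) this(2)[rule_format]
  obtain R where R: "R \<in> borel_measurable (P x)" "\<forall>\<omega>. 0 \<le> R \<omega>"
    "AE \<omega> in P x. \<forall>t\<ge>0. k t \<omega> \<le> R \<omega>" "(\<integral>\<^sup>+ \<omega>. ennreal ((R \<omega>)\<^sup>2) \<partial>P x) < \<infinity>"
    by (rule intervention_cost_dominated)
  note [measurable] = R(1) measurable_stopping_time_law[OF \<sigma>] measurable_level_time_state[OF inc]
    measurable_process_time[OF increasing_adapted[OF inc] increasing_cadlag[OF inc]]
  define \<epsilon> :: "nat \<Rightarrow> real" where "\<epsilon> n = 1 / Suc n" for n
  have \<epsilon>: "0 \<le> \<epsilon> n" for n by (simp add: \<epsilon>_def)
  have \<epsilon>_lim: "\<epsilon> \<longlonglongrightarrow> 0" unfolding \<epsilon>_def[abs_def] by (rule LIMSEQ_Suc[OF lim_1_over_n])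
  define \<eta> where "\<eta> n = delayed \<theta> a (\<epsilon> n) \<sigma>" for n
  have \<eta>: "\<eta> n \<in> controls (P x) F r" for n
    unfolding \<eta>_def by (intro delayed_control[OF \<theta> \<sigma> a] \<epsilon>)
  have gap: "\<eta> n t \<omega> \<le> \<theta> t \<omega>" "\<theta> t \<omega> - \<eta> n t \<omega> \<le> \<epsilon> n" for n t \<omega>
    unfolding \<eta>_def using delayed_bounds[OF \<theta> \<sigma> a \<epsilon>] by auto

  define f where "f n = (\<lambda>(\<omega>, t). c\<theta> t (X t \<omega>) (\<eta> n t \<omega>) * (\<theta> t \<omega> - \<eta> n t \<omega>) * exp (- r * t))" for n
  define g where "g = (\<lambda>(\<omega>, t). (if ennreal t < \<sigma> \<omega> \<and> a < \<theta> t \<omega> then 1 else 0) * (c\<theta> t (X t \<omega>) (\<theta> t \<omega>) * exp (- r * t)))"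
  have f_meas: "f n \<in> borel_measurable ?N" for n
  proof -
    note [measurable] = measurable_time measurable_marginal_process[OF controlsD(1)[OF \<eta>[of n]]]
      measurable_process_time[OF increasing_adapted[OF controlsD(1)[OF \<eta>[of n]]] increasing_cadlag[OF controlsD(1)[OF \<eta>[of n]]]]
    show ?thesis unfolding f_def case_prod_beta by measurable
  qed
  have g_meas: "g \<in> borel_measurable ?N"
  proof -
    note [measurable] = measurable_time measurable_marginal_process[OF inc]
    show ?thesis unfolding g_def case_prod_beta by measurable
  qed
  have dom: "integrable ?N (\<lambda>z. L * exp (- r * snd z))"
    by (intro integrable_mult_right integrable_discount)
  have f_bound: "norm (Suc n * f n z) \<le> L * exp (- r * snd z)" if "z \<in> space ?N" for n z
  proof -
    obtain \<omega> t where z: "z = (\<omega>, t)" and \<omega>: "\<omega> \<in> space (P x)" and t: "0 \<le> t"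
      using \<open>z \<in> space ?N\<close> by (cases z) (auto simp: space_pair_measure space_restrict_space)
    have "Suc n * (\<theta> t \<omega> - \<eta> n t \<omega>) \<le> Suc n * \<epsilon> n" using gap(2)[of t \<omega> n] by (intro mult_left_mono) auto
    then have "Suc n * (\<theta> t \<omega> - \<eta> n t \<omega>) \<le> 1" by (simp add: \<epsilon>_def)
    then have "\<bar>c\<theta> t (X t \<omega>) (\<eta> n t \<omega>)\<bar> * (Suc n * (\<theta> t \<omega> - \<eta> n t \<omega>)) \<le> L * 1"
      using L(1) L(2)[OF t increasing_nonneg[OF controlsD(1)[OF \<eta>] \<omega> t]] gap(1)
      by (intro mult_mono) auto
    then have "\<bar>c\<theta> t (X t \<omega>) (\<eta> n t \<omega>)\<bar> * (Suc n * (\<theta> t \<omega> - \<eta> n t \<omega>)) * exp (- r * t) \<le> L * exp (- r * t)"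
      by (intro mult_right_mono) auto
    moreover have "norm (Suc n * f n z) = \<bar>c\<theta> t (X t \<omega>) (\<eta> n t \<omega>)\<bar> * (Suc n * (\<theta> t \<omega> - \<eta> n t \<omega>)) * exp (- r * t)"
      unfolding f_def z using gap(1)[of n t \<omega>] by (simp add: abs_mult del: of_nat_Suc)
    ultimately show ?thesis by (simp add: z)
  qed
  have f_lim: "(\<lambda>n. Suc n * f n z) \<longlonglongrightarrow> g z" if "z \<in> space ?N" for z
  proof -
    obtain \<omega> t where z: "z = (\<omega>, t)" and \<omega>: "\<omega> \<in> space (P x)" and t: "0 \<le> t"
      using \<open>z \<in> space ?N\<close> by (cases z) (auto simp: space_pair_measure space_restrict_space)
    have "(\<lambda>n. \<eta> n t \<omega>) \<longlonglongrightarrow> \<theta> t \<omega>"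
    proof (rule tendsto_sandwich)
      show "(\<lambda>n. \<theta> t \<omega> - \<epsilon> n) \<longlonglongrightarrow> \<theta> t \<omega>" using tendsto_diff[OF tendsto_const \<epsilon>_lim] by simp
      show "\<forall>\<^sub>F n in sequentially. \<theta> t \<omega> - \<epsilon> n \<le> \<eta> n t \<omega>"
        using gap(2)[of t \<omega>] by (intro always_eventually) (auto simp: algebra_simps)
    qed (use gap in auto)
    then have c_lim: "(\<lambda>n. c\<theta> t (X t \<omega>) (\<eta> n t \<omega>)) \<longlonglongrightarrow> c\<theta> t (X t \<omega>) (\<theta> t \<omega>)"
      using t increasing_nonneg[OF inc \<omega> t] increasing_nonneg[OF controlsD(1)[OF \<eta>] \<omega> t]
      by (intro continuous_on_tendsto_compose[OF cont_c\<theta>]) auto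
    have d_lim: "(\<lambda>n. real (Suc n) * (\<theta> t \<omega> - \<eta> n t \<omega>)) \<longlonglongrightarrow> (if ennreal t < \<sigma> \<omega> \<and> a < \<theta> t \<omega> then 1 else 0)"
    proof (cases "ennreal t < \<sigma> \<omega>")
      case True
      then have "\<theta> t \<omega> - \<eta> n t \<omega> = band a (1 / Suc n) (\<theta> t \<omega>)" for n
        by (simp add: \<eta>_def delayed_def \<epsilon>_def)
      then show ?thesis using tendsto_band_quotient[of a "\<theta> t \<omega>"] True by simp
    qed (simp add: \<eta>_def delayed_def)
    have "(\<lambda>n. real (Suc n) * (\<theta> t \<omega> - \<eta> n t \<omega>) * (c\<theta> t (X t \<omega>) (\<eta> n t \<omega>) * exp (- r * t))) \<longlonglongrightarrow> g z"
      unfolding g_def z prod.case by (intro tendsto_mult d_lim c_lim tendsto_const)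
    then show ?thesis by (simp add: f_def z mult_ac)
  qed
  have f_scaled: "(\<lambda>z. Suc n * f n z) \<in> borel_measurable ?N" for n
    by (rule borel_measurable_times[OF borel_measurable_const f_meas])
  have f_lim_AE: "AE z in ?N. (\<lambda>n. Suc n * f n z) \<longlonglongrightarrow> g z"
    by (rule AE_I2) (rule f_lim)
  have f_bound_AE: "AE z in ?N. norm (Suc n * f n z) \<le> L * exp (- r * snd z)" for n
    by (rule AE_I2) (rule f_bound)
  note dct = integrable_dominated_convergence[OF g_meas f_scaled dom f_lim_AE f_bound_AE]
    integral_dominated_convergence[OF g_meas f_scaled dom f_lim_AE f_bound_AE]
  have running: "(\<integral>z. g z \<partial>?N) = (\<integral>\<omega>. marginal_after \<theta> (?\<tau> \<omega>) \<omega> - marginal_after \<theta> (\<sigma> \<omega>) \<omega> \<partial>P x)"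
  proof -
    have "(\<integral>z. g z \<partial>?N) = (\<integral>\<omega>. (LINT t|time_measure. g (\<omega>, t)) \<partial>P x)"
      by (rule law_time.integral_fst'[OF dct(1), symmetric])
    also have "\<dots> = (\<integral>\<omega>. marginal_after \<theta> (?\<tau> \<omega>) \<omega> - marginal_after \<theta> (\<sigma> \<omega>) \<omega> \<partial>P x)"
    proof (rule integral_cong_AE)
      show "(\<lambda>\<omega>. LINT t|time_measure. g (\<omega>, t)) \<in> borel_measurable (P x)"
        by (rule borel_measurable_integrable[OF law_time.integrable_fst'[OF dct(1)]])
      show "(\<lambda>\<omega>. marginal_after \<theta> (?\<tau> \<omega>) \<omega> - marginal_after \<theta> (\<sigma> \<omega>) \<omega>) \<in> borel_measurable (P x)"
        by (intro borel_measurable_diff measurable_marginal_after[OF inc]) measurable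
      show "AE \<omega> in P x. (LINT t|time_measure. g (\<omega>, t)) = marginal_after \<theta> (?\<tau> \<omega>) \<omega> - marginal_after \<theta> (\<sigma> \<omega>) \<omega>"
        using crossing AE_space
      proof eventually_elim
        case (elim \<omega>)
        note [measurable] = measurable_time marginal_path_measurable[OF inc elim(2)]
        have "(LINT t|time_measure. g (\<omega>, t)) = (LINT t|time_measure.
            indicator {t. ?\<tau> \<omega> < ennreal t \<and> ennreal t < \<sigma> \<omega>} t * (c\<theta> t (X t \<omega>) (\<theta> t \<omega>) * exp (- r * t)))"
        proof (rule integral_cong_AE)
          show "(\<lambda>t. g (\<omega>, t)) \<in> borel_measurable time_measure"
            using measurable_compose[OF measurable_Pair1'[OF elim(2)] g_meas] .
          \<comment> \<open>The crossing condition makes \<open>{t. a < \<theta> t}\<close> and \<open>{t. \<tau> < t}\<close> agree off the single time \<open>\<tau>\<close>.\<close>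
          show "AE t in time_measure. g (\<omega>, t)
              = indicator {t. ?\<tau> \<omega> < ennreal t \<and> ennreal t < \<sigma> \<omega>} t * (c\<theta> t (X t \<omega>) (\<theta> t \<omega>) * exp (- r * t))"
            using AE_time_neq[of "?\<tau> \<omega>"] AE_space
          proof eventually_elim
            case (elim t)
            then have t: "0 \<le> t" by (simp add: space_restrict_space)
            have "a < \<theta> t \<omega> \<longleftrightarrow> ?\<tau> \<omega> < ennreal t"
            proof
              assume "a < \<theta> t \<omega>"
              then have "?\<tau> \<omega> \<le> ennreal t" using level_time_le[OF inc \<open>\<omega> \<in> space (P x)\<close> t] by simp
              then show "?\<tau> \<omega> < ennreal t" using elim(1) by (simp add: less_le eq_commute)
            qed (use \<open>\<forall>t\<ge>0. ?\<tau> \<omega> < ennreal t \<longrightarrow> a < \<theta> t \<omega>\<close> t in blast)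
            then show ?case by (auto simp: g_def split: split_indicator)
          qed
        qed measurable
        then show ?case using marginal_after_diff[OF inc elim(2) later[OF elim(2)]] by simp
      qed
    qed
    finally show ?thesis .
  qed

  define h where "h \<omega> b = present_value r k \<omega> (max (level_time \<theta> b \<omega>) (\<sigma> \<omega>)) - present_value r k \<omega> (level_time \<theta> b \<omega>)" for \<omega> b
  define I where "I n = {a<..a + 1 / real (Suc n)}" for n
  have h_joint: "(\<lambda>z. h (fst z) (snd z)) \<in> borel_measurable (P x \<Otimes>\<^sub>M lborel)"
  proof -
    have [measurable]: "(\<lambda>z. level_time \<theta> (snd z) (fst z)) \<in> borel_measurable (P x \<Otimes>\<^sub>M lborel)"
      using measurable_compose[OF _ measurable_level_time[OF inc], of "\<lambda>z. (snd z, fst z)" "P x \<Otimes>\<^sub>M lborel"]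
      by simp
    show ?thesis
      unfolding h_def
      by (intro borel_measurable_diff measurable_present_value[OF measurable_process[OF adapted_k cadlag_cost]]) measurable
  qed
  have h_meas: "h \<omega> \<in> borel_measurable borel" if "\<omega> \<in> space (P x)" for \<omega>
    using measurable_compose[OF measurable_Pair1'[OF that] h_joint] by simp
  have h_bound: "\<bar>h \<omega> b\<bar> \<le> R \<omega>" if "\<omega> \<in> space (P x)" "\<forall>t\<ge>0. k t \<omega> \<le> R \<omega>" for \<omega> b
  proof -
    have "0 \<le> present_value r k \<omega> T \<and> present_value r k \<omega> T \<le> R \<omega>" for T
      using present_value_intervention_bounds[OF that(1), of "R \<omega>"] that(2) R(2) by blast
    from this[of "level_time \<theta> b \<omega>"] this[of "max (level_time \<theta> b \<omega>) (\<sigma> \<omega>)"]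
    show ?thesis unfolding h_def by linarith
  qed
  have avg_meas: "(\<lambda>\<omega>. real (Suc n) * (LINT b:I n|lborel. h \<omega> b)) \<in> borel_measurable (P x)" for n
  proof -
    have "(\<lambda>z. indicator (I n) (snd z) *\<^sub>R h (fst z) (snd z)) \<in> borel_measurable (P x \<Otimes>\<^sub>M lborel)"
      using h_joint unfolding I_def by measurable
    then have "(\<lambda>\<omega>. LINT b|lborel. indicator (I n) b *\<^sub>R h \<omega> b) \<in> borel_measurable (P x)"
      by (intro lborel.borel_measurable_lebesgue_integral) (simp add: case_prod_beta)
    then show ?thesis unfolding set_lebesgue_integral_def by measurable
  qed
  have avg_bound: "AE \<omega> in P x. norm (real (Suc n) * (LINT b:I n|lborel. h \<omega> b)) \<le> R \<omega>" for n
    using R(3) AE_space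
  proof eventually_elim
    case (elim \<omega>)
    show ?case
      unfolding I_def real_norm_def
      by (rule abs_integral_right_average_le[OF h_meas[OF elim(2)] h_bound[OF elim(2,1)]])
  qed
  have avg_lim: "AE \<omega> in P x. (\<lambda>n. real (Suc n) * (LINT b:I n|lborel. h \<omega> b)) \<longlonglongrightarrow> h \<omega> a"
    using R(3) crossing AE_space
  proof eventually_elim
    case (elim \<omega>)
    have right_cont: "continuous (at_right t) (\<lambda>t. k t \<omega>)" if "0 \<le> t" for t
      using that by (intro cadlag_right_continuous[OF cadlag_cost elim(3)])
    have level_soon: "\<forall>\<^sub>F b in at_right a. level_time \<theta> b \<omega> \<le> ennreal t"
      if "0 \<le> t" "level_time \<theta> a \<omega> < ennreal t" for t
    proof (rule eventually_at_rightI)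
      show "a < \<theta> t \<omega>" using elim(2) that by blast
      show "level_time \<theta> b \<omega> \<le> ennreal t" if "b \<in> {a<..<\<theta> t \<omega>}" for b
        using that level_time_le[OF inc elim(3) \<open>0 \<le> t\<close>] by simp
    qed
    have "(h \<omega> \<longlongrightarrow> h \<omega> a) (at_right a)"
      unfolding h_def[abs_def]
    proof (intro tendsto_diff present_value_right_continuous right_cont)
      show "\<forall>\<^sub>F b in at_right a. max (level_time \<theta> b \<omega>) (\<sigma> \<omega>) \<le> ennreal t"
        if "0 \<le> t" "max (level_time \<theta> a \<omega>) (\<sigma> \<omega>) < ennreal t" for t
        using level_soon[of t] that by (auto elim!: eventually_mono)
    qed (auto intro: level_soon level_time_mono order_trans[OF level_time_mono max.cobounded1])
    then show ?case
      unfolding I_def by (rule tendsto_right_average[OF h_meas[OF elim(3)] h_bound[OF elim(3,1)]])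
  qed
  have h_level: "(\<lambda>\<omega>. h \<omega> a) \<in> borel_measurable (P x)"
    unfolding h_def
    by (intro borel_measurable_diff measurable_present_value[OF measurable_process[OF adapted_k cadlag_cost]]) measurable
  have avg_conv: "(\<lambda>n. \<integral>\<omega>. real (Suc n) * (LINT b:I n|lborel. h \<omega> b) \<partial>P x) \<longlonglongrightarrow> (\<integral>\<omega>. h \<omega> a \<partial>P x)"
    by (rule integral_dominated_convergence[OF h_level avg_meas integrable_intervention_bound[OF R(1,2,4)] avg_lim avg_bound])
  have intervention: "(\<integral>\<omega>. h \<omega> a \<partial>P x) = (\<integral>\<omega>. present_value r k \<omega> (\<sigma> \<omega>) - present_value r k \<omega> (?\<tau> \<omega>) \<partial>P x)"
    using later by (intro Bochner_Integration.integral_cong) (auto simp: h_def max_absorb2)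

  have step: "(\<integral>z. Suc n * f n z \<partial>?N) \<le> (\<integral>\<omega>. real (Suc n) * (LINT b:I n|lborel. h \<omega> b) \<partial>P x)" for n
  proof -
    have "(\<integral>z. f n z \<partial>?N) \<le> (\<integral>\<omega>. enn2real (intervention_cost (\<eta> n) \<omega>) - enn2real (intervention_cost \<theta> \<omega>) \<partial>P x)"
      unfolding f_def by (rule variational_inequality[OF opt \<eta> gap])
    also have "\<dots> = (\<integral>\<omega>. (LINT b:I n|lborel. h \<omega> b) \<partial>P x)"
    proof (rule integral_cong_AE)
      show "(\<lambda>\<omega>. enn2real (intervention_cost (\<eta> n) \<omega>) - enn2real (intervention_cost \<theta> \<omega>)) \<in> borel_measurable (P x)"
        by (intro borel_measurable_diff borel_measurable_integrable intervention_cost_integrable(3) \<theta> \<eta>)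
      show "(\<lambda>\<omega>. LINT b:I n|lborel. h \<omega> b) \<in> borel_measurable (P x)"
        using borel_measurable_divide[OF avg_meas[of n] borel_measurable_const[of "real (Suc n)"]]
        by (simp del: of_nat_Suc)
      show "AE \<omega> in P x. enn2real (intervention_cost (\<eta> n) \<omega>) - enn2real (intervention_cost \<theta> \<omega>) = (LINT b:I n|lborel. h \<omega> b)"
        using R(3) intervention_cost_integrable(2)[OF \<theta>] AE_space
      proof eventually_elim
        case (elim \<omega>)
        show ?case
          unfolding \<eta>_def I_def h_def \<epsilon>_def
          using elim R(2) by (intro intervention_cost_delayed[OF \<theta> \<sigma> a, where R="R \<omega>"]) auto
      qed
    qed
    finally have "Suc n * (\<integral>z. f n z \<partial>?N) \<le> Suc n * (\<integral>\<omega>. (LINT b:I n|lborel. h \<omega> b) \<partial>P x)"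
      by (intro mult_left_mono) auto
    then show ?thesis by (simp del: of_nat_Suc)
  qed
  have "(\<integral>z. g z \<partial>?N) \<le> (\<integral>\<omega>. h \<omega> a \<partial>P x)"
    by (rule LIMSEQ_le[OF dct(2) avg_conv]) (use step in blast)
  then show ?thesis unfolding running intervention .
qed

end

section \<open>The adjoint process at stopping times\<close>

context singular_control_setting
begin

lemma conditional_expectation_law: "subalgebra (P x) G \<Longrightarrow> sigma_finite_subalgebra (P x) G"
  by (intro finite_measure_subalgebra_is_sigma_finite finite_measure_subalgebra.intro
      law.finite_measure_axioms finite_measure_subalgebra_axioms.intro)

context
  fixes \<theta> p :: "real \<Rightarrow> 'a \<Rightarrow> real"
  assumes inc: "increasing_process (P x) F \<theta>" and adj: "is_adjoint (P x) F X c\<theta> r \<theta> p"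
begin

lemma adjoint_adapted: "adapted F p" and adjoint_cadlag: "cadlag_process (P x) p"
  using adj by (auto simp: is_adjoint_def)

lemma adjoint_discounted:
  assumes s: "0 \<le> s"
  shows "AE \<omega> in P x. p s \<omega> * exp (- r * s)
    = real_cond_exp (P x) (F s) (\<lambda>\<omega>. marginal_after \<theta> (ennreal s) \<omega>) \<omega>"
proof -
  interpret F: sigma_finite_subalgebra "P x" "F s"
    by (rule conditional_expectation_law[OF subalgebra_law[OF s]])
  let ?f = "\<lambda>\<omega>. LINT u:{s..}|lborel. c\<theta> u (X u \<omega>) (\<theta> u \<omega>) * exp (- r * (u - s))"
  let ?M = "\<lambda>\<omega>. marginal_after \<theta> (ennreal s) \<omega>"
  have eq: "?f \<omega> = exp (r * s) * ?M \<omega>" if \<omega>: "\<omega> \<in> space (P x)" for \<omega>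
  proof -
    note [measurable] = measurable_time marginal_path_measurable[OF inc \<omega>]
    have exps: "exp (- r * (u - s)) = exp (r * s) * exp (- r * u)" for u
      by (simp add: exp_add[symmetric] algebra_simps)
    have "?f \<omega> = (LINT t|time_measure. indicator {s..} t * (exp (r * s) * (c\<theta> t (X t \<omega>) (\<theta> t \<omega>) * exp (- r * t))))"
      unfolding set_lebesgue_integral_def exps using s
      by (subst integral_restrict_space)
        (auto intro!: Bochner_Integration.integral_cong split: split_indicator)
    also have "\<dots> = (LINT t|time_measure. exp (r * s) * (indicator {t. ennreal s < ennreal t} t * (c\<theta> t (X t \<omega>) (\<theta> t \<omega>) * exp (- r * t))))"
    proof (rule integral_cong_AE)
      show "AE t in time_measure. indicator {s..} t * (exp (r * s) * (c\<theta> t (X t \<omega>) (\<theta> t \<omega>) * exp (- r * t)))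
          = exp (r * s) * (indicator {t. ennreal s < ennreal t} t * (c\<theta> t (X t \<omega>) (\<theta> t \<omega>) * exp (- r * t)))"
        using AE_time_neq[of "ennreal s"] AE_space
      proof eventually_elim
        case (elim t)
        then have "s \<le> t \<longleftrightarrow> ennreal s < ennreal t"
          using s by (auto simp: space_restrict_space ennreal_less_iff less_le)
        then show ?case by (auto split: split_indicator)
      qed
      have [measurable]: "(\<lambda>t. indicator {s..} t) \<in> borel_measurable time_measure"
        by (rule measurable_compose[OF measurable_time]) simp
      show "(\<lambda>t. indicator {s..} t * (exp (r * s) * (c\<theta> t (X t \<omega>) (\<theta> t \<omega>) * exp (- r * t)))) \<in> borel_measurable time_measure"
        by measurable
    qed measurable
    finally show ?thesis by (simp add: marginal_after_def)
  qed
  have int: "integrable (P x) ?M" by (rule integrable_marginal_after[OF inc]) simp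
  have f_int: "integrable (P x) ?f"
  proof -
    have "integrable (P x) ?f \<longleftrightarrow> integrable (P x) (\<lambda>\<omega>. exp (r * s) * ?M \<omega>)"
      by (rule Bochner_Integration.integrable_cong[OF refl]) (rule eq)
    then show ?thesis using integrable_mult_right[OF int, of "exp (r * s)"] by blast
  qed
  have "AE \<omega> in P x. real_cond_exp (P x) (F s) ?f \<omega> = real_cond_exp (P x) (F s) (\<lambda>\<omega>. exp (r * s) * ?M \<omega>) \<omega>"
    by (rule F.real_cond_exp_cong[OF AE_I2[OF eq] borel_measurable_integrable[OF f_int]
          borel_measurable_times[OF borel_measurable_const borel_measurable_integrable[OF int]]])
  moreover have "AE \<omega> in P x. real_cond_exp (P x) (F s) (\<lambda>\<omega>. exp (r * s) * ?M \<omega>) \<omega> = exp (r * s) * real_cond_exp (P x) (F s) ?M \<omega>"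
    by (rule F.real_cond_exp_cmult[OF int])
  moreover have "AE \<omega> in P x. p s \<omega> = real_cond_exp (P x) (F s) ?f \<omega>"
    using adj s by (simp add: is_adjoint_def)
  ultimately show ?thesis
  proof eventually_elim
    case (elim \<omega>)
    then have "p s \<omega> * exp (- r * s) = (exp (r * s) * exp (- r * s)) * real_cond_exp (P x) (F s) ?M \<omega>" by simp
    then show ?case by (simp add: exp_add[symmetric])
  qed
qed

text \<open>At a fixed time the bound passes through the conditional expectation. It holds at all rational
  times simultaneously, and at all times by right-continuity.\<close>

lemma adjoint_bounded:
  obtains B where "0 \<le> B" "AE \<omega> in P x. \<forall>t\<ge>0. \<bar>p t \<omega>\<bar> \<le> B"
    "\<forall>\<omega>\<in>space (P x). \<forall>T. \<bar>marginal_after \<theta> T \<omega>\<bar> \<le> B"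
proof -
  obtain B where B: "0 \<le> B" "\<forall>\<omega>\<in>space (P x). \<forall>s\<ge>0. \<bar>marginal_after \<theta> (ennreal s) \<omega>\<bar> \<le> B * exp (- r * s)"
    by (rule marginal_after_bound[OF inc])
  have at: "AE \<omega> in P x. \<bar>p s \<omega>\<bar> \<le> B" if s: "0 \<le> s" for s
  proof -
    interpret F: sigma_finite_subalgebra "P x" "F s"
      by (rule conditional_expectation_law[OF subalgebra_law[OF s]])
    have int: "integrable (P x) (\<lambda>\<omega>. marginal_after \<theta> (ennreal s) \<omega>)"
      by (rule integrable_marginal_after[OF inc]) simp
    have up: "marginal_after \<theta> (ennreal s) \<omega> \<le> B * exp (- r * s)"
      and low: "- (B * exp (- r * s)) \<le> marginal_after \<theta> (ennreal s) \<omega>" if "\<omega> \<in> space (P x)" for \<omega>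
    proof -
      have "\<bar>marginal_after \<theta> (ennreal s) \<omega>\<bar> \<le> B * exp (- r * s)" using B(2) that s by blast
      then show "marginal_after \<theta> (ennreal s) \<omega> \<le> B * exp (- r * s)"
        "- (B * exp (- r * s)) \<le> marginal_after \<theta> (ennreal s) \<omega>" by linarith+
    qed
    have "AE \<omega> in P x. real_cond_exp (P x) (F s) (\<lambda>\<omega>. marginal_after \<theta> (ennreal s) \<omega>) \<omega> \<le> B * exp (- r * s)"
      by (intro F.real_cond_exp_le_c int AE_I2 up)
    moreover have "AE \<omega> in P x. real_cond_exp (P x) (F s) (\<lambda>\<omega>. marginal_after \<theta> (ennreal s) \<omega>) \<omega> \<ge> - (B * exp (- r * s))"
      by (intro F.real_cond_exp_ge_c int AE_I2 low)
    ultimately show ?thesis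
      using adjoint_discounted[OF s]
    proof eventually_elim
      case (elim \<omega>)
      then have "\<bar>p s \<omega>\<bar> * exp (- r * s) \<le> B * exp (- r * s)"
        by (metis abs_exp_cancel abs_le_iff abs_mult minus_le_iff)
      then show ?case by simp
    qed
  qed
  have "AE \<omega> in P x. \<forall>q\<in>{q\<in>\<rat>. 0 \<le> q}. \<bar>p q \<omega>\<bar> \<le> B"
    by (subst AE_ball_countable) (auto intro: at countable_subset[OF _ countable_rat])
  then have "AE \<omega> in P x. \<forall>t\<ge>0. \<bar>p t \<omega>\<bar> \<le> B"
    using AE_space
  proof eventually_elim
    case (elim \<omega>)
    show ?case
    proof (intro allI impI)
      fix t :: real assume t: "0 \<le> t"
      have "continuous (at_right t) (\<lambda>t. \<bar>p t \<omega>\<bar>)"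
        using cadlag_right_continuous[OF adjoint_cadlag elim(2) t] by (rule continuous_rabs)
      then show "\<bar>p t \<omega>\<bar> \<le> B"
        by (rule right_continuous_le_from_rationals) (use elim(1) t in auto)
    qed
  qed
  moreover have "\<bar>marginal_after \<theta> T \<omega>\<bar> \<le> B" if "\<omega> \<in> space (P x)" for \<omega> T
  proof (cases T)
    case (real s)
    then have "\<bar>marginal_after \<theta> T \<omega>\<bar> \<le> B * exp (- r * s)" using B(2) that by auto
    also have "\<dots> \<le> B * 1" using B(1) real r_pos by (intro mult_left_mono) auto
    finally show ?thesis by simp
  qed (use B(1) marginal_after_top[OF inc] in simp)
  ultimately show ?thesis using B(1) by (intro that[of B]) auto
qed

lemma stopping_time_strict_less:
  assumes "is_stopping_time (P x) F \<sigma>" "0 \<le> u" "u \<le> t"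
  shows "{\<omega> \<in> space (P x). \<sigma> \<omega> < ennreal u} \<in> sets (F t)"
proof -
  interpret ext: filtration "space (P x)" "ext_filtration (P x) F" by (rule filtration_law)
  have "{\<omega> \<in> space (P x). \<sigma> \<omega> < ennreal u} \<in> sets (F u)"
    using ext.stopping_time_less_const[OF assms(1), of "ennreal u"] assms(2) subalgebra_law[OF assms(2)]
    by (simp add: ext_filtration_ennreal pred_def subalgebra_def)
  then show ?thesis using mono_F[OF assms(2,3)] by blast
qed

text \<open>The grid time takes countably many values, and the event that it takes a given value is known
  at that value, so the defining property of \<open>p\<close> at deterministic times can be applied to each
  piece.\<close>

lemma adjoint_at_grid_time:
  assumes \<sigma>: "is_stopping_time (P x) F \<sigma>"
  defines "S \<equiv> \<lambda>n \<omega>. if \<sigma> \<omega> = \<infinity> then \<infinity> else ennreal (grid_above n (enn2real (\<sigma> \<omega>)))"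
  shows "(\<integral>\<omega>. present_value r p \<omega> (S n \<omega>) \<partial>P x) = (\<integral>\<omega>. marginal_after \<theta> (S n \<omega>) \<omega> \<partial>P x)"
proof -
  note [measurable] = measurable_stopping_time_law[OF \<sigma>]
  have [measurable]: "S n \<in> borel_measurable (P x)" unfolding S_def by measurable
  obtain B where B: "0 \<le> B" "AE \<omega> in P x. \<forall>t\<ge>0. \<bar>p t \<omega>\<bar> \<le> B"
    by (rule adjoint_bounded)
  let ?p = "\<lambda>\<omega>. present_value r p \<omega> (S n \<omega>)" and ?m = "\<lambda>\<omega>. marginal_after \<theta> (S n \<omega>) \<omega>"
  have p_meas: "?p \<in> borel_measurable (P x)"
    by (intro measurable_present_value[OF measurable_process[OF adjoint_adapted adjoint_cadlag]]) measurable
  have p_int: "integrable (P x) ?p"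
  proof (rule law.integrable_const_bound[OF _ p_meas])
    show "AE \<omega> in P x. norm (?p \<omega>) \<le> B"
      using B(2)
    proof eventually_elim
      case (elim \<omega>)
      have "\<bar>p (enn2real (S n \<omega>)) \<omega>\<bar> * exp (- r * enn2real (S n \<omega>)) \<le> B * 1"
        using elim B(1) r_pos by (intro mult_mono) auto
      then show ?case using B(1) by (simp add: present_value_def abs_mult)
    qed
  qed
  have m_int: "integrable (P x) ?m" by (intro integrable_marginal_after[OF inc]) measurable
  \<comment> \<open>The grid time equals \<open>(i + 1) / Suc n\<close> on the i-th cell.\<close>
  define V where "V i = {\<omega> \<in> space (P x). \<sigma> \<omega> < ennreal (real i / real (Suc n))}" for i :: nat
  define cell where "cell i = V (Suc i) - V i" for i
  have V_mono: "V i \<subseteq> V j" if "i \<le> j" for i j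
  proof -
    have "ennreal (real i / real (Suc n)) \<le> ennreal (real j / real (Suc n))"
      using that by (intro ennreal_leI divide_right_mono) auto
    then show ?thesis unfolding V_def by (auto intro: less_le_trans)
  qed
  have cell_F: "cell i \<in> sets (F (real (Suc i) / real (Suc n)))" for i
    unfolding cell_def V_def by (intro sets.Diff stopping_time_strict_less[OF \<sigma>] divide_right_mono) auto
  have cell_sets [measurable]: "cell i \<in> sets (P x)" for i
    using cell_F[of i] subalgebra_law[of "real (Suc i) / real (Suc n)"] by (auto simp: subalgebra_def)
  have disj: "cell i \<inter> cell j = {}" if "i \<noteq> j" for i j
  proof -
    have "cell i \<inter> cell j = {}" if "i < j" for i j
      using V_mono[of "Suc i" j] that unfolding cell_def by auto
    then show ?thesis using that by (metis Int_commute linorder_neqE_nat)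
  qed
  have grid: "S n \<omega> = ennreal (real (Suc i) / real (Suc n))" if mem: "\<omega> \<in> cell i" for \<omega> i
  proof -
    obtain v where v: "\<sigma> \<omega> = ennreal v" "0 \<le> v"
      using mem unfolding cell_def V_def by (cases "\<sigma> \<omega>") auto
    then have lo: "real i / real (Suc n) \<le> v" and hi: "v < real (Suc i) / real (Suc n)"
      using mem unfolding cell_def V_def by (auto simp: ennreal_less_iff not_less simp del: of_nat_Suc)
    have "real i \<le> v * real (Suc n)" using lo by (simp add: pos_divide_le_eq del: of_nat_Suc)
    moreover have "v * real (Suc n) < real (Suc i)" using hi by (simp add: pos_less_divide_eq del: of_nat_Suc)
    ultimately have "\<lfloor>real (Suc n) * v\<rfloor> = int i" by (intro floor_unique) (auto simp: mult.commute)
    then show ?thesis using v by (simp add: S_def grid_above_def add.commute)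
  qed
  have cover: "(\<Union>i. cell i) = {\<omega> \<in> space (P x). \<sigma> \<omega> \<noteq> \<infinity>}"
  proof safe
    fix \<omega> assume \<omega>: "\<omega> \<in> space (P x)" "\<sigma> \<omega> \<noteq> \<infinity>"
    then obtain v where v: "\<sigma> \<omega> = ennreal v" "0 \<le> v" by (cases "\<sigma> \<omega>") auto
    define i where "i = nat \<lfloor>v * real (Suc n)\<rfloor>"
    have "real i = of_int \<lfloor>v * real (Suc n)\<rfloor>" unfolding i_def using v by simp
    then have "real i \<le> v * real (Suc n)" "v * real (Suc n) < real (Suc i)" by linarith+
    then have "real i / real (Suc n) \<le> v" "v < real (Suc i) / real (Suc n)"
      by (simp_all add: pos_divide_le_eq pos_less_divide_eq del: of_nat_Suc)
    then have "\<omega> \<in> cell i" using \<omega> v by (auto simp: cell_def V_def ennreal_less_iff not_less simp del: of_nat_Suc)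
    then show "\<omega> \<in> (\<Union>i. cell i)" by blast
  qed (auto simp: cell_def V_def)
  have piece: "(LINT \<omega>:cell i|P x. ?p \<omega>) = (LINT \<omega>:cell i|P x. ?m \<omega>)" for i
  proof -
    let ?s = "real (Suc i) / real (Suc n)"
    have s: "0 \<le> ?s" by simp
    interpret F: sigma_finite_subalgebra "P x" "F ?s"
      by (rule conditional_expectation_law[OF subalgebra_law[OF s]])
    have "(LINT \<omega>:cell i|P x. ?p \<omega>) = (LINT \<omega>:cell i|P x. p ?s \<omega> * exp (- r * ?s))"
      using s by (intro set_lebesgue_integral_cong cell_sets) (simp add: grid present_value_def del: of_nat_Suc)
    also have "\<dots> = (LINT \<omega>:cell i|P x. real_cond_exp (P x) (F ?s) (\<lambda>\<omega>. marginal_after \<theta> (ennreal ?s) \<omega>) \<omega>)"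
    proof (rule set_lebesgue_integral_cong_AE[OF cell_sets])
      show "AE \<omega>\<in>cell i in P x. p ?s \<omega> * exp (- r * ?s) = real_cond_exp (P x) (F ?s) (\<lambda>\<omega>. marginal_after \<theta> (ennreal ?s) \<omega>) \<omega>"
        using adjoint_discounted[OF s] by (rule eventually_mono) simp
      show "(\<lambda>\<omega>. p ?s \<omega> * exp (- r * ?s)) \<in> borel_measurable (P x)"
        using adapted_measurable[OF adjoint_adapted s] by (intro borel_measurable_times borel_measurable_const)
    qed simp
    also have "\<dots> = (LINT \<omega>:cell i|P x. marginal_after \<theta> (ennreal ?s) \<omega>)"
      by (intro F.real_cond_exp_intA[symmetric] cell_F integrable_marginal_after[OF inc]) simp
    also have "\<dots> = (LINT \<omega>:cell i|P x. ?m \<omega>)"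
      by (intro set_lebesgue_integral_cong cell_sets) (simp add: grid del: of_nat_Suc)
    finally show ?thesis .
  qed
  have total: "(\<integral>\<omega>. g \<omega> \<partial>P x) = (\<Sum>i. LINT \<omega>:cell i|P x. g \<omega>)"
    if g: "integrable (P x) g" and top: "\<And>\<omega>. \<sigma> \<omega> = \<infinity> \<Longrightarrow> g \<omega> = 0" for g :: "'a \<Rightarrow> real"
  proof -
    have "(\<integral>\<omega>. g \<omega> \<partial>P x) = (LINT \<omega>:(\<Union>i. cell i)|P x. g \<omega>)"
      unfolding set_lebesgue_integral_def cover using top
      by (intro Bochner_Integration.integral_cong) (auto split: split_indicator)
    also have "\<dots> = (\<Sum>i. LINT \<omega>:cell i|P x. g \<omega>)"
    proof (rule lebesgue_integral_countable_add)
      show "set_integrable (P x) (\<Union>i. cell i) g"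
        unfolding set_integrable_def by (intro integrable_mult_indicator g) measurable
    qed (use disj in auto)
    finally show ?thesis .
  qed
  show ?thesis
    using total[OF p_int] total[OF m_int] piece by (simp add: S_def present_value_def marginal_after_def)
qed

text \<open>Both sides are right-continuous in the stopping time and bounded, so the identity for the grid
  times above \<open>\<sigma>\<close> survives in the limit.\<close>

lemma adjoint_at_stopping_time:
  assumes \<sigma>: "is_stopping_time (P x) F \<sigma>"
  shows "integrable (P x) (\<lambda>\<omega>. present_value r p \<omega> (\<sigma> \<omega>))"
    "(\<integral>\<omega>. present_value r p \<omega> (\<sigma> \<omega>) \<partial>P x) = (\<integral>\<omega>. marginal_after \<theta> (\<sigma> \<omega>) \<omega> \<partial>P x)"
proof -
  note [measurable] = measurable_stopping_time_law[OF \<sigma>]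
  define S where "S n \<omega> = (if \<sigma> \<omega> = \<infinity> then \<infinity> else ennreal (grid_above n (enn2real (\<sigma> \<omega>))))" for n \<omega>
  have S_meas [measurable]: "S n \<in> borel_measurable (P x)" for n unfolding S_def by measurable
  obtain B where B: "0 \<le> B" "AE \<omega> in P x. \<forall>t\<ge>0. \<bar>p t \<omega>\<bar> \<le> B"
    "\<forall>\<omega>\<in>space (P x). \<forall>T. \<bar>marginal_after \<theta> T \<omega>\<bar> \<le> B"
    by (rule adjoint_bounded)
  have p_meas: "(\<lambda>\<omega>. present_value r p \<omega> (T \<omega>)) \<in> borel_measurable (P x)"
    if "T \<in> borel_measurable (P x)" for T
    by (rule measurable_present_value[OF measurable_process[OF adjoint_adapted adjoint_cadlag] that])
      (rule measurable_ident_sets[OF refl])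
  have bound: "AE \<omega> in P x. norm (present_value r p \<omega> (T \<omega>)) \<le> B" for T
    using B(2)
  proof eventually_elim
    case (elim \<omega>)
    have "\<bar>p (enn2real (T \<omega>)) \<omega>\<bar> * exp (- r * enn2real (T \<omega>)) \<le> B * 1"
      using elim B(1) r_pos by (intro mult_mono) auto
    then show ?case using B(1) by (simp add: present_value_def abs_mult)
  qed
  show "integrable (P x) (\<lambda>\<omega>. present_value r p \<omega> (\<sigma> \<omega>))"
    by (rule law.integrable_const_bound[OF bound p_meas]) measurable
  have p_lim: "AE \<omega> in P x. (\<lambda>n. present_value r p \<omega> (S n \<omega>)) \<longlonglongrightarrow> present_value r p \<omega> (\<sigma> \<omega>)"
  proof (rule AE_I2)
    fix \<omega> assume \<omega>: "\<omega> \<in> space (P x)"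
    show "(\<lambda>n. present_value r p \<omega> (S n \<omega>)) \<longlonglongrightarrow> present_value r p \<omega> (\<sigma> \<omega>)"
    proof (cases "\<sigma> \<omega>")
      case (real s)
      have "((\<lambda>t. p t \<omega> * exp (- r * t)) \<longlongrightarrow> p s \<omega> * exp (- r * s)) (at_right s)"
        using cadlag_right_continuous[OF adjoint_cadlag \<omega> real(1)]
        by (auto simp: continuous_within intro!: tendsto_intros)
      from filterlim_compose[OF this filterlim_grid_above]
      have "(\<lambda>n. p (grid_above n s) \<omega> * exp (- r * grid_above n s)) \<longlonglongrightarrow> p s \<omega> * exp (- r * s)" .
      moreover have "0 \<le> grid_above n s" for n
        using grid_above_bounds(1)[of s n] real(1) by linarith
      ultimately show ?thesis using real by (simp add: present_value_def S_def)
    qed (simp add: S_def)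
  qed
  have m_lim: "AE \<omega> in P x. (\<lambda>n. marginal_after \<theta> (S n \<omega>) \<omega>) \<longlonglongrightarrow> marginal_after \<theta> (\<sigma> \<omega>) \<omega>"
  proof (rule AE_I2)
    fix \<omega> assume \<omega>: "\<omega> \<in> space (P x)"
    note [measurable] = measurable_time marginal_path_measurable[OF inc \<omega>]
    let ?m = "\<lambda>t. c\<theta> t (X t \<omega>) (\<theta> t \<omega>) * exp (- r * t)"
    have "integrable time_measure (\<lambda>t. indicator {t. 0 < ennreal t} t * ?m t)"
      by (rule marginal_path_integrable[OF inc \<omega>])
    then have dom: "integrable time_measure (\<lambda>t. \<bar>indicator {t. 0 < ennreal t} t * ?m t\<bar>)"
      by (rule integrable_abs)
    show "(\<lambda>n. marginal_after \<theta> (S n \<omega>) \<omega>) \<longlonglongrightarrow> marginal_after \<theta> (\<sigma> \<omega>) \<omega>"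
      unfolding marginal_after_def
    proof (rule integral_dominated_convergence[OF _ _ dom])
      show "AE t in time_measure. (\<lambda>n. indicator {t. S n \<omega> < ennreal t} t * ?m t) \<longlonglongrightarrow> indicator {t. \<sigma> \<omega> < ennreal t} t * ?m t"
      proof (rule AE_I2)
        fix t
        have "\<forall>\<^sub>F n in sequentially. S n \<omega> < ennreal t \<longleftrightarrow> \<sigma> \<omega> < ennreal t"
        proof (cases "\<sigma> \<omega> < ennreal t")
          case True
          then obtain s where s: "\<sigma> \<omega> = ennreal s" "0 \<le> s" "s < t"
            by (cases "\<sigma> \<omega>") (auto simp: ennreal_less_iff)
          then have "\<forall>\<^sub>F u in at_right s. u < t" by (auto simp: eventually_at_right_field)
          then have "\<forall>\<^sub>F n in sequentially. grid_above n s < t"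
            using filterlim_grid_above[of s] by (auto simp: filterlim_iff)
          then show ?thesis
          proof (rule eventually_mono)
            fix n assume "grid_above n s < t"
            moreover have "0 \<le> grid_above n s" using grid_above_bounds(1)[of s n] s(2) by linarith
            ultimately show "S n \<omega> < ennreal t \<longleftrightarrow> \<sigma> \<omega> < ennreal t"
              using s True by (simp add: S_def ennreal_less_iff)
          qed
        next
          case False
          have "\<sigma> \<omega> \<le> S n \<omega>" for n
          proof (cases "\<sigma> \<omega>")
            case (real s)
            then show ?thesis using grid_above_bounds(1)[of s n] by (auto simp: S_def intro!: ennreal_leI)
          qed (simp add: S_def)
          then have "\<not> S n \<omega> < ennreal t" for n using False by (meson not_less order_trans)
          then show ?thesis using False by simp
        qed
        then have "\<forall>\<^sub>F n in sequentially. indicator {t. \<sigma> \<omega> < ennreal t} t * ?m t = indicator {t. S n \<omega> < ennreal t} t * ?m t"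
          by (rule eventually_mono) (simp add: indicator_def)
        then show "(\<lambda>n. indicator {t. S n \<omega> < ennreal t} t * ?m t) \<longlonglongrightarrow> indicator {t. \<sigma> \<omega> < ennreal t} t * ?m t"
          by (rule Lim_transform_eventually[OF tendsto_const])
      qed
      show "AE t in time_measure. norm (indicator {t. S n \<omega> < ennreal t} t * ?m t) \<le> \<bar>indicator {t. 0 < ennreal t} t * ?m t\<bar>" for n
        by (intro AE_I2) (auto split: split_indicator simp: not_less)
    qed measurable
  qed
  have "(\<lambda>n. \<integral>\<omega>. present_value r p \<omega> (S n \<omega>) \<partial>P x) \<longlonglongrightarrow> (\<integral>\<omega>. present_value r p \<omega> (\<sigma> \<omega>) \<partial>P x)"
    by (rule integral_dominated_convergence[OF p_meas p_meas law.integrable_const p_lim bound]) measurable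
  moreover have "(\<lambda>n. \<integral>\<omega>. marginal_after \<theta> (S n \<omega>) \<omega> \<partial>P x) \<longlonglongrightarrow> (\<integral>\<omega>. marginal_after \<theta> (\<sigma> \<omega>) \<omega> \<partial>P x)"
  proof (rule integral_dominated_convergence[OF measurable_marginal_after[OF inc] measurable_marginal_after[OF inc] law.integrable_const m_lim])
    show "AE \<omega> in P x. norm (marginal_after \<theta> (S n \<omega>) \<omega>) \<le> B" for n
      using B(3) by (intro AE_I2) simp
  qed measurable
  ultimately show "(\<integral>\<omega>. present_value r p \<omega> (\<sigma> \<omega>) \<partial>P x) = (\<integral>\<omega>. marginal_after \<theta> (\<sigma> \<omega>) \<omega> \<partial>P x)"
    using adjoint_at_grid_time[OF \<sigma>] unfolding S_def[symmetric] by (simp add: LIMSEQ_unique)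
qed

end

end

section \<open>Stopping at once is optimal at a level time\<close>

context singular_control_setting
begin

lemma subalgebra_stopped:
  assumes "is_stopping_time (P x) F \<tau>"
  shows "subalgebra (P x) (stopped_sigma (P x) F \<tau>)"
proof -
  interpret ext: filtration "space (P x)" "ext_filtration (P x) F" by (rule filtration_law)
  have "A' \<in> sets (P x)" if "A' \<in> sets (stopped_sigma (P x) F \<tau>)" for A'
    using ext.sets_pre_sigmaD[OF assms that, of \<infinity>] sets_ext_filtration by auto
  then show ?thesis by (auto simp: subalgebra_def ext.space_pre_sigma)
qed

text \<open>On the event \<open>\<tau> \<le> u\<close> the value at \<open>\<tau>\<close> is that of the process stopped at \<open>u\<close>, which is jointly
  measurable with respect to \<open>F u\<close>. Approximating \<open>\<tau>\<close> from the right would only give measurability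
  with respect to the right-continuous filtration.\<close>

lemma measurable_at_stopping_time:
  assumes Y: "adapted F Y" "cadlag_process (P x) Y" and \<tau>: "is_stopping_time (P x) F \<tau>"
  shows "at_time Y \<tau> \<in> borel_measurable (stopped_sigma (P x) F \<tau>)"
proof (rule measurableI)
  interpret ext: filtration "space (P x)" "ext_filtration (P x) F" by (rule filtration_law)
  fix C :: "real set" assume C: "C \<in> sets borel"
  let ?Z = "{\<omega> \<in> space (P x). at_time Y \<tau> \<omega> \<in> C}"
  have finite: "{\<omega> \<in> ?Z. \<tau> \<omega> \<le> ennreal u} \<in> sets (F u)" if u: "0 \<le> u" for u
  proof -
    have space_u: "space (F u) = space (P x)" using subalgebra_law[OF u] by (simp add: subalgebra_def)
    let ?stop = "\<lambda>(s, \<omega>). Y (min (max 0 s) u) \<omega>"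
    have stop: "?stop \<in> borel_measurable (borel \<Otimes>\<^sub>M F u)"
    proof (rule measurable_right_continuous_process[of "\<lambda>s. Y (min s u)"])
      show "Y (min s u) \<in> borel_measurable (F u)" if "0 \<le> s" for s
      proof -
        have "0 \<le> min s u" "min s u \<le> u" using that u by auto
        then have "subalgebra (F u) (F (min s u))"
          using mono_F[of "min s u" u] sub_F[of "min s u"] sub_F[OF u] by (simp add: subalgebra_def)
        then show ?thesis
          using Y(1) \<open>0 \<le> min s u\<close> by (auto simp: adapted_def intro: measurable_from_subalg)
      qed
      fix \<omega> t assume \<omega>: "\<omega> \<in> space (F u)" and t: "(0::real) \<le> t"
      show "continuous (at_right t) (\<lambda>s. Y (min s u) \<omega>)"
      proof (cases "t < u")
        case True
        have "((\<lambda>s. Y s \<omega>) \<longlongrightarrow> Y t \<omega>) (at_right t)"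
          using cadlag_right_continuous[OF Y(2) _ t] \<omega> by (simp add: space_u continuous_within)
        then have "((\<lambda>s. Y (min s u) \<omega>) \<longlongrightarrow> Y t \<omega>) (at_right t)"
        proof (rule Lim_transform_eventually)
          show "\<forall>\<^sub>F s in at_right t. Y s \<omega> = Y (min s u) \<omega>"
            using True by (intro eventually_at_rightI[of t u]) auto
        qed
        then show ?thesis using True by (simp add: continuous_within)
      next
        case False
        have "\<forall>\<^sub>F s in at_right t. Y (min s u) \<omega> = Y u \<omega>"
          by (rule eventually_mono[OF eventually_at_right_less[of t]]) (use False in \<open>simp add: min_def\<close>)
        then have "((\<lambda>s. Y (min s u) \<omega>) \<longlongrightarrow> Y u \<omega>) (at_right t)" by (rule tendsto_eventually)
        moreover have "min t u = u" using False by simp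
        ultimately show ?thesis by (simp add: continuous_within)
      qed
    qed
    have capped: "(\<lambda>\<omega>. min (\<tau> \<omega>) (ennreal u)) \<in> borel_measurable (F u)"
    proof (rule borel_measurableI_le)
      fix v
      show "{\<omega> \<in> space (F u). min (\<tau> \<omega>) (ennreal u) \<le> v} \<in> sets (F u)"
      proof (cases "ennreal u \<le> v")
        case False
        then have "v < ennreal u" by simp
        then have "sets (ext_filtration (P x) F v) \<subseteq> sets (F u)"
          using ext.sets_F_mono[of v "ennreal u"] by (simp add: ext_filtration_ennreal[OF u])
        moreover have "{\<omega> \<in> space (P x). \<tau> \<omega> \<le> v} \<in> sets (ext_filtration (P x) F v)"
          using stopping_timeD[OF \<tau>, of v] by (simp add: pred_def ext.space_F)
        moreover have "{\<omega> \<in> space (F u). min (\<tau> \<omega>) (ennreal u) \<le> v} = {\<omega> \<in> space (P x). \<tau> \<omega> \<le> v}"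
          using False by (auto simp: space_u min_le_iff_disj)
        ultimately show ?thesis by auto
      qed (simp add: min_le_iff_disj)
    qed
    have "(\<lambda>\<omega>. (enn2real (min (\<tau> \<omega>) (ennreal u)), \<omega>)) \<in> F u \<rightarrow>\<^sub>M borel \<Otimes>\<^sub>M F u"
      by (rule measurable_Pair[OF borel_measurable_enn2real[OF capped] measurable_ident_sets[OF refl]])
    from measurable_sets[OF measurable_compose[OF this stop] C]
    have "{\<omega> \<in> space (P x). Y (min (enn2real (min (\<tau> \<omega>) (ennreal u))) u) \<omega> \<in> C} \<in> sets (F u)"
      by (simp add: vimage_def Int_def space_u conj_commute)
    from sets.Int[OF this stopping_time_le[OF \<tau> u]]
    show ?thesis
    proof (rule back_subst[where P="\<lambda>Z. Z \<in> sets (F u)"])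
      have "at_time Y \<tau> \<omega> = Y (min (enn2real (min (\<tau> \<omega>) (ennreal u))) u) \<omega>" if le: "\<tau> \<omega> \<le> ennreal u" for \<omega>
      proof -
        obtain v where "\<tau> \<omega> = ennreal v" "0 \<le> v" using le by (cases "\<tau> \<omega>") (auto simp: top_unique)
        then show ?thesis using le u by (simp add: at_time_def min_absorb1)
      qed
      then show "{\<omega> \<in> space (P x). Y (min (enn2real (min (\<tau> \<omega>) (ennreal u))) u) \<omega> \<in> C}
          \<inter> {\<omega> \<in> space (P x). \<tau> \<omega> \<le> ennreal u} = {\<omega> \<in> ?Z. \<tau> \<omega> \<le> ennreal u}"
        by auto
    qed
  qed
  have "?Z \<in> sets (stopped_sigma (P x) F \<tau>)"
  proof (rule ext.sets_pre_sigmaI[OF \<tau>])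
    fix t :: ennreal
    show "{\<omega> \<in> ?Z. \<tau> \<omega> \<le> t} \<in> sets (ext_filtration (P x) F t)"
    proof (cases t)
      case (real u)
      then show ?thesis using finite by (simp add: ext_filtration_ennreal)
    next
      case top
      let ?E = "ext_filtration (P x) F t"
      have sub: "sets (F (real n)) \<subseteq> sets ?E" for n
        using ext.sets_F_mono[of "ennreal (real n)" t] top by (simp add: ext_filtration_ennreal)
      have inf: "{\<omega> \<in> space (P x). \<tau> \<omega> = \<infinity>} \<in> sets ?E"
        using ext.stopping_time_eq_const[OF \<tau>, of t] top by (simp add: pred_def ext.space_F)
      have part: "{\<omega> \<in> ?Z. \<tau> \<omega> = \<infinity>} \<in> sets ?E"
      proof (cases "0 \<in> C")
        case True
        then have all: "{\<omega> \<in> ?Z. \<tau> \<omega> = \<infinity>} = {\<omega> \<in> space (P x). \<tau> \<omega> = \<infinity>}" by (auto simp: at_time_def)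
        show ?thesis unfolding all by (rule inf)
      next
        case False
        then have none: "{\<omega> \<in> ?Z. \<tau> \<omega> = \<infinity>} = {}" by (auto simp: at_time_def)
        show ?thesis unfolding none by (rule sets.empty_sets)
      qed
      have "{\<omega> \<in> ?Z. \<tau> \<omega> \<le> t} = (\<Union>n. {\<omega> \<in> ?Z. \<tau> \<omega> \<le> ennreal (real n)}) \<union> {\<omega> \<in> ?Z. \<tau> \<omega> = \<infinity>}"
      proof -
        have "(\<exists>n. \<tau> \<omega> \<le> ennreal (real n)) \<or> \<tau> \<omega> = \<infinity>" for \<omega>
        proof (cases "\<tau> \<omega>")
          case (real v)
          obtain n where "v \<le> real n" using real_arch_simple by blast
          then show ?thesis using real by (auto intro!: exI[of _ n] ennreal_leI)
        qed simp
        then show ?thesis using top by auto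
      qed
      moreover have "(\<Union>n. {\<omega> \<in> ?Z. \<tau> \<omega> \<le> ennreal (real n)}) \<in> sets ?E"
      proof (rule sets.countable_nat_UN, safe)
        show "{\<omega> \<in> ?Z. \<tau> \<omega> \<le> ennreal (real n)} \<in> sets ?E" for n
          using finite[of "real n"] sub[of n] by (auto simp del: mem_Collect_eq)
      qed
      ultimately show ?thesis using sets.Un[OF _ part] by simp
    qed
  qed
  then show "at_time Y \<tau> -` C \<inter> space (stopped_sigma (P x) F \<tau>) \<in> sets (stopped_sigma (P x) F \<tau>)"
    by (simp add: ext.space_pre_sigma vimage_def Int_def conj_commute)
qed simp

lemma stopping_time_switch:
  assumes \<tau>: "is_stopping_time (P x) F \<tau>" and \<sigma>: "is_stopping_time (P x) F \<sigma>"
    and later: "\<And>\<omega>. \<omega> \<in> space (P x) \<Longrightarrow> \<tau> \<omega> \<le> \<sigma> \<omega>" and B: "B \<in> sets (stopped_sigma (P x) F \<tau>)"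
  shows "is_stopping_time (P x) F (\<lambda>\<omega>. if \<omega> \<in> B then \<sigma> \<omega> else \<tau> \<omega>)"
proof (rule stopping_timeI)
  interpret ext: filtration "space (P x)" "ext_filtration (P x) F" by (rule filtration_law)
  fix t
  let ?E = "ext_filtration (P x) F t"
  have B\<tau>: "{\<omega> \<in> B. \<tau> \<omega> \<le> t} \<in> sets ?E" by (rule ext.sets_pre_sigmaD[OF \<tau> B])
  have \<tau>t: "{\<omega> \<in> space (P x). \<tau> \<omega> \<le> t} \<in> sets ?E" and \<sigma>t: "{\<omega> \<in> space (P x). \<sigma> \<omega> \<le> t} \<in> sets ?E"
    using stopping_timeD[OF \<tau>, of t] stopping_timeD[OF \<sigma>, of t] by (simp_all add: pred_def ext.space_F)
  have "B \<subseteq> space (P x)" using sets.sets_into_space[OF B] by (simp add: ext.space_pre_sigma)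
  then have "{\<omega> \<in> space ?E. (if \<omega> \<in> B then \<sigma> \<omega> else \<tau> \<omega>) \<le> t}
      = ({\<omega> \<in> B. \<tau> \<omega> \<le> t} \<inter> {\<omega> \<in> space (P x). \<sigma> \<omega> \<le> t}) \<union> ({\<omega> \<in> space (P x). \<tau> \<omega> \<le> t} - {\<omega> \<in> B. \<tau> \<omega> \<le> t})"
    using later by (auto simp: ext.space_F intro: order_trans)
  then show "Measurable.pred ?E (\<lambda>\<omega>. (if \<omega> \<in> B then \<sigma> \<omega> else \<tau> \<omega>) \<le> t)"
    unfolding pred_def using B\<tau> \<tau>t \<sigma>t by auto
qed

lemma stopping_time_level:
  assumes "increasing_process (P x) F \<theta>"
  shows "is_stopping_time (P x) F (level_time \<theta> b)"
proof (rule stopping_timeI)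
  fix t
  show "Measurable.pred (ext_filtration (P x) F t) (\<lambda>\<omega>. level_time \<theta> b \<omega> \<le> t)"
  proof (cases t)
    case (real u)
    have [measurable]: "\<theta> u \<in> borel_measurable (F u)"
      using increasing_adapted[OF assms] real by (simp add: adapted_def)
    have pred: "Measurable.pred (F u) (\<lambda>\<omega>. b \<le> \<theta> u \<omega>)" by measurable
    have eq: "level_time \<theta> b \<omega> \<le> t \<longleftrightarrow> b \<le> \<theta> u \<omega>" if "\<omega> \<in> space (F u)" for \<omega>
      using level_time_le[OF assms, of \<omega> u b] real that subalgebra_law[OF real(1)]
      by (simp add: subalgebra_def)
    have "Measurable.pred (F u) (\<lambda>\<omega>. level_time \<theta> b \<omega> \<le> t)"
      by (rule measurable_cong[THEN iffD2, OF eq pred])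
    then show ?thesis using real by (simp add: ext_filtration_ennreal)
  qed simp
qed

context
  fixes \<theta> p :: "real \<Rightarrow> 'a \<Rightarrow> real"
  assumes opt: "optimal_control (P x) F X k c r \<theta>" and adj: "is_adjoint (P x) F X c\<theta> r \<theta> p"
begin

lemma optimal_is_control: "\<theta> \<in> controls (P x) F r"
  using opt by (simp add: optimal_control_def)

lemma optimal_increasing: "increasing_process (P x) F \<theta>"
  by (rule controlsD(1)[OF optimal_is_control])

lemma subgradient_adapted: "adapted F (subgradient k p)"
  using adapted_k adjoint_adapted[OF optimal_increasing adj] unfolding adapted_def subgradient_def[abs_def]
  by (auto intro!: borel_measurable_add)

lemma subgradient_cadlag: "cadlag_process (P x) (subgradient k p)"
  unfolding cadlag_process_def cadlag_def subgradient_def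
proof (intro ballI conjI allI impI)
  fix \<omega> and t :: real assume \<omega>: "\<omega> \<in> space (P x)"
  show "continuous (at_right t) (\<lambda>t. k t \<omega> + p t \<omega>)" if "0 \<le> t"
    using that by (intro continuous_add cadlag_right_continuous[OF cadlag_cost \<omega>]
        cadlag_right_continuous[OF adjoint_cadlag[OF optimal_increasing adj] \<omega>])
  show "\<exists>l. ((\<lambda>t. k t \<omega> + p t \<omega>) \<longlongrightarrow> l) (at_left t)" if t: "0 < t"
  proof -
    obtain l m where "((\<lambda>t. k t \<omega>) \<longlongrightarrow> l) (at_left t)" "((\<lambda>t. p t \<omega>) \<longlongrightarrow> m) (at_left t)"
      using cadlag_cost adjoint_cadlag[OF optimal_increasing adj] \<omega> t unfolding cadlag_process_def cadlag_def by blast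
    then have "((\<lambda>t. k t \<omega> + p t \<omega>) \<longlongrightarrow> l + m) (at_left t)" by (rule tendsto_add)
    then show ?thesis by blast
  qed
qed

lemma subgradient_dominated:
  obtains D where "integrable (P x) D" "AE \<omega> in P x. \<forall>t\<ge>0. \<bar>subgradient k p t \<omega>\<bar> \<le> D \<omega>" "\<forall>\<omega>. 0 \<le> D \<omega>"
proof -
  obtain R where R: "R \<in> borel_measurable (P x)" "\<forall>\<omega>. 0 \<le> R \<omega>"
    "AE \<omega> in P x. \<forall>t\<ge>0. k t \<omega> \<le> R \<omega>" "(\<integral>\<^sup>+ \<omega>. ennreal ((R \<omega>)\<^sup>2) \<partial>P x) < \<infinity>"
    by (rule intervention_cost_dominated)
  obtain B where B: "0 \<le> B" "AE \<omega> in P x. \<forall>t\<ge>0. \<bar>p t \<omega>\<bar> \<le> B"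
    by (rule adjoint_bounded[OF optimal_increasing adj])
  have "integrable (P x) (\<lambda>\<omega>. R \<omega> + B)"
    using integrable_intervention_bound[OF R(1,2,4)] by simp
  moreover have "AE \<omega> in P x. \<forall>t\<ge>0. \<bar>subgradient k p t \<omega>\<bar> \<le> R \<omega> + B"
    using R(3) B(2) AE_space
  proof eventually_elim
    case (elim \<omega>)
    show ?case
    proof (intro allI impI)
      fix t :: real assume t: "0 \<le> t"
      have "0 < k t \<omega>" using k_pos[OF t] elim(3) by (simp add: space_law)
      moreover have "k t \<omega> \<le> R \<omega>" "\<bar>p t \<omega>\<bar> \<le> B" using elim t by auto
      ultimately show "\<bar>subgradient k p t \<omega>\<bar> \<le> R \<omega> + B" unfolding subgradient_def by linarith
    qed
  qed
  ultimately show ?thesis using R(2) B(1) by (intro that[of "\<lambda>\<omega>. R \<omega> + B"]) auto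
qed

text \<open>The marginal running cost saved between the two times has, by \<open>adjoint_at_stopping_time\<close>, the
  expectation of the difference of the discounted adjoint values, which is moved to the other side
  of \<open>first_variation\<close>.\<close>

lemma delaying_does_not_pay:
  assumes \<sigma>: "is_stopping_time (P x) F \<sigma>"
    and a: "0 \<le> a" and later: "\<And>\<omega>. \<omega> \<in> space (P x) \<Longrightarrow> level_time \<theta> a \<omega> \<le> \<sigma> \<omega>"
    and crossing: "AE \<omega> in P x. \<forall>t\<ge>0. level_time \<theta> a \<omega> < ennreal t \<longrightarrow> a < \<theta> t \<omega>"
  shows "0 \<le> (\<integral>\<omega>. present_value r (subgradient k p) \<omega> (\<sigma> \<omega>)
    - present_value r (subgradient k p) \<omega> (level_time \<theta> a \<omega>) \<partial>P x)"
proof -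
  note inc = optimal_increasing
  let ?\<tau> = "level_time \<theta> a"
  have \<tau>: "is_stopping_time (P x) F ?\<tau>" by (rule stopping_time_level[OF inc])
  obtain R where R: "R \<in> borel_measurable (P x)" "\<forall>\<omega>. 0 \<le> R \<omega>"
    "AE \<omega> in P x. \<forall>t\<ge>0. k t \<omega> \<le> R \<omega>" "(\<integral>\<^sup>+ \<omega>. ennreal ((R \<omega>)\<^sup>2) \<partial>P x) < \<infinity>"
    by (rule intervention_cost_dominated)
  have k_int: "integrable (P x) (\<lambda>\<omega>. present_value r k \<omega> (T \<omega>))" if T: "is_stopping_time (P x) F T" for T
  proof (rule Bochner_Integration.integrable_bound[OF integrable_intervention_bound[OF R(1,2,4)]])
    show "(\<lambda>\<omega>. present_value r k \<omega> (T \<omega>)) \<in> borel_measurable (P x)"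
      by (rule measurable_present_value[OF measurable_process[OF adapted_k cadlag_cost] measurable_stopping_time_law[OF T]])
        (rule measurable_ident_sets[OF refl])
    show "AE \<omega> in P x. norm (present_value r k \<omega> (T \<omega>)) \<le> norm (R \<omega>)"
      using R(3) AE_space
    proof eventually_elim
      case (elim \<omega>)
      have "0 \<le> present_value r k \<omega> (T \<omega>)" "present_value r k \<omega> (T \<omega>) \<le> R \<omega>"
        using present_value_intervention_bounds[OF elim(2), of "R \<omega>" "T \<omega>"] elim(1) R(2) by auto
      then show ?case by simp
    qed
  qed
  have m_int: "integrable (P x) (\<lambda>\<omega>. marginal_after \<theta> (T \<omega>) \<omega>)" if "is_stopping_time (P x) F T" for T
    by (rule integrable_marginal_after[OF inc measurable_stopping_time_law[OF that]])
  note p_int = adjoint_at_stopping_time[OF inc adj]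
  have split: "present_value r (subgradient k p) \<omega> T = present_value r k \<omega> T + present_value r p \<omega> T" for \<omega> T
    by (simp add: present_value_def subgradient_def distrib_right)
  have "(\<integral>\<omega>. present_value r p \<omega> (?\<tau> \<omega>) \<partial>P x) - (\<integral>\<omega>. present_value r p \<omega> (\<sigma> \<omega>) \<partial>P x)
      \<le> (\<integral>\<omega>. present_value r k \<omega> (\<sigma> \<omega>) \<partial>P x) - (\<integral>\<omega>. present_value r k \<omega> (?\<tau> \<omega>) \<partial>P x)"
    using first_variation[OF opt \<sigma> a later crossing] m_int k_int p_int(2) \<sigma> \<tau> by simp
  then show ?thesis unfolding split using k_int p_int(1) \<sigma> \<tau> by simp
qed

text \<open>If the inequality failed on an event of positive probability, waiting until \<open>\<sigma>\<close> on this event,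
  which is known at the level time, would lower the expected discounted subgradient.\<close>

lemma subgradient_le_conditional_expectation:
  assumes \<sigma>: "is_stopping_time (P x) F \<sigma>"
    and a: "0 \<le> a" and later: "\<And>\<omega>. \<omega> \<in> space (P x) \<Longrightarrow> level_time \<theta> a \<omega> \<le> \<sigma> \<omega>"
    and crossing: "AE \<omega> in P x. \<forall>t\<ge>0. level_time \<theta> a \<omega> < ennreal t \<longrightarrow> a < \<theta> t \<omega>"
  shows "AE \<omega> in P x. at_time (subgradient k p) (level_time \<theta> a) \<omega>
    \<le> real_cond_exp (P x) (stopped_sigma (P x) F (level_time \<theta> a))
        (discounted r (subgradient k p) (level_time \<theta> a) \<sigma>) \<omega>"
proof -
  interpret ext: filtration "space (P x)" "ext_filtration (P x) F" by (rule filtration_law)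
  let ?Y = "subgradient k p"
  let ?\<tau> = "level_time \<theta> a"
  let ?G = "stopped_sigma (P x) F ?\<tau>"
  have \<tau>: "is_stopping_time (P x) F ?\<tau>" by (rule stopping_time_level[OF optimal_increasing])
  interpret G: sigma_finite_subalgebra "P x" ?G
    by (rule conditional_expectation_law[OF subalgebra_stopped[OF \<tau>]])
  define U where "U = at_time ?Y ?\<tau>"
  define V where "V = discounted r ?Y ?\<tau> \<sigma>"
  define CV where "CV = real_cond_exp (P x) ?G V"
  \<comment> \<open>The discount factor, replaced by \<open>1\<close> at infinity, where both values vanish, so that it is positive everywhere.\<close>
  define w where "w \<omega> = (if ?\<tau> \<omega> = \<infinity> then 1 else exp (- r * enn2real (?\<tau> \<omega>)))" for \<omega>
  obtain D where D: "integrable (P x) D" "AE \<omega> in P x. \<forall>t\<ge>0. \<bar>?Y t \<omega>\<bar> \<le> D \<omega>" "\<forall>\<omega>. 0 \<le> D \<omega>"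
    by (rule subgradient_dominated)
  have U_G: "U \<in> borel_measurable ?G"
    unfolding U_def by (rule measurable_at_stopping_time[OF subgradient_adapted subgradient_cadlag \<tau>])
  have w_G: "w \<in> borel_measurable ?G"
  proof -
    have [measurable]: "?\<tau> \<in> borel_measurable ?G" by (rule ext.measurable_stopping_time_pre_sigma[OF \<tau>])
    show ?thesis unfolding w_def[abs_def] by measurable
  qed
  note [measurable] = measurable_stopping_time_law[OF \<sigma>] measurable_stopping_time_law[OF \<tau>]
  have V_meas: "V \<in> borel_measurable (P x)"
  proof -
    have "(\<lambda>\<omega>. (enn2real (\<sigma> \<omega>), \<omega>)) \<in> P x \<rightarrow>\<^sub>M borel \<Otimes>\<^sub>M P x"
      by (intro measurable_Pair measurable_ident_sets[OF refl]) measurable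
    from measurable_compose[OF this measurable_process[OF subgradient_adapted subgradient_cadlag]]
    have [measurable]: "(\<lambda>\<omega>. ?Y (enn2real (\<sigma> \<omega>)) \<omega>) \<in> borel_measurable (P x)" by simp
    show ?thesis unfolding V_def discounted_def[abs_def] by measurable
  qed
  have wU: "w \<omega> * U \<omega> = present_value r ?Y \<omega> (?\<tau> \<omega>)" for \<omega>
    by (simp add: w_def U_def at_time_def present_value_def)
  have wV: "w \<omega> * V \<omega> = present_value r ?Y \<omega> (\<sigma> \<omega>)" if "\<omega> \<in> space (P x)" for \<omega>
  proof (cases "\<sigma> \<omega> = \<infinity>")
    case False
    then have "?\<tau> \<omega> \<noteq> \<infinity>" using later[OF that] by (auto simp: top_unique)
    then show ?thesis
      using False by (simp add: w_def V_def discounted_def present_value_def exp_add[symmetric] algebra_simps)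
  qed (simp add: V_def discounted_def present_value_def)
  have V_int: "integrable (P x) V"
  proof (rule Bochner_Integration.integrable_bound[OF D(1) V_meas])
    show "AE \<omega> in P x. norm (V \<omega>) \<le> norm (D \<omega>)"
      using D(2) AE_space
    proof eventually_elim
      case (elim \<omega>)
      show ?case
      proof (cases "\<sigma> \<omega> = \<infinity>")
        case False
        have "enn2real (?\<tau> \<omega>) \<le> enn2real (\<sigma> \<omega>)"
          using later[OF elim(2)] False by (intro enn2real_mono) (auto simp: less_top)
        then have "exp (- r * (enn2real (\<sigma> \<omega>) - enn2real (?\<tau> \<omega>))) \<le> 1"
          using r_pos by simp
        then have "\<bar>?Y (enn2real (\<sigma> \<omega>)) \<omega>\<bar> * exp (- r * (enn2real (\<sigma> \<omega>) - enn2real (?\<tau> \<omega>))) \<le> D \<omega> * 1"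
          using elim(1) D(3) by (intro mult_mono) auto
        then show ?thesis using False D(3) by (simp add: V_def discounted_def abs_mult)
      qed (simp add: V_def discounted_def)
    qed
  qed
  have U_int: "integrable (P x) U"
  proof (rule Bochner_Integration.integrable_bound[OF D(1) measurable_from_subalg[OF G.subalg U_G]])
    show "AE \<omega> in P x. norm (U \<omega>) \<le> norm (D \<omega>)"
      using D(2) by eventually_elim (use D(3) in \<open>simp add: U_def at_time_def\<close>)
  qed
  have w_bounds: "0 < w \<omega> \<and> w \<omega> \<le> 1" for \<omega> using r_pos by (simp add: w_def)
  define W where "W \<omega> = w \<omega> * (CV \<omega> - U \<omega>)" for \<omega>
  have W_G: "W \<in> borel_measurable ?G"
    unfolding W_def[abs_def] CV_def using U_G w_G by measurable
  define B where "B = {\<omega> \<in> space ?G. W \<omega> < 0}"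
  have B: "B \<in> sets ?G" unfolding B_def using W_G by measurable
  have B_law [measurable]: "B \<in> sets (P x)" using B G.subalg by (auto simp: subalgebra_def)
  have w_law [measurable]: "w \<in> borel_measurable (P x)" by (rule measurable_from_subalg[OF G.subalg w_G])
  \<comment> \<open>Waiting until \<open>\<sigma>\<close> exactly where this looks profitable is an admissible delay.\<close>
  let ?\<sigma>' = "\<lambda>\<omega>. if \<omega> \<in> B then \<sigma> \<omega> else ?\<tau> \<omega>"
  have "0 \<le> (\<integral>\<omega>. present_value r ?Y \<omega> (?\<sigma>' \<omega>) - present_value r ?Y \<omega> (?\<tau> \<omega>) \<partial>P x)"
    using later by (intro delaying_does_not_pay stopping_time_switch \<tau> \<sigma> B a crossing) auto
  also have "\<dots> = (\<integral>\<omega>. (indicator B \<omega> * w \<omega>) * V \<omega> - (indicator B \<omega> * w \<omega>) * U \<omega> \<partial>P x)"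
    by (intro Bochner_Integration.integral_cong refl) (auto simp: wU wV mult.assoc split: split_indicator)
  also have "\<dots> = (\<integral>\<omega>. (indicator B \<omega> * w \<omega>) * CV \<omega> - (indicator B \<omega> * w \<omega>) * U \<omega> \<partial>P x)"
  proof -
    have factor: "integrable (P x) (\<lambda>\<omega>. (indicator B \<omega> * w \<omega>) * Z \<omega>)" if Z: "integrable (P x) Z" for Z
    proof (rule Bochner_Integration.integrable_bound[OF Z])
      show "AE \<omega> in P x. norm (indicator B \<omega> * w \<omega> * Z \<omega>) \<le> norm (Z \<omega>)"
        using w_bounds by (intro AE_I2) (auto simp: abs_mult mult_left_le_one_le less_imp_le split: split_indicator)
      show "(\<lambda>\<omega>. indicator B \<omega> * w \<omega> * Z \<omega>) \<in> borel_measurable (P x)"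
        using borel_measurable_integrable[OF Z] by measurable
    qed
    have BwG: "(\<lambda>\<omega>. indicator B \<omega> * w \<omega>) \<in> borel_measurable ?G" using B w_G by measurable
    note cond = G.real_cond_exp_intg[OF factor[OF V_int] BwG V_meas]
    show ?thesis
      unfolding CV_def using cond factor[OF V_int] factor[OF U_int]
      by (simp add: Bochner_Integration.integral_diff)
  qed
  also have "\<dots> = (\<integral>\<omega>. indicator B \<omega> * W \<omega> \<partial>P x)"
    by (intro Bochner_Integration.integral_cong refl) (simp add: W_def algebra_simps)
  finally have nonneg: "0 \<le> (\<integral>\<omega>. indicator B \<omega> * W \<omega> \<partial>P x)" .
  have W_int: "integrable (P x) (\<lambda>\<omega>. indicator B \<omega> * W \<omega>)"
  proof (rule Bochner_Integration.integrable_bound)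
    show "integrable (P x) (\<lambda>\<omega>. CV \<omega> - U \<omega>)"
      unfolding CV_def by (intro Bochner_Integration.integrable_diff G.real_cond_exp_int V_int U_int)
    show "(\<lambda>\<omega>. indicator B \<omega> * W \<omega>) \<in> borel_measurable (P x)"
      using measurable_from_subalg[OF G.subalg W_G] by measurable
    show "AE \<omega> in P x. norm (indicator B \<omega> * W \<omega>) \<le> norm (CV \<omega> - U \<omega>)"
      using w_bounds by (intro AE_I2) (auto simp: W_def abs_mult mult_left_le_one_le less_imp_le split: split_indicator)
  qed
  have nonpos: "indicator B \<omega> * W \<omega> \<le> 0" for \<omega> by (auto simp: B_def split: split_indicator)
  have "(\<integral>\<omega>. - (indicator B \<omega> * W \<omega>) \<partial>P x) = 0"
    using nonneg integral_nonneg_AE[of "\<lambda>\<omega>. - (indicator B \<omega> * W \<omega>)" "P x"] nonpos by simp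
  then have "AE \<omega> in P x. - (indicator B \<omega> * W \<omega>) = 0"
    using W_int nonpos by (subst (asm) integral_nonneg_eq_0_iff_AE) auto
  then have "AE \<omega> in P x. U \<omega> \<le> CV \<omega>"
    using AE_space
  proof eventually_elim
    case (elim \<omega>)
    then have "\<not> W \<omega> < 0" by (auto simp: B_def ext.space_pre_sigma)
    then show ?case using w_bounds[of \<omega>] by (simp add: W_def zero_le_mult_iff not_less)
  qed
  then show ?thesis unfolding U_def CV_def V_def .
qed

lemma snell_envelope_at_level_time:
  assumes snell: "is_snell_envelope (P x) F r (subgradient k p) S" and a: "0 \<le> a"
    and crossing: "AE \<omega> in P x. \<forall>t\<ge>0. level_time \<theta> a \<omega> < ennreal t \<longrightarrow> a < \<theta> t \<omega>"
  shows "AE \<omega> in P x. at_time (subgradient k p) (level_time \<theta> a) \<omega> = at_time S (level_time \<theta> a) \<omega>"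
proof -
  let ?Y = "subgradient k p"
  let ?\<tau> = "level_time \<theta> a"
  let ?G = "stopped_sigma (P x) F ?\<tau>"
  let ?\<Phi> = "{real_cond_exp (P x) ?G (discounted r ?Y ?\<tau> \<sigma>) | \<sigma>.
             is_stopping_time (P x) F \<sigma> \<and> (\<forall>\<omega>\<in>space (P x). ?\<tau> \<omega> \<le> \<sigma> \<omega>)}"
  have \<tau>: "is_stopping_time (P x) F ?\<tau>" by (rule stopping_time_level[OF optimal_increasing])
  interpret G: sigma_finite_subalgebra "P x" ?G
    by (rule conditional_expectation_law[OF subalgebra_stopped[OF \<tau>]])
  have inf: "is_ess_inf (P x) ?\<Phi> (at_time S ?\<tau>)"
    using snell \<tau> by (simp add: is_snell_envelope_def)
  have Y_G: "at_time ?Y ?\<tau> \<in> borel_measurable ?G"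
    by (rule measurable_at_stopping_time[OF subgradient_adapted subgradient_cadlag \<tau>])
  have Y_law: "at_time ?Y ?\<tau> \<in> borel_measurable (P x)" by (rule measurable_from_subalg[OF G.subalg Y_G])
  have lower: "AE \<omega> in P x. at_time ?Y ?\<tau> \<omega> \<le> at_time S ?\<tau> \<omega>"
  proof -
    have "\<forall>f\<in>?\<Phi>. AE \<omega> in P x. at_time ?Y ?\<tau> \<omega> \<le> f \<omega>"
      using subgradient_le_conditional_expectation[OF _ a _ crossing] by auto
    then show ?thesis using inf Y_law by (auto simp: is_ess_inf_def)
  qed
  \<comment> \<open>The choice of \<open>\<tau>\<close> itself as the later stopping time gives the reverse inequality.\<close>
  have "real_cond_exp (P x) ?G (discounted r ?Y ?\<tau> ?\<tau>) \<in> ?\<Phi>" using \<tau> by auto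
  moreover have "discounted r ?Y ?\<tau> ?\<tau> = at_time ?Y ?\<tau>"
    by (auto simp: discounted_def at_time_def fun_eq_iff)
  ultimately have "AE \<omega> in P x. at_time S ?\<tau> \<omega> \<le> real_cond_exp (P x) ?G (at_time ?Y ?\<tau>) \<omega>"
    using inf by (auto simp: is_ess_inf_def)
  moreover have "AE \<omega> in P x. real_cond_exp (P x) ?G (at_time ?Y ?\<tau>) \<omega> = at_time ?Y ?\<tau> \<omega>"
  proof (rule G.real_cond_exp_F_meas[OF _ Y_G])
    obtain D where D: "integrable (P x) D" "AE \<omega> in P x. \<forall>t\<ge>0. \<bar>?Y t \<omega>\<bar> \<le> D \<omega>" "\<forall>\<omega>. 0 \<le> D \<omega>"
      by (rule subgradient_dominated)
    show "integrable (P x) (at_time ?Y ?\<tau>)"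
    proof (rule Bochner_Integration.integrable_bound[OF D(1) Y_law])
      show "AE \<omega> in P x. norm (at_time ?Y ?\<tau> \<omega>) \<le> norm (D \<omega>)"
        using D(2) by eventually_elim (use D(3) in \<open>simp add: at_time_def\<close>)
    qed
  qed
  ultimately show ?thesis using lower by eventually_elim simp
qed

end

end

section \<open>Almost every level\<close>

lemma progressive_measurable:
  assumes "progressive F S" and sub: "\<And>t. 0 \<le> t \<Longrightarrow> subalgebra M (F t)"
  shows "(\<lambda>(t, \<omega>). S (max 0 t) \<omega>) \<in> borel_measurable (borel \<Otimes>\<^sub>M M)"
proof -
  have stopped: "(\<lambda>z. S (min (max 0 (fst z)) (real n)) (snd z)) \<in> borel_measurable (borel \<Otimes>\<^sub>M M)" for n
  proof -
    have "(\<lambda>t. min (max 0 t) (real n)) \<in> borel \<rightarrow>\<^sub>M restrict_space borel {0..real n}"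
      by (intro measurable_restrict_space2) auto
    moreover have "(\<lambda>\<omega>. \<omega>) \<in> M \<rightarrow>\<^sub>M F n"
      by (rule measurable_from_subalg[OF sub measurable_ident_sets[OF refl]]) simp
    ultimately have "(\<lambda>z. (min (max 0 (fst z)) (real n), snd z)) \<in> borel \<Otimes>\<^sub>M M \<rightarrow>\<^sub>M restrict_space borel {0..real n} \<Otimes>\<^sub>M F n"
      by (intro measurable_Pair measurable_compose[OF measurable_fst] measurable_compose[OF measurable_snd])
    moreover have "(\<lambda>(s, \<omega>). S s \<omega>) \<in> borel_measurable (restrict_space borel {0..real n} \<Otimes>\<^sub>M F n)"
      using assms(1) by (simp add: progressive_def)
    ultimately show ?thesis using measurable_compose by fastforce
  qed
  have "(\<lambda>n. S (min (max 0 (fst z)) (real n)) (snd z)) \<longlonglongrightarrow> S (max 0 (fst z)) (snd z)" for z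
  proof (rule tendsto_eventually)
    obtain N where "max 0 (fst z) \<le> real N" using real_arch_simple by blast
    then have "min (max 0 (fst z)) (real n) = max 0 (fst z)" if "N \<le> n" for n
      using that by (intro min_absorb1) (meson of_nat_le_iff order_trans)
    then show "\<forall>\<^sub>F n in sequentially. S (min (max 0 (fst z)) (real n)) (snd z) = S (max 0 (fst z)) (snd z)"
      unfolding eventually_sequentially by (intro exI[of _ N]) simp
  qed
  from borel_measurable_LIMSEQ_real[OF this stopped] show ?thesis by (simp add: case_prod_beta)
qed

context singular_control_setting
begin

text \<open>If \<open>\<theta>\<close> does not exceed \<open>a\<close> immediately after the level time of \<open>a\<close>, then the level times jump
  at \<open>a\<close>. On each path there are countably many such levels, but a set of levels common to almost
  all paths is wanted. A level at which the expectation of a strictly decreasing bounded function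
  \<open>\<rho>\<close> of the level time is continuous has the required property, since a jump of the level time on
  an event of positive probability makes this expectation jump.\<close>

lemma almost_all_levels_crossed:
  assumes inc: "increasing_process (P x) F \<theta>"
  shows "AE a in lborel. AE \<omega> in P x. \<forall>t\<ge>0. level_time \<theta> a \<omega> < ennreal t \<longrightarrow> a < \<theta> t \<omega>"
proof -
  define \<rho> where "\<rho> T = (if T = \<infinity> then 0 else exp (- enn2real T))" for T :: ennreal
  have \<rho>_mono: "\<rho> U \<le> \<rho> T" if "T \<le> U" for T U
  proof (cases "U = \<infinity>")
    case False
    then have "T \<noteq> \<infinity>" "enn2real T \<le> enn2real U"
      using that by (auto simp: top_unique less_top intro!: enn2real_mono)
    then show ?thesis using False by (simp add: \<rho>_def)
  qed (simp add: \<rho>_def)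
  have [measurable]: "\<rho> \<in> borel_measurable borel" unfolding \<rho>_def[abs_def] by measurable
  note [measurable] = measurable_level_time_state[OF inc]
  have int: "integrable (P x) (\<lambda>\<omega>. \<rho> (level_time \<theta> a \<omega>))" for a
  proof (rule law.integrable_const_bound[where B=1])
    show "AE \<omega> in P x. norm (\<rho> (level_time \<theta> a \<omega>)) \<le> 1" by (auto simp: \<rho>_def)
  qed measurable
  define \<phi> where "\<phi> a = - (\<integral>\<omega>. \<rho> (level_time \<theta> a \<omega>) \<partial>P x)" for a
  have "mono \<phi>"
    unfolding \<phi>_def by (intro monoI le_imp_neg_le integral_mono int \<rho>_mono level_time_mono)
  then have "countable {a. \<not> isCont \<phi> a}" by (rule mono_ctble_discont)
  then have "{a. \<not> isCont \<phi> a} \<in> null_sets lborel" by (rule countable_imp_null_set_lborel)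
  then have "AE a in lborel. isCont \<phi> a" by (rule AE_I') auto
  then show ?thesis
  proof eventually_elim
    case (elim a)
    let ?D = "\<lambda>n \<omega>. \<rho> (level_time \<theta> a \<omega>) - \<rho> (level_time \<theta> (a + 1 / Suc n) \<omega>)"
    have D_nonneg: "0 \<le> ?D n \<omega>" for n \<omega>
      using \<rho>_mono[OF level_time_mono, of a "a + 1 / Suc n" \<theta> \<omega>] by simp
    have D_int: "integrable (P x) (?D n)" for n by (intro Bochner_Integration.integrable_diff int)
    have "(\<lambda>n. a + 1 / real (Suc n)) \<longlonglongrightarrow> a"
      using tendsto_add[OF tendsto_const LIMSEQ_Suc[OF lim_1_over_n], of a] by simp
    then have "(\<lambda>n. \<phi> (a + 1 / Suc n)) \<longlonglongrightarrow> \<phi> a"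
      using elim by (rule isCont_tendsto_compose[rotated])
    then have "(\<lambda>n. \<phi> (a + 1 / Suc n) - \<phi> a) \<longlonglongrightarrow> \<phi> a - \<phi> a"
      by (intro tendsto_diff tendsto_const)
    moreover have "\<phi> (a + 1 / Suc n) - \<phi> a = (\<integral>\<omega>. ?D n \<omega> \<partial>P x)" for n
      unfolding \<phi>_def by (subst Bochner_Integration.integral_diff[OF int int]) simp
    ultimately have lim: "(\<lambda>n. \<integral>\<omega>. ?D n \<omega> \<partial>P x) \<longlonglongrightarrow> 0" by simp
    have "(\<integral>\<^sup>+ \<omega>. (INF n. ennreal (?D n \<omega>)) \<partial>P x) \<le> ennreal 0"
    proof (rule tendsto_lowerbound[OF tendsto_ennrealI[OF lim]])
      have "(\<integral>\<^sup>+ \<omega>. (INF n. ennreal (?D n \<omega>)) \<partial>P x) \<le> ennreal (\<integral>\<omega>. ?D n \<omega> \<partial>P x)" for n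
      proof -
        have "(\<integral>\<^sup>+ \<omega>. (INF n. ennreal (?D n \<omega>)) \<partial>P x) \<le> (\<integral>\<^sup>+ \<omega>. ennreal (?D n \<omega>) \<partial>P x)"
          by (intro nn_integral_mono INF_lower) simp
        also have "\<dots> = ennreal (\<integral>\<omega>. ?D n \<omega> \<partial>P x)"
          by (intro nn_integral_eq_integral D_int AE_I2 D_nonneg)
        finally show ?thesis .
      qed
      then show "\<forall>\<^sub>F n in sequentially. (\<integral>\<^sup>+ \<omega>. (INF n. ennreal (?D n \<omega>)) \<partial>P x) \<le> ennreal (\<integral>\<omega>. ?D n \<omega> \<partial>P x)"
        by simp
    qed simp
    then have zero: "(\<integral>\<^sup>+ \<omega>. (INF n. ennreal (?D n \<omega>)) \<partial>P x) = 0" by simp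
    have "(\<lambda>\<omega>. INF n. ennreal (?D n \<omega>)) \<in> borel_measurable (P x)" by measurable
    from nn_integral_0_iff_AE[OF this] zero
    have "AE \<omega> in P x. (INF n. ennreal (?D n \<omega>)) = 0" by blast
    then show ?case
      using AE_space
    proof eventually_elim
      case (elim \<omega>)
      show ?case
      proof (intro allI impI, rule ccontr)
        fix t :: real assume t: "0 \<le> t" and less: "level_time \<theta> a \<omega> < ennreal t" and "\<not> a < \<theta> t \<omega>"
        define gap where "gap = \<rho> (level_time \<theta> a \<omega>) - exp (- t)"
        have "ennreal gap \<le> ennreal (?D n \<omega>)" for n
        proof -
          have "\<not> a + 1 / Suc n \<le> \<theta> t \<omega>"
            using \<open>\<not> a < \<theta> t \<omega>\<close> by (smt (verit) of_nat_0_less_iff zero_less_Suc zero_less_divide_1_iff)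
          then have "ennreal t \<le> level_time \<theta> (a + 1 / Suc n) \<omega>"
            using level_time_le[OF inc elim(2) t, of "a + 1 / Suc n"] by simp
          then have "\<rho> (level_time \<theta> (a + 1 / Suc n) \<omega>) \<le> \<rho> (ennreal t)" by (rule \<rho>_mono)
          also have "\<rho> (ennreal t) = exp (- t)" using t by (simp add: \<rho>_def)
          finally show ?thesis unfolding gap_def by (intro ennreal_leI) simp
        qed
        then have "ennreal gap \<le> (INF n. ennreal (?D n \<omega>))" by (intro INF_greatest)
        then have "gap \<le> 0" using elim(1) by (simp add: ennreal_eq_0_iff)
        moreover obtain s where "level_time \<theta> a \<omega> = ennreal s" "0 \<le> s" "s < t"
          using less by (cases "level_time \<theta> a \<omega>") (auto simp: ennreal_less_iff)
        ultimately show False by (simp add: gap_def \<rho>_def)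
      qed
    qed
  qed
qed

text \<open>The exceptional null set may depend on the level. Joint measurability turns it into null sets
  of levels that depend on the state, which the Stieltjes integral ignores.\<close>

lemma flat_off_levels:
  assumes inc: "increasing_process (P x) F \<theta>"
    and Y: "(\<lambda>(t, \<omega>). Y (max 0 t) \<omega>) \<in> borel_measurable (borel \<Otimes>\<^sub>M P x)"
    and Z: "(\<lambda>(t, \<omega>). Z (max 0 t) \<omega>) \<in> borel_measurable (borel \<Otimes>\<^sub>M P x)"
    and levels: "AE b in lborel. 0 < b \<longrightarrow> (AE \<omega> in P x. at_time Y (level_time \<theta> b) \<omega> = at_time Z (level_time \<theta> b) \<omega>)"
  shows "flat_off (P x) \<theta> (\<lambda>\<omega>. {t. 0 \<le> t \<and> Y t \<omega> = Z t \<omega>})"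
proof -
  interpret levels: pair_sigma_finite lborel "P x" ..
  let ?T = "\<lambda>b \<omega>. level_time \<theta> b \<omega>"
  have T [measurable]: "(\<lambda>z. ?T (fst z) (snd z)) \<in> borel_measurable (lborel \<Otimes>\<^sub>M P x)"
    using measurable_level_time[OF inc] by (simp add: case_prod_beta)
  have at: "(\<lambda>z. at_time W (?T (fst z)) (snd z)) \<in> borel_measurable (lborel \<Otimes>\<^sub>M P x)"
    if W: "(\<lambda>(t, \<omega>). W (max 0 t) \<omega>) \<in> borel_measurable (borel \<Otimes>\<^sub>M P x)" for W
  proof -
    have "(\<lambda>z. (enn2real (?T (fst z) (snd z)), snd z)) \<in> lborel \<Otimes>\<^sub>M P x \<rightarrow>\<^sub>M borel \<Otimes>\<^sub>M P x"
      by measurable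
    from measurable_compose[OF this W]
    have [measurable]: "(\<lambda>z. W (enn2real (?T (fst z) (snd z))) (snd z)) \<in> borel_measurable (lborel \<Otimes>\<^sub>M P x)"
      by simp
    show ?thesis unfolding at_time_def by measurable
  qed
  note [measurable] = at[OF Y] at[OF Z]
  have "AE b in lborel. AE \<omega> in P x. 0 < b \<longrightarrow> at_time Y (?T b) \<omega> = at_time Z (?T b) \<omega>"
    using levels by eventually_elim auto
  then have "AE \<omega> in P x. AE b in lborel. 0 < b \<longrightarrow> at_time Y (?T b) \<omega> = at_time Z (?T b) \<omega>"
    by (subst levels.AE_commute[symmetric]) measurable
  then show ?thesis
    unfolding flat_off_def using AE_space
  proof eventually_elim
    case (elim \<omega>)
    let ?\<Gamma> = "{t. 0 \<le> t \<and> Y t \<omega> = Z t \<omega>}"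
    have path: "(\<lambda>t. W t \<omega>) \<in> borel_measurable time_measure"
      if "(\<lambda>(t, \<omega>). W (max 0 t) \<omega>) \<in> borel_measurable (borel \<Otimes>\<^sub>M P x)" for W
      using measurable_compose[OF measurable_Pair1'[OF elim(2)] measurable_pair_time[OF that]] by simp
    have meas: "(indicator (- ?\<Gamma>) :: real \<Rightarrow> ennreal) \<in> borel_measurable time_measure"
    proof -
      note [measurable] = path[OF Y] path[OF Z]
      have split: "(\<lambda>t. if Y t \<omega> = Z t \<omega> then 0 else 1 :: ennreal) \<in> borel_measurable time_measure" by measurable
      have eq: "(if Y t \<omega> = Z t \<omega> then 0 else 1 :: ennreal) = indicator (- ?\<Gamma>) t"
        if "t \<in> space time_measure" for t
        using that by (auto simp: space_restrict_space split: split_indicator)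
      have "(\<lambda>t. if Y t \<omega> = Z t \<omega> then 0 else 1 :: ennreal) \<in> borel_measurable time_measure
          \<longleftrightarrow> (\<lambda>t. indicator (- ?\<Gamma>) t :: ennreal) \<in> borel_measurable time_measure"
        by (rule measurable_cong) (rule eq)
      then show ?thesis using split by blast
    qed
    have "(\<integral>\<^sup>+ t\<in>{0..}. indicator (- ?\<Gamma>) t \<partial>stieltjes \<theta> \<omega>)
        = (\<integral>\<^sup>+ b. indicator (- ?\<Gamma>) (enn2real (?T b \<omega>)) * indicator {b. 0 < b \<and> ?T b \<omega> < \<infinity>} b \<partial>lborel)"
      by (rule nn_integral_stieltjes[OF inc elim(2) meas])
    also have "\<dots> = (\<integral>\<^sup>+ b. 0 \<partial>(lborel :: real measure))"
    proof (rule nn_integral_cong_AE)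
      show "AE b in lborel. indicator (- ?\<Gamma>) (enn2real (?T b \<omega>)) * indicator {b. 0 < b \<and> ?T b \<omega> < \<infinity>} b = (0 :: ennreal)"
        using elim(1) by eventually_elim (auto simp: at_time_def split: split_indicator if_splits)
    qed
    finally show ?case by simp
  qed
qed

end

theorem corollary8:
  fixes A :: "'a measure" and F :: "real \<Rightarrow> 'a measure" and P :: "real \<Rightarrow> 'a measure"
    and X k \<theta> p S :: "real \<Rightarrow> 'a \<Rightarrow> real"
    and c c\<theta> :: "real \<Rightarrow> real \<Rightarrow> real \<Rightarrow> real" and r x :: real
  assumes "singular_control_setting A F P X k c c\<theta> r x"
    and "optimal_control (P x) F X k c r \<theta>"
    and "is_adjoint (P x) F X c\<theta> r \<theta> p"
    and "is_snell_envelope (P x) F r (subgradient k p) S"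
  shows "flat_off (P x) \<theta> (\<lambda>\<omega>. {t. 0 \<le> t \<and> subgradient k p t \<omega> = S t \<omega>})"
proof -
  interpret singular_control_setting A F P X k c c\<theta> r x by fact
  note inc = optimal_increasing[OF assms(2,3)]
  show ?thesis
  proof (rule flat_off_levels[OF inc])
    show "(\<lambda>(t, \<omega>). subgradient k p (max 0 t) \<omega>) \<in> borel_measurable (borel \<Otimes>\<^sub>M P x)"
      by (intro measurable_process subgradient_adapted[OF assms(2,3)] subgradient_cadlag[OF assms(2,3)])
    show "(\<lambda>(t, \<omega>). S (max 0 t) \<omega>) \<in> borel_measurable (borel \<Otimes>\<^sub>M P x)"
      using assms(4) by (intro progressive_measurable[OF _ subalgebra_law]) (simp_all add: is_snell_envelope_def)
    show "AE b in lborel. 0 < b \<longrightarrow> (AE \<omega> in P x.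
        at_time (subgradient k p) (level_time \<theta> b) \<omega> = at_time S (level_time \<theta> b) \<omega>)"
      using almost_all_levels_crossed[OF inc]
      by (rule eventually_mono) (intro impI snell_envelope_at_level_time[OF assms(2,3,4)] less_imp_le)
  qed
qed

end
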